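(* There is an algorithm which, given an instance of $1|r_j;\mathrm{pmtn};L=1|E$ with $n$ jobs, computes the optimum value, i.e. the minimum number of gaps of a feasible preemptive schedule, in time $O(n^5)$.
   Context: Time is discrete, divided into unit slots $[t,t+1)$, $t\in\mathbb{Z}$. An instance consists of $n$ jobs; job $j$ has integer processing time $p_j\ge1$, integer release time $r_j$ and integer deadline $d_j$. A feasible preemptive schedule assigns to each slot at most one job so that each job $j$ receives exactly $p_j$ slots, all in $[r_j,d_j)$. A gap is a maximal finite interval of idle slots (idle intervals before the first busy slot and after the last busy slot are not gaps). For $L=1$ the energy objective equals the number of gaps; the problem $1|r_j;\mathrm{pmtn};L=1|E$ is to minimize the number of gaps over feasible preemptive schedules. *)

theory Defs
  imports Main
begin

type_synonym job = "int \<times> int \<times> int"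

definition ptime :: "job \<Rightarrow> int" where "ptime j = fst j"
definition rel :: "job \<Rightarrow> int" where "rel j = fst (snd j)"
definition dl :: "job \<Rightarrow> int" where "dl j = snd (snd j)"

definition valid_instance :: "job list \<Rightarrow> bool" where
  "valid_instance J \<longleftrightarrow> (\<forall>j < length J. ptime (J ! j) \<ge> 1)"

text \<open>A schedule assigns to each unit slot [t, t+1) at most one job (None = idle).\<close>
type_synonym schedule = "int \<Rightarrow> nat option"

definition feasible_schedule :: "job list \<Rightarrow> schedule \<Rightarrow> bool" where
  "feasible_schedule J S \<longleftrightarrow>
     (\<forall>t j. S t = Some j \<longrightarrow> j < length J \<and> rel (J ! j) \<le> t \<and> t < dl (J ! j)) \<and>
     (\<forall>j < length J. finite {t. S t = Some j} \<and> int (card {t. S t = Some j}) = ptime (J ! j))"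

definition feasible_instance :: "job list \<Rightarrow> bool" where
  "feasible_instance J \<longleftrightarrow> (\<exists>S. feasible_schedule J S)"

definition gaps :: "schedule \<Rightarrow> (int \<times> int) set" where
  "gaps S = {(a, b). a < b \<and> (\<forall>t. a \<le> t \<and> t < b \<longrightarrow> S t = None)
                     \<and> S (a - 1) \<noteq> None \<and> S b \<noteq> None}"

definition num_gaps :: "schedule \<Rightarrow> nat" where
  "num_gaps S = card (gaps S)"

definition opt_gaps :: "job list \<Rightarrow> nat" where
  "opt_gaps J = (LEAST g. \<exists>S. feasible_schedule J S \<and> num_gaps S = g)"

datatype instr =
    LoadConst int int
  | AddI int int int
  | SubI int int int
  | LoadInd int int
  | StoreInd int int
  | JumpLe int int nat
  | Halt

type_synonym prog = "instr list"
type_synonym config = "nat \<times> (int \<Rightarrow> int)"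

definition halted :: "prog \<Rightarrow> config \<Rightarrow> bool" where
  "halted P c \<longleftrightarrow> (fst c \<ge> length P \<or> P ! fst c = Halt)"

fun exec_instr :: "instr \<Rightarrow> config \<Rightarrow> config" where
  "exec_instr (LoadConst a v) (pc, M) = (Suc pc, M(a := v))"
| "exec_instr (AddI a b c) (pc, M) = (Suc pc, M(a := M b + M c))"
| "exec_instr (SubI a b c) (pc, M) = (Suc pc, M(a := M b - M c))"
| "exec_instr (LoadInd a b) (pc, M) = (Suc pc, M(a := M (M b)))"
| "exec_instr (StoreInd a b) (pc, M) = (Suc pc, M(M a := M b))"
| "exec_instr (JumpLe a b k) (pc, M) = (if M a \<le> M b then k else Suc pc, M)"
| "exec_instr Halt c = c"

definition step :: "prog \<Rightarrow> config \<Rightarrow> config" where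
  "step P c = (if halted P c then c else exec_instr (P ! fst c) c)"

text \<open>Input encoding: M[0] = n, and for job i (0-based) M[3i+1] = p_i,
  M[3i+2] = r_i, M[3i+3] = d_i; all other cells 0. Output: M[0] on halting.\<close>
definition encode :: "job list \<Rightarrow> int \<Rightarrow> int" where
  "encode J x =
     (if x = 0 then int (length J)
      else if 1 \<le> x \<and> x \<le> 3 * int (length J) then
        (let i = nat ((x - 1) div 3); k = (x - 1) mod 3 in
           if k = 0 then ptime (J ! i) else if k = 1 then rel (J ! i) else dl (J ! i))
      else 0)"

definition computes_within :: "prog \<Rightarrow> job list \<Rightarrow> nat \<Rightarrow> int \<Rightarrow> bool" where
  "computes_within P J T v \<longleftrightarrow>
     (\<exists>k \<le> T. halted P ((step P ^^ k) (0, encode J))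
             \<and> snd ((step P ^^ k) (0, encode J)) 0 = v)"

end

theory Submission
  imports Defs
begin

text \<open>
  Serve the jobs by earliest deadline; then a schedule is determined by its set of busy slots. With
  the jobs sorted by deadline, the pending work of the first \<open>k\<close> jobs depends on the busy set only,
  and a busy set is feasible iff, for each \<open>k\<close>, none of that work is pending at the \<open>k\<close>-th deadline
  and no busy slot is useless, i.e. finds nothing pending.

  For a start time \<open>s\<close> let \<open>R k s g\<close> be the latest \<open>e\<close> such that those of the first \<open>k\<close> jobs which are
  released in \<open>[s, e)\<close> can be done inside \<open>[s, e)\<close> with at most \<open>g\<close> idle runs and without useless
  slots. The work of the next job goes into slots useless for the first \<open>k\<close> jobs: it bridges the
  stretch from \<open>R k s h\<close> to the next release, where another piece starts, and what is left of it is
  appended at the end, as far as its deadline permits. Since idle slots can be filled from the right,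
  a piece that could reach farther never does harm, so only the maximal reaches matter, and computing
  \<open>R (k + 1) s\<close> from \<open>R k\<close> is a shortest path problem with \<open>O(n\<^sup>3)\<close> relaxations. With \<open>n\<close> values of
  \<open>k\<close> and \<open>n + 1\<close> starts this gives \<open>O(n\<^sup>5)\<close>. The optimum is one less than the least \<open>g\<close> for which the reach
  from a start before all releases passes all releases.
\<close>

section \<open>Pending work and idle runs\<close>

text \<open>The new job has the latest deadline, hence the lowest priority under earliest deadline
  service: it cannot disturb the older jobs and lives on the slots they leave useless. A finished
  piece has no useless slot, so each of its busy slots does work. The obstacle is that an arbitrary
  schedule need not consist of maximal pieces. \<open>compress\<close> supplies the exchange: a
  piece that reaches too far is squeezed to any end by which the never-idling schedule is done,
  without more idle runs. In the shortest path problem a node is a release time together with a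
  number of idle runs, and its cost is the amount of the new job spent so far. The number
  \<open>h\<close> of further idle runs fixes an edge, since \<open>R\<close> and the next release
  determine where it leads; hence three factors of order n. Edges lead to later release times, so
  one pass in increasing order suffices. Costs are stored but never enumerated, which keeps the
  bound independent of the processing times. \<open>T\<close> lies above all deadlines and is the
  value of a reach that has passed all releases with an idle run to spare.\<close>

fun qn :: "(int \<Rightarrow> nat) \<Rightarrow> int set \<Rightarrow> int \<Rightarrow> nat \<Rightarrow> nat" where
  "qn A B s 0 = 0"
| "qn A B s (Suc i) = qn A B s i + A (s + int i) - (if s + int i \<in> B then 1 else 0)"

text \<open>Releases before \<open>s\<close> are ignored, and those at \<open>t\<close> are not yet
  counted. The truncated subtraction in \<open>qn\<close> is what makes a busy slot with nothing to
  do harmless: it changes nothing.\<close>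

definition pend :: "(int \<Rightarrow> nat) \<Rightarrow> int set \<Rightarrow> int \<Rightarrow> int \<Rightarrow> nat" where
  "pend A B s t = qn A B s (nat (t - s))"

lemma pend_start [simp]: "pend A B s s = 0"
  by (simp add: pend_def)

lemma pend_step: "s \<le> t \<Longrightarrow> pend A B s (t + 1) = pend A B s t + A t - (if t \<in> B then 1 else 0)"
proof -
  assume "s \<le> t"
  hence "nat (t + 1 - s) = Suc (nat (t - s))" "s + int (nat (t - s)) = t" by linarith+
  thus ?thesis by (simp add: pend_def)
qed

lemma pend_mono:
  assumes "s \<le> t" and "\<And>u. s \<le> u \<Longrightarrow> u < t \<Longrightarrow> u \<in> B \<Longrightarrow> u \<in> B'"
    and "\<And>u. s \<le> u \<Longrightarrow> u < t \<Longrightarrow> A' u \<le> A u"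
  shows "pend A' B' s t \<le> pend A B s t"
  using assms
proof (induction t rule: int_ge_induct)
  case base show ?case by simp
next
  case (step i)
  have "pend A' B' s i \<le> pend A B s i" using step by auto
  moreover have "A' i \<le> A i" "i \<in> B \<Longrightarrow> i \<in> B'" using step by auto
  ultimately show ?case using step(1) by (auto simp: pend_step)
qed

lemma pend_cong:
  assumes "s \<le> t" and "\<And>u. s \<le> u \<Longrightarrow> u < t \<Longrightarrow> u \<in> B \<longleftrightarrow> u \<in> B'"
    and "\<And>u. s \<le> u \<Longrightarrow> u < t \<Longrightarrow> A' u = A u"
  shows "pend A' B' s t = pend A B s t"
  using assms by (intro antisym pend_mono) auto

text \<open>Nothing pending means no memory: the count continues as one started afresh. All cutting
  and gluing of pieces rests on this.\<close>

lemma pend_restart: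
  assumes "s \<le> m" "m \<le> t" "pend A B s m = 0"
  shows "pend A B s t = pend A B m t"
  using assms(2)
proof (induction t rule: int_ge_induct)
  case base show ?case using assms by simp
next
  case (step i) thus ?case using assms by (simp add: pend_step)
qed

lemma pend_later_start:
  assumes "s \<le> m" "m \<le> t"
  shows "pend A B m t \<le> pend A B s t"
  using assms(2)
proof (induction t rule: int_ge_induct)
  case base show ?case by simp
next
  case (step i) thus ?case using assms by (simp add: pend_step)
qed

lemma pend_no_arrivals:
  assumes "s \<le> m" "m \<le> t" "pend A B s m = 0" "\<And>u. m \<le> u \<Longrightarrow> u < t \<Longrightarrow> A u = 0"
  shows "pend A B s t = 0"
  using assms(2,4)
proof (induction t rule: int_ge_induct)
  case base show ?case using assms by simp
next
  case (step i) thus ?case using assms(1) by (simp add: pend_step)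
qed

text \<open>Unlike gaps, the idle runs at the beginning and at the end of \<open>[s, e)\<close> count.\<close>
definition runs :: "int set \<Rightarrow> int \<Rightarrow> int \<Rightarrow> nat" where
  "runs B s e = card {t. s \<le> t \<and> t < e \<and> t \<notin> B \<and> (t = s \<or> t - 1 \<in> B)}"

text \<open>The useless slots.\<close>
definition fil :: "(int \<Rightarrow> nat) \<Rightarrow> int set \<Rightarrow> int \<Rightarrow> int \<Rightarrow> int set" where
  "fil A B s e = {t. s \<le> t \<and> t < e \<and> t \<in> B \<and> pend A B s t + A t = 0}"

definition join_at :: "int \<Rightarrow> int set \<Rightarrow> int set \<Rightarrow> int set" where
  "join_at m B1 B2 = {t. if t < m then t \<in> B1 else t \<in> B2}"

lemma finite_int_range [simp]: "finite {t::int. s \<le> t \<and> t < e \<and> P t}"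
  by (rule finite_subset[of _ "{s..<e}"]) auto

lemma finite_fil [simp]: "finite (fil A B s e)"
  by (simp add: fil_def)

lemma runs_mono_end: "e \<le> e' \<Longrightarrow> runs B s e \<le> runs B s e'"
  unfolding runs_def by (rule card_mono) auto

lemma runs_cong:
  assumes "\<And>u. s \<le> u \<Longrightarrow> u < e \<Longrightarrow> u \<in> B \<longleftrightarrow> u \<in> B'"
  shows "runs B s e = runs B' s e"
proof -
  have "{t. s \<le> t \<and> t < e \<and> t \<notin> B \<and> (t = s \<or> t - 1 \<in> B)} = {t. s \<le> t \<and> t < e \<and> t \<notin> B' \<and> (t = s \<or> t - 1 \<in> B')}"
    using assms by (intro Collect_cong) (smt (verit, best))
  thus ?thesis unfolding runs_def by simp
qed

text \<open>An idle run that straddles \<open>m\<close> is counted once on the left and in both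
  summands on the right; the correction term accounts for it.\<close>

lemma runs_split:
  assumes "s \<le> m" "m \<le> e"
  shows "runs B s e + (if s < m \<and> m < e \<and> m - 1 \<notin> B \<and> m \<notin> B then 1 else 0) = runs B s m + runs B m e"
proof -
  let ?S = "\<lambda>s e. {t. s \<le> t \<and> t < e \<and> t \<notin> B \<and> (t = s \<or> t - 1 \<in> B)}"
  let ?c = "s < m \<and> m < e \<and> m - 1 \<notin> B \<and> m \<notin> B"
  have d: "?S s m \<inter> ?S m e = {}" by auto
  have u: "?S s m \<union> ?S m e = ?S s e \<union> (if ?c then {m} else {})"
    using assms by (auto split: if_splits)
  have "card (?S s m) + card (?S m e) = card (?S s m \<union> ?S m e)"
    using d by (simp add: card_Un_disjoint)
  also have "\<dots> = card (?S s e) + (if ?c then 1 else 0)"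
    unfolding u by (subst card_Un_disjoint) auto
  finally show ?thesis unfolding runs_def by simp
qed

text \<open>The first idle slot after the busy slot \<open>z\<close> opens a run which
  \<open>runs B s z\<close> has not counted.\<close>

lemma runs_idle_after_busy:
  assumes "s \<le> z" "z \<in> B" "z < u" "u \<notin> B" "u < e"
  shows "runs B s z + 1 \<le> runs B s e"
proof -
  let ?P = "\<lambda>i. z + int i \<notin> B"
  have ex: "?P (nat (u - z))" using assms by simp
  define i where "i = (LEAST i. ?P i)"
  have i: "?P i" "i \<le> nat (u - z)" unfolding i_def using ex by (rule LeastI, rule Least_le)
  have i0: "i \<noteq> 0" using i(1) assms(2) by (cases i) auto
  have "\<not> ?P (i - 1)" unfolding i_def using not_less_Least[of "i - 1" ?P] i0 i_def by simp
  hence b: "z + int i - 1 \<in> B" using i0 by (simp add: of_nat_diff algebra_simps)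
  let ?S = "\<lambda>s e. {t. s \<le> t \<and> t < e \<and> t \<notin> B \<and> (t = s \<or> t - 1 \<in> B)}"
  have "insert (z + int i) (?S s z) \<subseteq> ?S s e" using i b assms i0 by auto
  hence "card (insert (z + int i) (?S s z)) \<le> card (?S s e)" by (rule card_mono[rotated]) simp
  thus ?thesis unfolding runs_def by simp
qed

lemma fil_cong:
  assumes "\<And>u. s \<le> u \<Longrightarrow> u < e \<Longrightarrow> u \<in> B \<longleftrightarrow> u \<in> B'"
  shows "fil A B s e = fil A B' s e"
proof -
  have "pend A B s t = pend A B' s t" if "s \<le> t" "t < e" for t
    using assms that by (intro pend_cong) auto
  thus ?thesis unfolding fil_def using assms by auto
qed

lemma fil_split:
  assumes "s \<le> m" "m \<le> e" "pend A B s m = 0"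
  shows "fil A B s e = fil A B s m \<union> fil A B m e"
  unfolding fil_def using assms pend_restart[OF assms(1) _ assms(3)] by auto

text \<open>Any schedule without useless slots can be squeezed to end at \<open>\<tau>\<close>, provided the
  never-idling one is done by then: fill idle slots from the right until the work fits.\<close>
lemma compress:
  assumes st: "s \<le> \<tau>" and nf: "fil A B s \<tau> = {}" and full: "pend A UNIV s \<tau> = 0"
  shows "\<exists>B'. B \<subseteq> B' \<and> fil A B' s \<tau> = {} \<and> pend A B' s \<tau> = 0 \<and> runs B' s \<tau> \<le> runs B s \<tau>"
proof -
  let ?Z = "{z. s \<le> z \<and> z \<le> \<tau> \<and> pend A (B \<union> {z..}) s \<tau> = 0}"
  have fin: "finite ?Z" by (rule finite_subset[of _ "{s..\<tau>}"]) auto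
  have "pend A (B \<union> {s..}) s \<tau> = pend A UNIV s \<tau>" using st by (intro pend_cong) auto
  hence "s \<in> ?Z" using st full by simp
  hence ne: "?Z \<noteq> {}" by blast
  \<comment> \<open>The latest point from which filling all idle slots makes the work fit. If
    \<open>z < \<tau>\<close>, filling from \<open>z + 1\<close> only leaves work pending all the
    way to \<open>\<tau>\<close>, and this excludes useless slots.\<close>
  define z where "z = Max ?Z"
  have zZ: "z \<in> ?Z" unfolding z_def using fin ne by (rule Max_in)
  let ?B0 = "B \<union> {z..}" and ?B1 = "B \<union> {z + 1..}"
  have r: "runs ?B0 s \<tau> \<le> runs B s \<tau>" unfolding runs_def by (rule card_mono) auto
  show ?thesis
  proof (cases "z = \<tau>")
    case True
    have "pend A ?B0 s \<tau> = pend A B s \<tau>" using st True by (intro pend_cong) auto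
    thus ?thesis using zZ nf by (intro exI[of _ B]) auto
  next
    case False
    hence zt: "z < \<tau>" "s \<le> z" using zZ by auto
    have n1: "pend A ?B1 s \<tau> \<noteq> 0"
    proof
      assume "pend A ?B1 s \<tau> = 0"
      hence "z + 1 \<in> ?Z" using zt by auto
      hence "z + 1 \<le> z" unfolding z_def using fin by (rule Max_ge[rotated])
      thus False by simp
    qed
    have pos: "pend A ?B1 s t > 0" if t: "z + 1 \<le> t" "t \<le> \<tau>" for t
    proof (rule ccontr)
      assume "\<not> ?thesis"
      hence 0: "pend A ?B1 s t = 0" by simp
      have "pend A ?B1 s \<tau> = pend A ?B1 t \<tau>" using pend_restart[OF _ _ 0] t zt by auto
      also have "\<dots> = pend A UNIV t \<tau>" using t by (intro pend_cong) auto
      also have "\<dots> \<le> pend A UNIV s \<tau>" using t zt by (intro pend_later_start) auto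
      finally show False using n1 full by simp
    qed
    \<comment> \<open>Giving up the one slot \<open>z\<close> delays at most one unit of work. So if
      work is still pending after a busy slot under \<open>?B1\<close>, there was something to serve
      in that slot under \<open>?B0\<close>.\<close>
    have close: "pend A ?B1 s t \<le> pend A ?B0 s t + 1" if "z + 1 \<le> t" for t
      using that
    proof (induction t rule: int_ge_induct)
      case base
      have "pend A ?B1 s z = pend A ?B0 s z" using zt by (intro pend_cong) auto
      thus ?case using zt by (simp add: pend_step)
    next
      case (step i) thus ?case using zt by (simp add: pend_step)
    qed
    have "pend A ?B0 s t + A t > 0" if t: "s \<le> t" "t < \<tau>" "t \<in> ?B0" for t
    proof -
      consider "t < z" | "t = z" | "z < t" by linarith
      thus ?thesis
      proof cases
        case 1
        have "pend A ?B0 s t = pend A B s t" using t 1 by (intro pend_cong) auto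
        thus ?thesis using t 1 nf by (auto simp: fil_def)
      next
        case 2
        have e: "pend A ?B1 s z = pend A ?B0 s z" using zt by (intro pend_cong) auto
        have "0 < pend A ?B1 s (z + 1)" using pos[of "z + 1"] zt by simp
        hence "0 < pend A ?B0 s z + A z" using zt e by (simp only: pend_step)
        thus ?thesis using 2 by simp
      next
        case 3
        have "0 < pend A ?B1 s (t + 1)" using pos[of "t + 1"] 3 t by simp
        moreover have "pend A ?B1 s t \<le> pend A ?B0 s t + 1" using close 3 by simp
        ultimately show ?thesis using t 3 by (simp add: pend_step) linarith
      qed
    qed
    hence "fil A ?B0 s \<tau> = {}" unfolding fil_def by (auto, fastforce+)
    thus ?thesis using zZ r by (intro exI[of _ ?B0]) auto
  qed
qed


section \<open>Levels of jobs\<close>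

definition arr :: "job list \<Rightarrow> int \<Rightarrow> nat" where
  "arr js t = (\<Sum>x\<leftarrow>js. if rel x = t then nat (ptime x) else 0)"

lemma arr_Nil [simp]: "arr [] t = 0"
  by (simp add: arr_def)

lemma arr_snoc: "arr (js @ [x]) t = arr js t + (if rel x = t then nat (ptime x) else 0)"
  by (simp add: arr_def)

lemma arr_take_le: "arr (take i js) t \<le> arr js t"
proof -
  have "arr js t = arr (take i js @ drop i js) t" by simp
  also have "\<dots> = arr (take i js) t + arr (drop i js) t" unfolding arr_def by (simp del: append_take_drop_id)
  finally show ?thesis by simp
qed

lemma arr_eq_0: "t \<notin> rel ` set js \<Longrightarrow> arr js t = 0"
  unfolding arr_def by (induction js) auto

lemma arr_pos: "t \<in> rel ` set js \<Longrightarrow> \<forall>x\<in>set js. 1 \<le> ptime x \<Longrightarrow> 0 < arr js t"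
  unfolding arr_def by (induction js) auto

text \<open>With the jobs sorted by deadline, earliest deadline service treats each prefix as if the
  later jobs did not exist, so each prefix has a pending count of its own. Asking for 0 at every
  time from the deadline on, not only at the deadline, keeps the condition meaningful when intervals
  are cut and glued.\<close>

definition dl_ok :: "job list \<Rightarrow> int set \<Rightarrow> int \<Rightarrow> int \<Rightarrow> bool" where
  "dl_ok js B s e \<longleftrightarrow> (\<forall>i<length js. \<forall>t. s \<le> t \<and> dl (js ! i) \<le> t \<and> t \<le> e \<longrightarrow> pend (arr (take (Suc i) js)) B s t = 0)"

lemma dl_ok_snoc:
  "dl_ok (js @ [x]) B s e \<longleftrightarrow>
     dl_ok js B s e \<and> (\<forall>t. s \<le> t \<and> dl x \<le> t \<and> t \<le> e \<longrightarrow> pend (arr (js @ [x])) B s t = 0)"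
  unfolding dl_ok_def by (auto simp: less_Suc_eq nth_append)

lemma dl_ok_mono:
  assumes "dl_ok js B s e" "e' \<le> e" "\<And>u. s \<le> u \<Longrightarrow> u < e' \<Longrightarrow> u \<in> B \<Longrightarrow> u \<in> B'"
  shows "dl_ok js B' s e'"
  unfolding dl_ok_def
proof (intro allI impI)
  fix i t assume i: "i < length js" and t: "s \<le> t \<and> dl (js ! i) \<le> t \<and> t \<le> e'"
  have "pend (arr (take (Suc i) js)) B s t = 0" using assms(1,2) i t unfolding dl_ok_def by auto
  moreover have "pend (arr (take (Suc i) js)) B' s t \<le> pend (arr (take (Suc i) js)) B s t"
    using t assms(3) by (intro pend_mono) auto
  ultimately show "pend (arr (take (Suc i) js)) B' s t = 0" by simp
qed

definition sched :: "job list \<Rightarrow> int set \<Rightarrow> int \<Rightarrow> int \<Rightarrow> bool" where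
  "sched js B s e \<longleftrightarrow> s \<le> e \<and> pend (arr js) B s e = 0 \<and> dl_ok js B s e"

lemma pend_take_0: "pend (arr js) B s m = 0 \<Longrightarrow> s \<le> m \<Longrightarrow> pend (arr (take i js)) B s m = 0"
  using pend_mono[of s m B B "arr (take i js)" "arr js"] arr_take_le[of i js] by auto

lemma sched_split:
  assumes "sched js B s e" "s \<le> m" "m \<le> e" "pend (arr js) B s m = 0"
  shows "sched js B s m" "sched js B m e"
proof -
  show "sched js B s m" using assms dl_ok_mono unfolding sched_def by blast
  have "pend (arr js) B m e = 0" using assms pend_restart unfolding sched_def by metis
  moreover have "dl_ok js B m e" unfolding dl_ok_def
  proof (intro allI impI)
    fix i t assume i: "i < length js" and t: "m \<le> t \<and> dl (js ! i) \<le> t \<and> t \<le> e"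
    have "pend (arr (take (Suc i) js)) B s t = 0"
      using assms i t unfolding sched_def dl_ok_def by auto
    thus "pend (arr (take (Suc i) js)) B m t = 0"
      using pend_later_start[of s m t "arr (take (Suc i) js)" B] assms t by simp
  qed
  ultimately show "sched js B m e" using assms unfolding sched_def by simp
qed

text \<open>At \<open>m\<close> the whole list has nothing pending, hence no prefix has, and every
  prefix count restarts there.\<close>

lemma dl_ok_glue:
  assumes "sched js B s m" "dl_ok js B m e"
  shows "dl_ok js B s e"
  unfolding dl_ok_def
proof (intro allI impI)
  fix i t assume i: "i < length js" and t: "s \<le> t \<and> dl (js ! i) \<le> t \<and> t \<le> e"
  show "pend (arr (take (Suc i) js)) B s t = 0"
  proof (cases "t \<le> m")
    case True thus ?thesis using assms i t unfolding sched_def dl_ok_def by auto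
  next
    case False
    have "pend (arr (take (Suc i) js)) B s t = pend (arr (take (Suc i) js)) B m t"
      using assms False by (intro pend_restart pend_take_0) (auto simp: sched_def)
    thus ?thesis using assms(2) i t False unfolding dl_ok_def by auto
  qed
qed

lemma sched_glue:
  assumes "sched js B s m" "sched js B m e"
  shows "sched js B s e"
proof -
  have "pend (arr js) B s e = pend (arr js) B m e"
    using assms by (intro pend_restart) (auto simp: sched_def)
  thus ?thesis using assms dl_ok_glue unfolding sched_def by fastforce
qed

lemma sched_cong:
  assumes "\<And>u. s \<le> u \<Longrightarrow> u < e \<Longrightarrow> u \<in> B \<longleftrightarrow> u \<in> B'"
  shows "sched js B s e = sched js B' s e"
proof (cases "s \<le> e")
  case True
  have "pend (arr js) B s e = pend (arr js) B' s e" using True assms by (intro pend_cong) auto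
  moreover have "dl_ok js B s e = dl_ok js B' s e" using assms dl_ok_mono[of js _ s e e] by blast
  ultimately show ?thesis unfolding sched_def by simp
qed (simp add: sched_def)

lemma cut_left: "u < m \<Longrightarrow> u \<in> join_at m B1 B2 \<longleftrightarrow> u \<in> B1"
  and cut_right: "m \<le> u \<Longrightarrow> u \<in> join_at m B1 B2 \<longleftrightarrow> u \<in> B2"
  by (auto simp: join_at_def)

lemma sched_cut:
  assumes "sched js B1 s m" "sched js B2 m e"
  shows "sched js (join_at m B1 B2) s e"
proof (rule sched_glue)
  show "sched js (join_at m B1 B2) s m" using assms(1) sched_cong[of s m "join_at m B1 B2" B1 js] by (simp add: cut_left)
  show "sched js (join_at m B1 B2) m e" using assms(2) sched_cong[of m e "join_at m B1 B2" B2 js] by (simp add: cut_right)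
qed

lemma fil_cut:
  assumes "s \<le> m" "m \<le> e" "pend A B1 s m = 0"
  shows "fil A (join_at m B1 B2) s e = fil A B1 s m \<union> fil A B2 m e"
proof -
  have "pend A (join_at m B1 B2) s m = pend A B1 s m" using assms(1) by (intro pend_cong) (auto simp: cut_left)
  hence "fil A (join_at m B1 B2) s e = fil A (join_at m B1 B2) s m \<union> fil A (join_at m B1 B2) m e"
    using assms by (intro fil_split) auto
  moreover have "fil A (join_at m B1 B2) s m = fil A B1 s m" by (rule fil_cong) (simp add: cut_left)
  moreover have "fil A (join_at m B1 B2) m e = fil A B2 m e" by (rule fil_cong) (simp add: cut_right)
  ultimately show ?thesis by simp
qed

lemma runs_cut:
  assumes "s \<le> m" "m \<le> e"
  shows "runs (join_at m B1 B2) s e + (if s < m \<and> m < e \<and> m - 1 \<notin> B1 \<and> m \<notin> B2 then 1 else 0)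
    = runs B1 s m + runs B2 m e"
proof -
  have "runs (join_at m B1 B2) s m = runs B1 s m" by (rule runs_cong) (simp add: cut_left)
  moreover have "runs (join_at m B1 B2) m e = runs B2 m e" by (rule runs_cong) (simp add: cut_right)
  ultimately show ?thesis using runs_split[OF assms, of "join_at m B1 B2"] by (simp add: cut_left cut_right)
qed

section \<open>Reaches and how far they extend\<close>

definition reach :: "job list \<Rightarrow> int \<Rightarrow> nat \<Rightarrow> int \<Rightarrow> bool" where
  "reach js s g e \<longleftrightarrow> (\<exists>B. sched js B s e \<and> fil (arr js) B s e = {} \<and> runs B s e \<le> g)"

text \<open>The last condition is feasibility: the never-idling service meets all deadlines from
  every start.\<close>

definition good :: "int \<Rightarrow> job list \<Rightarrow> bool" where
  "good T js \<longleftrightarrow> (\<forall>x\<in>set js. 1 \<le> ptime x \<and> rel x < dl x \<and> dl x < T) \<and> sorted (map dl js) \<and>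
     (\<forall>s e. dl_ok js UNIV s e)"

definition mreach :: "int \<Rightarrow> job list \<Rightarrow> int \<Rightarrow> nat \<Rightarrow> int" where
  "mreach T js s g = Max {e. s \<le> e \<and> e \<le> T \<and> reach js s g e}"

lemma good_snocD: "good T (js @ [x]) \<Longrightarrow> good T js"
  unfolding good_def dl_ok_snoc by (auto simp: sorted_append)

lemma runs_refl [simp]: "runs B s s = 0"
  by (simp add: runs_def)

lemma fil_refl [simp]: "fil A B s s = {}"
  by (simp add: fil_def)

lemma pend_after_dl:
  assumes "good T js" "s \<le> t" "\<forall>x\<in>set js. dl x \<le> t"
    "dl_ok js B s t"
  shows "pend (arr js) B s t = 0"
proof (cases js rule: rev_cases)
  case Nil thus ?thesis using assms(2) pend_no_arrivals[of s s t "arr js" B] by simp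
next
  case (snoc ys y)
  thus ?thesis using assms by (simp add: dl_ok_snoc)
qed

lemma sched_refl: "good T js \<Longrightarrow> sched js B s s"
  unfolding sched_def dl_ok_def by auto

lemma reach_refl: "good T js \<Longrightarrow> reach js s g s"
  unfolding reach_def using sched_refl by fastforce

lemma reach_mono: "reach js s g e \<Longrightarrow> g \<le> g' \<Longrightarrow> reach js s g' e"
  unfolding reach_def using le_trans by blast

lemma mreach_props:
  assumes "good T js" "s \<le> T"
  shows "s \<le> mreach T js s g" "mreach T js s g \<le> T" "reach js s g (mreach T js s g)"
    and "\<And>e. reach js s g e \<Longrightarrow> e \<le> T \<Longrightarrow> e \<le> mreach T js s g"
proof -
  let ?S = "{e. s \<le> e \<and> e \<le> T \<and> reach js s g e}"
  have fin: "finite ?S" by (rule finite_subset[of _ "{s..T}"]) auto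
  have "s \<in> ?S" using assms reach_refl by auto
  hence "Max ?S \<in> ?S" using fin Max_in by blast
  thus "s \<le> mreach T js s g" "mreach T js s g \<le> T" "reach js s g (mreach T js s g)"
    unfolding mreach_def by auto
  fix e assume "reach js s g e" "e \<le> T"
  moreover hence "s \<le> e" by (auto simp: reach_def sched_def)
  ultimately show "e \<le> mreach T js s g" unfolding mreach_def using fin by (intro Max_ge) auto
qed

lemma mreach_mono: "good T js \<Longrightarrow> s \<le> T \<Longrightarrow> g \<le> g' \<Longrightarrow> mreach T js s g \<le> mreach T js s g'"
  by (rule mreach_props(4)) (auto intro: mreach_props reach_mono)

text \<open>The appended idle stretch is one run, or none if it merges with an idle end of
  \<open>B\<close>.\<close>

lemma sched_idle:
  assumes "good T js" "sched js B s e" "e \<le> \<nu>" "\<And>u. e \<le> u \<Longrightarrow> u < \<nu> \<Longrightarrow> u \<notin> rel ` set js"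
  shows "sched js (join_at e B {}) s \<nu>" "fil (arr js) (join_at e B {}) s \<nu> = fil (arr js) B s e"
    "runs (join_at e B {}) s \<nu> \<le> runs B s e + 1"
proof -
  have p0: "pend (arr (take i js)) {} e t = 0" if "e \<le> t" "t \<le> \<nu>" for i t
  proof (rule pend_no_arrivals[of e e])
    fix u assume "e \<le> u" "u < t"
    hence "arr js u = 0" using that assms(4) by (intro arr_eq_0) auto
    thus "arr (take i js) u = 0" using arr_take_le[of i js u] by simp
  qed (use that in auto)
  have "sched js {} e \<nu>" unfolding sched_def dl_ok_def
    using assms(3) p0 p0[of \<nu> "length js"] by auto
  thus "sched js (join_at e B {}) s \<nu>" using assms(2) by (rule sched_cut[rotated])
  have "s \<le> e" "pend (arr js) B s e = 0" using assms(2) by (auto simp: sched_def)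
  thus "fil (arr js) (join_at e B {}) s \<nu> = fil (arr js) B s e"
    using fil_cut[of s e \<nu> "arr js" B "{}"] assms(3) by (simp add: fil_def)
  have "runs {} e \<nu> \<le> card {e}" unfolding runs_def by (rule card_mono) auto
  thus "runs (join_at e B {}) s \<nu> \<le> runs B s e + 1"
    using runs_cut[OF \<open>s \<le> e\<close> assms(3), of B "{}"] by (simp split: if_splits)
qed

lemma reach_idle:
  assumes "good T js" "reach js s g e" "e \<le> \<nu>" "\<And>u. e \<le> u \<Longrightarrow> u < \<nu> \<Longrightarrow> u \<notin> rel ` set js"
  shows "reach js s (g + 1) \<nu>"
proof -
  obtain B where B: "sched js B s e" "fil (arr js) B s e = {}" "runs B s e \<le> g"
    using assms(2) by (auto simp: reach_def)
  show ?thesis unfolding reach_def using sched_idle[OF assms(1) B(1) assms(3,4)] B(2,3)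
    by (intro exI[of _ "join_at e B {}"]) auto
qed

text \<open>At a release time there is work to do. The machine is kept busy until nothing is
  pending, which happens by time \<open>T\<close> because all deadlines lie before it; no idle slot
  is added, so \<open>k\<close> stays.\<close>

lemma reach_extend:
  assumes g: "good T js" and "reach js s k e" "e \<in> rel ` set js"
  shows "\<exists>e'>e. e' \<le> T \<and> reach js s k e'"
proof -
  obtain B where B: "sched js B s e" "fil (arr js) B s e = {}" "runs B s e \<le> k"
    using assms(2) by (auto simp: reach_def)
  let ?A = "arr js"
  have eT: "e < T" using g assms(3) unfolding good_def by force
  have "pend ?A UNIV e T = 0" using g eT by (intro pend_after_dl[OF g]) (auto simp: good_def)
  hence ex: "pend ?A UNIV e (e + int (Suc (nat (T - e - 1)))) = 0" using eT by simp
  \<comment> \<open>The first time after \<open>e\<close> with nothing pending. \<open>Suc\<close>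
    skips \<open>e\<close> itself, where the count is trivially 0.\<close>
  define i where "i = (LEAST i. pend ?A UNIV e (e + int (Suc i)) = 0)"
  have i: "pend ?A UNIV e (e + int (Suc i)) = 0" "i \<le> nat (T - e - 1)"
    unfolding i_def using ex by (rule LeastI, rule Least_le)
  let ?e = "e + int (Suc i)"
  have nz: "pend ?A UNIV e t \<noteq> 0" if "e < t" "t < ?e" for t
  proof -
    have "nat (t - e - 1) < i" using that by linarith
    hence "pend ?A UNIV e (e + int (Suc (nat (t - e - 1)))) \<noteq> 0"
      unfolding i_def by (rule not_less_Least)
    thus ?thesis using that by simp
  qed
  have "sched js UNIV e ?e" using i g by (auto simp: sched_def good_def)
  moreover have "fil ?A UNIV e ?e = {}"
  proof -
    have "0 < pend ?A UNIV e t + ?A t" if "e \<le> t" "t < ?e" for t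
      using nz[of t] arr_pos[OF assms(3)] g that by (cases "t = e") (auto simp: good_def)
    thus ?thesis unfolding fil_def by fastforce
  qed
  moreover have "runs UNIV e ?e = 0" by (simp add: runs_def)
  moreover have "s \<le> e" "pend ?A B s e = 0" using B(1) by (auto simp: sched_def)
  ultimately have "reach js s k ?e" unfolding reach_def
    using B sched_cut[OF B(1), of UNIV ?e] fil_cut[of s e ?e ?A B UNIV] runs_cut[of s e ?e B UNIV]
    by (intro exI[of _ "join_at e B UNIV"]) auto
  thus ?thesis using i(2) eT by (intro exI[of _ ?e]) auto
qed

definition is_next :: "job list \<Rightarrow> int \<Rightarrow> int \<Rightarrow> bool" where
  "is_next js e \<nu> \<longleftrightarrow> \<nu> \<in> rel ` set js \<and> e \<le> \<nu> \<and> (\<forall>x\<in>set js. e \<le> rel x \<longrightarrow> \<nu> \<le> rel x)"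

text \<open>A reach gets off a release time even without idle runs. This makes the release times
  along a chain strictly increasing.\<close>

lemma mreach_gt_release:
  assumes "good T js" "s \<in> rel ` set js"
  shows "s < mreach T js s g"
proof -
  have "s \<le> T" using assms unfolding good_def by force
  thus ?thesis using reach_extend[OF assms(1) reach_refl[OF assms(1)] assms(2)] mreach_props(4)[OF assms(1)]
    by (meson order_less_le_trans)
qed

lemma mreach_passes_next:
  assumes "good T js" "s \<le> T" "is_next js (mreach T js s g) \<nu>"
  shows "\<nu> < mreach T js s (Suc g)"
proof -
  have "reach js s (g + 1) \<nu>"
    using reach_idle[OF assms(1) mreach_props(3)[OF assms(1,2)], of g \<nu>] assms(3)
    unfolding is_next_def by fastforce
  then obtain e' where "e' > \<nu>" "e' \<le> T" "reach js s (g + 1) e'"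
    using reach_extend[OF assms(1)] assms(3) unfolding is_next_def by blast
  thus ?thesis using mreach_props(4)[OF assms(1,2), of "Suc g" e'] by simp
qed


section \<open>Chains of reaches\<close>

text \<open>\<open>chain R js \<rho> s \<mu> g c\<close>: pieces given by \<open>R\<close> lead from \<open>s\<close> to the release time \<open>\<mu>\<close> with \<open>g\<close>
  idle runs, if \<open>c\<close> units of an additional job released at \<open>\<rho>\<close> fill the stretches between them.\<close>
inductive chain :: "(int \<Rightarrow> nat \<Rightarrow> int) \<Rightarrow> job list \<Rightarrow> int \<Rightarrow> int \<Rightarrow> int \<Rightarrow> nat \<Rightarrow> int \<Rightarrow> bool"
  for R js \<rho> s where
  chain_refl: "chain R js \<rho> s s 0 0"
| chain_step: "chain R js \<rho> s \<mu> g c \<Longrightarrow> \<rho> \<le> R \<mu> h \<Longrightarrow> is_next js (R \<mu> h) \<nu> \<Longrightarrow>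
    chain R js \<rho> s \<nu> (g + h) (c + (\<nu> - R \<mu> h))"

text \<open>The inductive rule appends a step at the far end, as relaxation does; the completeness
  proof splits off the first step and uses this form.\<close>

lemma chain_Cons:
  assumes "chain R js \<rho> \<nu> \<mu> g c" "\<rho> \<le> R s h" "is_next js (R s h) \<nu>"
  shows "chain R js \<rho> s \<mu> (h + g) (\<nu> - R s h + c)"
  using assms
proof (induction rule: chain.induct)
  case chain_refl
  thus ?case using chain_step[OF chain.chain_refl[of R js \<rho> s], of h \<nu>] by simp
next
  case (chain_step \<mu> g c h' \<nu>')
  have "chain R js \<rho> s \<nu>' ((h + g) + h') ((\<nu> - R s h + c) + (\<nu>' - R \<mu> h'))"
    using chain_step by (intro chain.chain_step) auto
  thus ?case by (simp add: algebra_simps)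
qed

lemma chain_le_T:
  assumes "good T js" "s \<le> T" "chain R js \<rho> s \<mu> g c"
  shows "\<mu> \<le> T"
  using assms(3)
proof cases
  case (chain_step \<mu>' g' c' h)
  hence "\<mu> \<in> rel ` set js" by (simp add: is_next_def)
  thus ?thesis using assms(1) unfolding good_def by force
qed (use assms(2) in simp)

lemma fil_busy_no_arrivals:
  assumes "e \<le> \<nu>" "\<And>u. e \<le> u \<Longrightarrow> u < \<nu> \<Longrightarrow> A u = 0"
  shows "fil A UNIV e \<nu> = {e..<\<nu>}"
proof -
  have "pend A UNIV e t = 0" if "e \<le> t" "t < \<nu>" for t
    using that assms by - (rule pend_no_arrivals[of e e], auto)
  thus ?thesis unfolding fil_def using assms(2) by (intro set_eqI) auto
qed

lemma next_no_arrivals: "is_next js e \<nu> \<Longrightarrow> e \<le> u \<Longrightarrow> u < \<nu> \<Longrightarrow> u \<notin> rel ` set js"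
  unfolding is_next_def by (auto dest: leD)

text \<open>Between the reach of one piece and the next release the machine is kept busy. Nothing
  arrives there, so exactly these slots are useless, and the condition on \<open>\<rho>\<close> in
  each step keeps them from preceding the release of the additional job.\<close>

lemma chain_sound:
  assumes g: "good T js" and s: "s \<le> T" and "chain (mreach T js) js \<rho> s \<mu> k c"
  shows "\<exists>B. sched js B s \<mu> \<and> runs B s \<mu> \<le> k \<and> fil (arr js) B s \<mu> \<subseteq> {\<rho>..} \<and>
    int (card (fil (arr js) B s \<mu>)) = c"
  using assms(3)
proof (induction rule: chain.induct)
  case chain_refl thus ?case using sched_refl[OF g] by auto
next
  case (chain_step \<mu> k c h \<nu>)
  let ?e = "mreach T js \<mu> h" and ?A = "arr js"
  obtain B where B: "sched js B s \<mu>" "runs B s \<mu> \<le> k" "fil ?A B s \<mu> \<subseteq> {\<rho>..}" "int (card (fil ?A B s \<mu>)) = c"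
    using chain_step by blast
  have mT: "\<mu> \<le> T" using chain_le_T[OF g s chain_step(1)] .
  obtain B2 where B2: "sched js B2 \<mu> ?e" "fil ?A B2 \<mu> ?e = {}" "runs B2 \<mu> ?e \<le> h"
    using mreach_props(3)[OF g mT, of h] by (auto simp: reach_def)
  have le: "s \<le> \<mu>" "\<mu> \<le> ?e" "?e \<le> \<nu>" using B B2 chain_step(3) by (auto simp: sched_def is_next_def)
  have p: "pend ?A B s \<mu> = 0" "pend ?A B2 \<mu> ?e = 0" using B B2 by (auto simp: sched_def)
  have na: "?A u = 0" if "?e \<le> u" "u < \<nu>" for u
    using next_no_arrivals[OF chain_step(3) that] by (rule arr_eq_0)
  have s3: "sched js UNIV ?e \<nu>"
    using g le(3) pend_no_arrivals[of ?e ?e \<nu> ?A UNIV] na by (auto simp: sched_def good_def)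
  let ?B2 = "join_at ?e B2 UNIV"
  have S2: "sched js ?B2 \<mu> \<nu>" using sched_cut[OF B2(1) s3] .
  have F2: "fil ?A ?B2 \<mu> \<nu> = {?e..<\<nu>}"
    using fil_cut[of \<mu> ?e \<nu> ?A B2 UNIV] le p B2(2) fil_busy_no_arrivals[of ?e \<nu> ?A] na by simp
  have R2: "runs ?B2 \<mu> \<nu> \<le> h"
    using runs_cut[of \<mu> ?e \<nu> B2 UNIV] le B2(3) by (simp add: runs_def)
  let ?B = "join_at \<mu> B ?B2"
  have F: "fil ?A ?B s \<nu> = fil ?A B s \<mu> \<union> {?e..<\<nu>}"
    using fil_cut[of s \<mu> \<nu> ?A B ?B2] le p F2 by simp
  have "fil ?A B s \<mu> \<inter> {?e..<\<nu>} = {}" using le by (auto simp: fil_def)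
  hence "card (fil ?A ?B s \<nu>) = card (fil ?A B s \<mu>) + card {?e..<\<nu>}"
    unfolding F by (intro card_Un_disjoint) auto
  hence "int (card (fil ?A ?B s \<nu>)) = c + (\<nu> - ?e)" using B(4) le by simp
  moreover have "sched js ?B s \<nu>" using sched_cut[OF B(1) S2] .
  moreover have "runs ?B s \<nu> \<le> k + h" using runs_cut[of s \<mu> \<nu> B ?B2] le B(2) R2 by simp
  moreover have "fil ?A ?B s \<nu> \<subseteq> {\<rho>..}" unfolding F using B(3) chain_step(2) by auto
  ultimately show ?case by blast
qed

text \<open>Induction on the number of useless slots: let \<open>z\<close> be the first one and \<open>\<nu>\<close> the next
  release. Either the part before \<open>\<nu>\<close> can be redone without useless slots (squeezing the optimal
  reach, or idling up to \<open>\<nu>\<close>), or the useless slots fill all of \<open>[z, \<nu>)\<close>, which is a chain step.\<close>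
lemma chain_complete:
  assumes g: "good T js"
  shows "s \<le> T \<Longrightarrow> sched js B s e \<Longrightarrow> e \<le> T \<Longrightarrow> \<rho> \<le> e \<Longrightarrow> fil (arr js) B s e \<subseteq> {\<rho>..} \<Longrightarrow>
    runs B s e \<le> k \<Longrightarrow> card (fil (arr js) B s e) = n \<Longrightarrow>
    \<exists>\<mu> h c. chain (mreach T js) js \<rho> s \<mu> h c \<and> h \<le> k \<and> c \<le> int n \<and> \<rho> \<le> mreach T js \<mu> (k - h) \<and>
      e - int n \<le> mreach T js \<mu> (k - h) - c"
proof (induction n arbitrary: s B k rule: less_induct)
  case (less n)
  let ?A = "arr js" and ?R = "mreach T js"
  note sT = less.prems(1) and B = less.prems(2)
  have pe: "pend ?A B s e = 0" and se: "s \<le> e" using B by (auto simp: sched_def)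
  \<comment> \<open>The empty chain, with all \<open>k\<close> idle runs left for the last
    piece.\<close>
  have direct: ?case if "\<rho> \<le> ?R s k" "e - int n \<le> ?R s k"
    using that chain_refl[of ?R js \<rho> s] by (intro exI[of _ s] exI[of _ "0::nat"] exI[of _ "0::int"]) auto
  show ?case
  proof (cases "fil ?A B s e = {}")
    case True
    hence "reach js s k e" using B less.prems unfolding reach_def by blast
    hence "e \<le> ?R s k" using mreach_props(4)[OF g sT] less.prems by blast
    thus ?thesis using less.prems by (intro direct) auto
  next
    case False
    define z where "z = Min (fil ?A B s e)"
    have zF: "z \<in> fil ?A B s e" unfolding z_def using False by simp
    have zmin: "z \<le> u" if "u \<in> fil ?A B s e" for u unfolding z_def using that by simp
    have n0: "0 < n" using False less.prems(7) by (metis card_eq_0_iff finite_fil neq0_conv)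
    have z: "s \<le> z" "z < e" "z \<in> B" "pend ?A B s z = 0" "?A z = 0" "\<rho> \<le> z"
      using zF less.prems(5) by (auto simp: fil_def)
    define h where "h = runs B s z"
    have sz: "sched js B s z" using sched_split[OF B] z by simp
    have "fil ?A B s z = {}"
    proof -
      have "fil ?A B s z \<subseteq> fil ?A B s e" using z by (auto simp: fil_def)
      thus ?thesis using zmin by (force simp: fil_def)
    qed
    hence rz: "reach js s h z" using sz unfolding reach_def h_def by blast
    have hk: "h \<le> k" unfolding h_def using runs_mono_end[of z e B s] z less.prems(6) by simp
    let ?r = "?R s h"
    have zr: "z \<le> ?r" using mreach_props(4)[OF g sT rz] z less.prems by simp
    have rk: "?r \<le> ?R s k" using mreach_mono[OF g sT hk] .
    obtain B0 where B0: "sched js B0 s ?r" "fil ?A B0 s ?r = {}" "runs B0 s ?r \<le> h"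
      using mreach_props(3)[OF g sT, of h] by (auto simp: reach_def)
    \<comment> \<open>Exchange of the part before \<open>\<nu>\<close>: \<open>z\<close> disappears
      from the useless slots and none is added, so the induction hypothesis applies to the new busy
      set with the same \<open>s\<close> and \<open>k\<close>.\<close>
    have replace: ?thesis
      if \<nu>: "z < \<nu>" "\<nu> < e" "pend ?A B s \<nu> = 0" and B1: "sched js B1 s \<nu>" "fil ?A B1 s \<nu> = {}"
        and r1: "runs (join_at \<nu> B1 B) s e \<le> k" for \<nu> B1
    proof -
      let ?B = "join_at \<nu> B1 B"
      have s2: "sched js B \<nu> e" using sched_split[OF B] \<nu> z by simp
      have fs: "fil ?A B s e = fil ?A B s \<nu> \<union> fil ?A B \<nu> e" using \<nu> z by (intro fil_split) auto
      have f2: "fil ?A ?B s e = fil ?A B \<nu> e" using fil_cut[of s \<nu> e ?A B1 B] B1 \<nu> z by (simp add: sched_def)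
      have "z \<notin> fil ?A B \<nu> e" using \<nu> by (simp add: fil_def)
      hence "fil ?A ?B s e \<subset> fil ?A B s e" using f2 fs zF by auto
      hence lt: "card (fil ?A ?B s e) < n" using less.prems(7) by (metis finite_fil psubset_card_mono)
      have "fil ?A ?B s e \<subseteq> {\<rho>..}" using less.prems(5) f2 fs by auto
      from less.IH[OF lt sT sched_cut[OF B1(1) s2] less.prems(3,4) this r1 refl]
      obtain \<mu> h' c where "chain ?R js \<rho> s \<mu> h' c" "h' \<le> k" "c \<le> int (card (fil ?A ?B s e))"
        "\<rho> \<le> ?R \<mu> (k - h')" "e - int (card (fil ?A ?B s e)) \<le> ?R \<mu> (k - h') - c" by blast
      thus ?thesis using lt by (intro exI[of _ \<mu>] exI[of _ h'] exI[of _ c]) auto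
    qed
    consider "\<exists>\<nu>. is_next js z \<nu> \<and> \<nu> < e" | "\<forall>u. z \<le> u \<and> u < e \<longrightarrow> u \<notin> rel ` set js"
    proof (cases "\<exists>u. z \<le> u \<and> u < e \<and> u \<in> rel ` set js")
      case True
      let ?S = "{u \<in> rel ` set js. z \<le> u}"
      have ne: "?S \<noteq> {}" "finite ?S" using True by auto
      have "Min ?S \<in> ?S" using ne by (rule Min_in[rotated])
      moreover have "Min ?S \<le> u" if "u \<in> rel ` set js" "z \<le> u" for u using ne(2) that by (intro Min_le) auto
      ultimately have "is_next js z (Min ?S)" "Min ?S < e" using True unfolding is_next_def by force+
      thus ?thesis using that(1) by blast
    next
      case False thus ?thesis using that(2) by blast
    qed
    thus ?thesis
    proof cases
      case 1
      then obtain \<nu> where \<nu>: "is_next js z \<nu>" "\<nu> < e" by blast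
      have \<nu>z: "z < \<nu>"
      proof -
        have "z \<noteq> \<nu>" using z(5) arr_pos[of \<nu> js] \<nu>(1) g by (auto simp: is_next_def good_def)
        thus ?thesis using \<nu>(1) by (simp add: is_next_def)
      qed
      have na: "?A u = 0" if "z \<le> u" "u < \<nu>" for u using next_no_arrivals[OF \<nu>(1) that] by (rule arr_eq_0)
      have p\<nu>: "pend ?A B s t = 0" if "z \<le> t" "t \<le> \<nu>" for t
        using that z na by - (rule pend_no_arrivals[of s z], auto)
      have rs: "runs B s e + (if s < \<nu> \<and> \<nu> < e \<and> \<nu> - 1 \<notin> B \<and> \<nu> \<notin> B then 1 else 0) = runs B s \<nu> + runs B \<nu> e"
        using \<nu> z \<nu>z by (intro runs_split) auto
      have h\<nu>: "h \<le> runs B s \<nu>" unfolding h_def using \<nu>z by (intro runs_mono_end) simp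
      have h\<nu>': "h + 1 \<le> runs B s \<nu>" if "z < u" "u < \<nu>" "u \<notin> B" for u
        unfolding h_def using that z by (intro runs_idle_after_busy) auto
      \<comment> \<open>An idle slot \<open>\<nu> - 1\<close> means one run more than
        \<open>h\<close> in the original; this spare run pays for the correction term when an idle
        run straddles \<open>\<nu>\<close>.\<close>
      have h\<nu>1: "h + 1 \<le> runs B s \<nu>" if "\<nu> - 1 \<notin> B" using h\<nu>'[of "\<nu> - 1"] that \<nu>z z(3) by (cases "z = \<nu> - 1") auto
      show ?thesis
      proof (cases "\<nu> \<le> ?r")
        case True
        have sub: "fil ?A B0 s \<nu> = {}" using B0(2) True by (auto simp: fil_def)
        have "pend ?A UNIV s \<nu> \<le> pend ?A B s \<nu>" using z \<nu>z by (intro pend_mono) auto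
        hence "pend ?A UNIV s \<nu> = 0" using p\<nu>[of \<nu>] \<nu>z by simp
        \<comment> \<open>The optimal piece with \<open>h\<close> idle runs passes
          \<open>\<nu>\<close>. As \<open>B\<close> has nothing pending at \<open>\<nu>\<close>,
          neither has the never-idling service, so the piece can be squeezed to end there.\<close>
        then obtain B1 where B1: "B0 \<subseteq> B1" "fil ?A B1 s \<nu> = {}" "pend ?A B1 s \<nu> = 0" "runs B1 s \<nu> \<le> runs B0 s \<nu>"
          using compress[OF _ sub] z \<nu>z by auto
        have "dl_ok js B1 s \<nu>" using dl_ok_mono[of js B0 s ?r \<nu> B1] B0(1) True B1(1) by (auto simp: sched_def)
        hence S1: "sched js B1 s \<nu>" using B1(3) z \<nu>z by (simp add: sched_def)
        have r1: "runs B1 s \<nu> \<le> h" using B1(4) B0(3) runs_mono_end[of \<nu> ?r B0 s] True by simp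
        have "runs (join_at \<nu> B1 B) s e \<le> k"
          using runs_cut[of s \<nu> e B1 B] rs r1 h\<nu> h\<nu>1 \<nu> z \<nu>z less.prems(6) by (auto split: if_splits)
        thus ?thesis using replace[OF \<nu>z \<nu>(2) _ S1 B1(2)] p\<nu>[of \<nu>] \<nu>z by simp
      next
        case False
        hence r\<nu>: "?r < \<nu>" by simp
        have nx: "is_next js ?r \<nu>" using \<nu>(1) zr r\<nu> unfolding is_next_def by force
        show ?thesis
        proof (cases "\<exists>u. z < u \<and> u < \<nu> \<and> u \<notin> B")
          case True
          \<comment> \<open>The original also spends an idle run between \<open>z\<close> and
            \<open>\<nu>\<close>, so idling from \<open>?r\<close> to \<open>\<nu>\<close> costs no
            more. Being idle at \<open>\<nu> - 1\<close>, the new part even merges with an idle run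
            that continues at \<open>\<nu>\<close>.\<close>
          let ?B1 = "join_at ?r B0 {}"
          have S1: "sched js ?B1 s \<nu>" "fil ?A ?B1 s \<nu> = {}" "runs ?B1 s \<nu> \<le> h + 1"
            using sched_idle[OF g B0(1), of \<nu>] r\<nu> next_no_arrivals[OF nx] B0 by auto
          have "\<nu> - 1 \<notin> ?B1" using r\<nu> by (simp add: join_at_def)
          moreover have "h + 1 \<le> runs B s \<nu>" using h\<nu>' True by blast
          ultimately have "runs (join_at \<nu> ?B1 B) s e \<le> k"
            using runs_cut[of s \<nu> e ?B1 B] rs S1(3) \<nu>(2) z(1) \<nu>z less.prems(6) by (auto split: if_splits)
          thus ?thesis using replace[OF \<nu>z \<nu>(2) _ S1(1,2)] p\<nu>[of \<nu>] \<nu>z by simp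
        next
          case False
          hence busy: "u \<in> B" if "z \<le> u" "u < \<nu>" for u using that z(3) by (cases "u = z") auto
          have f1: "fil ?A B s \<nu> = {z..<\<nu>}"
          proof -
            have "{z..<\<nu>} \<subseteq> fil ?A B s \<nu>" using z busy p\<nu> na by (auto simp: fil_def)
            moreover have "fil ?A B s \<nu> \<subseteq> fil ?A B s e" using \<nu> by (auto simp: fil_def)
            ultimately show ?thesis using zmin by (force simp: fil_def)
          qed
          have fs: "fil ?A B s e = fil ?A B s \<nu> \<union> fil ?A B \<nu> e" using \<nu> z \<nu>z p\<nu>[of \<nu>] by (intro fil_split) auto
          have "fil ?A B s \<nu> \<inter> fil ?A B \<nu> e = {}" by (auto simp: fil_def)
          hence cn: "n = nat (\<nu> - z) + card (fil ?A B \<nu> e)"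
            using less.prems(7) unfolding fs f1 by (subst (asm) card_Un_disjoint) auto
          let ?n = "card (fil ?A B \<nu> e)"
          have lt: "?n < n" using cn \<nu>z by simp
          have "\<nu> - 1 \<in> B" using busy \<nu>z by simp
          hence rr: "runs B \<nu> e \<le> k - h" using rs h\<nu> less.prems(6) by simp
          have s2: "sched js B \<nu> e" using sched_split[OF B, of \<nu>] \<nu> z \<nu>z p\<nu>[of \<nu>] by simp
          have "\<nu> \<le> T" "fil ?A B \<nu> e \<subseteq> {\<rho>..}" using \<nu>(2) less.prems(3,5) fs by auto
          from less.IH[OF lt this(1) s2 less.prems(3,4) this(2) rr refl]
          obtain \<mu> h' c where c: "chain ?R js \<rho> \<nu> \<mu> h' c" "h' \<le> k - h" "c \<le> int ?n"
            "\<rho> \<le> ?R \<mu> (k - h - h')" "e - int ?n \<le> ?R \<mu> (k - h - h') - c" by blast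
          \<comment> \<open>The chain step costs \<open>\<nu> - ?r\<close>, at most the
            \<open>\<nu> - z\<close> useless slots that it replaces.\<close>
          have "chain ?R js \<rho> s \<mu> (h + h') (\<nu> - ?r + c)" using chain_Cons[OF c(1) _ nx] z(6) zr by simp
          thus ?thesis using c cn zr hk \<nu>z
            by (intro exI[of _ \<mu>] exI[of _ "h + h'"] exI[of _ "\<nu> - ?r + c"]) auto
        qed
      qed
    next
      case 2
      have na: "?A u = 0" if "z \<le> u" "u < e" for u using 2 that by (intro arr_eq_0) auto
      show ?thesis
      proof (cases "e \<le> ?r")
        case True thus ?thesis using rk less.prems(4) by (intro direct) auto
      next
        case False
        show ?thesis
        proof (cases "\<exists>u. z < u \<and> u < e \<and> u \<notin> B")
          case True
          then obtain u where u: "z < u" "u < e" "u \<notin> B" by blast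
          have "h + 1 \<le> k" using runs_idle_after_busy[OF z(1,3) u(1,3,2)] less.prems(6) h_def by simp
          moreover have "reach js s (h + 1) e" using False 2 zr
            by (intro reach_idle[OF g mreach_props(3)[OF g sT, of h]]) auto
          ultimately have "reach js s k e" using reach_mono by blast
          hence "e \<le> ?R s k" using mreach_props(4)[OF g sT] less.prems(3) by blast
          thus ?thesis using less.prems(4) by (intro direct) auto
        next
          case F: False
          hence busy: "u \<in> B" if "z \<le> u" "u < e" for u using that z(3) by (cases "u = z") auto
          have "pend ?A B s t = 0" if "z \<le> t" "t < e" for t
            using that z na by - (rule pend_no_arrivals[of s z], auto)
          hence "{z..<e} \<subseteq> fil ?A B s e" using z busy na by (auto simp: fil_def)
          hence "card {z..<e} \<le> n" using less.prems(7) card_mono[OF finite_fil] by blast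
          \<comment> \<open>All of \<open>[z, e)\<close> is useless here, so stepping back by
            \<open>n\<close> leads to \<open>z\<close> or earlier, and the reach with
            \<open>h\<close> idle runs gets to \<open>z\<close>.\<close>
          hence "e - int n \<le> z" using z by simp
          thus ?thesis using zr rk z(6) by (intro direct) auto
        qed
      qed
    qed
  qed
qed


section \<open>Adding the job with the latest deadline\<close>

lemma fil_step:
  assumes "s \<le> t"
  shows "fil A B s (t + 1) = (if t \<in> B \<and> pend A B s t + A t = 0 then insert t (fil A B s t) else fil A B s t)"
  unfolding fil_def using assms by (auto simp: zle_add1_eq_le le_less)

text \<open>The new job is served exactly in the slots which the older jobs leave useless.\<close>
lemma pend_snoc:
  assumes "s \<le> rel x" "s \<le> t"
  shows "pend (arr (js @ [x])) B s t = pend (arr js) B s t +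
    (if rel x < t then nat (ptime x) - card {u \<in> fil (arr js) B s t. rel x \<le> u} else 0)"
  using assms(2)
proof (induction t rule: int_ge_induct)
  case base thus ?case using assms(1) by simp
next
  case (step i)
  let ?F = "\<lambda>t. {u \<in> fil (arr js) B s t. rel x \<le> u}"
  have notin: "i \<notin> ?F i" by (simp add: fil_def)
  have "?F (i + 1) = (if i \<in> B \<and> pend (arr js) B s i + arr js i = 0 \<and> rel x \<le> i then insert i (?F i) else ?F i)"
    using fil_step[OF step(1), of "arr js" B] by auto
  hence cF: "card (?F (i + 1)) = (if i \<in> B \<and> pend (arr js) B s i + arr js i = 0 \<and> rel x \<le> i then Suc (card (?F i)) else card (?F i))"
 (is "_ = ?c")
  proof -
    have ci: "card (insert i (?F i)) = Suc (card (?F i))" by (rule card_insert_disjoint[OF _ notin]) simp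
    show ?thesis unfolding \<open>?F (i + 1) = _\<close> by (auto simp only: ci split: if_split)
  qed
  consider "i < rel x" | "i = rel x" | "rel x < i" by linarith
  thus ?case
  proof cases
    case 1 thus ?thesis using step by (simp add: pend_step arr_snoc)
  next
    case 2
    hence "?F i = {}" by (auto simp: fil_def)
    hence "card (?F i) = 0" by (simp only: card.empty)
    thus ?thesis using 2 step cF by (auto simp: pend_step arr_snoc simp del: card_0_eq card_eq_0_iff)
  next
    case 3
    thus ?thesis using step cF by (auto simp: pend_step arr_snoc)
  qed
qed

lemma pend_snoc_before:
  assumes "s \<le> t" "rel x < s \<or> t \<le> rel x"
  shows "pend (arr (js @ [x])) B s t = pend (arr js) B s t"
  using assms by (intro pend_cong) (auto simp: arr_snoc)

lemma sched_snocD: "sched (js @ [x]) B s e \<Longrightarrow> sched js B s e"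
  unfolding sched_def dl_ok_snoc using pend_take_0[of "js @ [x]" B s e "length js"] by auto

text \<open>A job released outside \<open>[s, e)\<close> brings no work. Its deadline adds no
  condition either: by then all older deadlines have passed, so the older jobs have nothing
  pending.\<close>

lemma sched_snoc_before:
  assumes g: "good T (js @ [x])" and "rel x < s \<or> e \<le> rel x"
  shows "sched (js @ [x]) B s e = sched js B s e"
proof
  assume S: "sched js B s e"
  have "pend (arr (js @ [x])) B s t = 0" if t: "s \<le> t" "dl x \<le> t" "t \<le> e" for t
  proof -
    have "pend (arr (js @ [x])) B s t = pend (arr js) B s t" using assms t by (intro pend_snoc_before) auto
    also have "\<dots> = 0"
    proof (rule pend_after_dl[OF good_snocD[OF g] t(1)])
      show "\<forall>x\<in>set js. dl x \<le> t" using g t unfolding good_def by (auto simp: sorted_append)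
      show "dl_ok js B s t" using S t dl_ok_mono unfolding sched_def by blast
    qed
    finally show ?thesis .
  qed
  moreover have "s \<le> e \<Longrightarrow> pend (arr (js @ [x])) B s e = pend (arr js) B s e" using assms by (intro pend_snoc_before) auto
  ultimately show "sched (js @ [x]) B s e" using S unfolding sched_def dl_ok_snoc by auto
qed (rule sched_snocD)

lemma reach_snoc_before:
  assumes g: "good T (js @ [x])" and "rel x < s \<or> e \<le> rel x"
  shows "reach (js @ [x]) s k e = reach js s k e"
proof -
  have "fil (arr (js @ [x])) B s e = fil (arr js) B s e" for B
  proof -
    have "pend (arr (js @ [x])) B s t = pend (arr js) B s t \<and> arr (js @ [x]) t = arr js t" if "s \<le> t" "t < e" for t
      using assms that by (auto simp: arr_snoc intro!: pend_snoc_before)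
    thus ?thesis unfolding fil_def by auto
  qed
  thus ?thesis unfolding reach_def using sched_snoc_before[OF assms] by simp
qed

lemma mreach_snoc_later:
  assumes "good T (js @ [x])" "rel x < s"
  shows "mreach T (js @ [x]) s k = mreach T js s k"
  unfolding mreach_def using reach_snoc_before[OF assms(1), of s _ k] assms(2) by simp

text \<open>The new job takes the useless slots, and after \<open>e\<close> the machine stays busy.
  If everything is done by \<open>dl x\<close>, the first such time is the new end. Otherwise the
  never-idling service still meets \<open>dl x\<close>, and squeezing gives a piece that ends
  exactly there.\<close>

lemma reach_snoc_sound:
  assumes g: "good T (js @ [x])" and B: "sched js B s e" and x: "s \<le> rel x" "rel x \<le> e"
    and F: "fil (arr js) B s e \<subseteq> {rel x..}" "int (card (fil (arr js) B s e)) \<le> ptime x"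
    and r: "runs B s e \<le> k"
  shows "\<exists>e'. reach (js @ [x]) s k e' \<and> e' \<le> T \<and> min (dl x) (e + ptime x - int (card (fil (arr js) B s e))) \<le> e'"
proof -
  let ?L = "arr js" and ?K = "arr (js @ [x])" and ?r = "rel x" and ?d = "dl x" and ?c = "card (fil (arr js) B s e)"
  have px: "1 \<le> ptime x" "?r < ?d" "?d < T" and gj: "good T js" using g good_snocD[OF g] by (auto simp: good_def)
  have se: "s \<le> e" using B by (simp add: sched_def)
  let ?B = "join_at e B UNIV"
  have pe: "pend ?L B s e = 0" using B by (simp add: sched_def)
  have Bs: "sched js ?B s e" using B sched_cong[of s e ?B B js] by (simp add: cut_left)
  have "dl_ok js UNIV e t" for t using gj by (simp add: good_def)
  hence "dl_ok js ?B e t" for t using dl_ok_mono[of js UNIV e t t ?B] by (auto simp: cut_right)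
  hence dlo: "dl_ok js ?B s t" for t using dl_ok_glue[OF Bs] by blast
  have Fe: "fil ?L ?B s e = fil ?L B s e" by (rule fil_cong) (simp add: cut_left)
  have nf_before: "0 < pend ?K ?B s t + ?K t" if t: "s \<le> t" "t < e" "t \<in> ?B" for t
  proof (rule ccontr)
    assume "\<not> ?thesis"
    hence 0: "pend ?K ?B s t = 0" "?K t = 0" by auto
    have "pend ?L ?B s t + ?L t = 0" using 0 pend_snoc[OF x(1) t(1), of js ?B] by (auto simp: arr_snoc)
    hence tF: "t \<in> fil ?L ?B s e" using t by (simp add: fil_def)
    hence "?r \<le> t" using F(1) Fe by auto
    moreover have "?r \<noteq> t" using 0(2) px by (auto simp: arr_snoc)
    ultimately have rt: "?r < t" by simp
    let ?F = "{u \<in> fil ?L ?B s t. ?r \<le> u}"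
    have "insert t ?F \<subseteq> fil ?L ?B s e" using tF t by (auto simp: fil_def)
    hence "card (insert t ?F) \<le> ?c" unfolding Fe by (rule card_mono[OF finite_fil])
    hence "Suc (card ?F) \<le> ?c" by (subst (asm) card_insert_disjoint) (auto simp: fil_def)
    moreover have "nat (ptime x) - card ?F = 0" using 0(1) pend_snoc[OF x(1) t(1), of js ?B] rt by auto
    ultimately show False using F(2) by linarith
  qed
  have runs_t: "runs ?B s t \<le> k" for t
  proof (cases "t \<le> e")
    case True thus ?thesis using runs_mono_end[of t e B s] runs_cong[of s t ?B B] r by (simp add: cut_left)
  next
    case False
    thus ?thesis using runs_cut[of s e t B UNIV] se r by (simp add: runs_def)
  qed
  \<comment> \<open>At \<open>rel x\<close> the count does not contain the new job yet, so its
    completion can be observed only from \<open>rel x + 1\<close> on.\<close>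
  let ?m = "max e (?r + 1)"
  show ?thesis
  proof (cases "\<exists>t. ?m \<le> t \<and> t \<le> ?d \<and> pend ?K ?B s t = 0")
    case True
    then obtain t0 where t0: "?m \<le> t0" "t0 \<le> ?d" "pend ?K ?B s t0 = 0" by blast
    let ?Z = "{t. ?m \<le> t \<and> t \<le> ?d \<and> pend ?K ?B s t = 0}"
    have fin: "finite ?Z" by (rule finite_subset[of _ "{?m..?d}"]) auto
    define t where "t = Min ?Z"
    have "?Z \<noteq> {}" using t0 by blast
    hence "t \<in> ?Z" unfolding t_def by (rule Min_in[OF fin])
    hence t: "?m \<le> t" "t \<le> ?d" "pend ?K ?B s t = 0" by auto
    have tm: "pend ?K ?B s u > 0" if "?m \<le> u" "u < t" for u
    proof (rule ccontr)
      assume "\<not> ?thesis"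
      hence "u \<in> ?Z" using that t by auto
      hence "t \<le> u" unfolding t_def by (rule Min_le[OF fin])
      thus False using that by simp
    qed
    have nf: "0 < pend ?K ?B s u + ?K u" if u: "s \<le> u" "u < t" "u \<in> ?B" for u
    proof -
      consider "u < e" | "?m \<le> u" | "u = ?r" using x by linarith
      thus ?thesis using nf_before[of u] tm[of u] u px by cases (auto simp: arr_snoc)
    qed
    hence nf: "fil ?K ?B s t = {}" unfolding fil_def by fastforce
    have "pend ?K ?B s u = 0" if "?d \<le> u" "u \<le> t" for u
    proof -
      have "u = t" using that t(2) by simp
      thus ?thesis using t(3) by simp
    qed
    hence "sched (js @ [x]) ?B s t" unfolding sched_def dl_ok_snoc
      using t dlo[of t] se by auto
    hence "reach (js @ [x]) s k t" using nf runs_t unfolding reach_def by blast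
    \<comment> \<open>The new job being finished at \<open>t\<close>, at least
      \<open>ptime x\<close> slots useless for the old jobs precede \<open>t\<close>; only
      \<open>?c\<close> of them lie before \<open>e\<close>.\<close>
    moreover have "e + ptime x - int ?c \<le> t"
    proof -
      let ?F = "{u \<in> fil ?L ?B s t. ?r \<le> u}"
      have "nat (ptime x) - card ?F = 0" using t(3) pend_snoc[OF x(1), of t js ?B] t(1) se by auto
      hence "ptime x \<le> int (card ?F)" by simp
      moreover have "?F \<subseteq> fil ?L ?B s e \<union> {e..<t}" by (auto simp: fil_def)
      hence "?F \<subseteq> fil ?L B s e \<union> {e..<t}" unfolding Fe .
      hence "card ?F \<le> card (fil ?L B s e \<union> {e..<t})" by (intro card_mono) auto
      hence "card ?F \<le> ?c + card {e..<t}" using card_Un_le le_trans by blast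
      moreover have "int (card {e..<t}) = t - e" using t(1) by simp
      ultimately show ?thesis by linarith
    qed
    ultimately show ?thesis using t px by (intro exI[of _ t]) auto
  next
    case False
    have nf: "0 < pend ?K ?B s u + ?K u" if u: "s \<le> u" "u < ?d" "u \<in> ?B" for u
    proof -
      consider "u < e" | "?m \<le> u" | "u = ?r" using x by linarith
      thus ?thesis
      proof cases
        case 2 hence "pend ?K ?B s u \<noteq> 0" using False u by auto
        thus ?thesis by simp
      qed (use nf_before[of u] u px in \<open>auto simp: arr_snoc\<close>)
    qed
    hence nf: "fil ?K ?B s ?d = {}" unfolding fil_def by fastforce
    have sd: "s \<le> ?d" using x px by simp
    have "pend ?K UNIV s ?d = 0" using g sd unfolding good_def dl_ok_snoc by auto
    from compress[OF sd nf this] obtain B' where B': "?B \<subseteq> B'" "fil ?K B' s ?d = {}" "pend ?K B' s ?d = 0"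
      "runs B' s ?d \<le> runs ?B s ?d" by blast
    have "dl_ok js B' s ?d" using dl_ok_mono[OF dlo[of ?d], of ?d B'] B'(1) by auto
    hence "sched (js @ [x]) B' s ?d" unfolding sched_def dl_ok_snoc using B'(3) sd by auto
    hence "reach (js @ [x]) s k ?d" using B' runs_t[of ?d] unfolding reach_def by fastforce
    thus ?thesis using px by (intro exI[of _ ?d]) auto
  qed
qed

text \<open>To the older jobs the slots serving the new one look useless: none precedes
  \<open>rel x\<close>, and there are at most \<open>ptime x\<close>, as one more would be useless
  for the longer list too. So \<open>chain_complete\<close> applies to the same busy set.\<close>

lemma reach_snoc_complete:
  assumes g: "good T (js @ [x])" and R: "reach (js @ [x]) s k e" and x: "s \<le> rel x" "rel x < e" "e \<le> T"
  shows "\<exists>\<mu> h c. chain (mreach T js) js (rel x) s \<mu> h c \<and> h \<le> k \<and> c \<le> ptime x \<and> rel x \<le> mreach T js \<mu> (k - h) \<and>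
      e \<le> mreach T js \<mu> (k - h) + ptime x - c"
proof -
  let ?L = "arr js" and ?K = "arr (js @ [x])"
  obtain B where B: "sched (js @ [x]) B s e" "fil ?K B s e = {}" "runs B s e \<le> k" using R by (auto simp: reach_def)
  have px: "1 \<le> ptime x" and gj: "good T js" using g good_snocD[OF g] by (auto simp: good_def)
  have BL: "sched js B s e" using B(1) by (rule sched_snocD)
  have F: "fil ?L B s e \<subseteq> {rel x..}"
  proof
    fix t assume t: "t \<in> fil ?L B s e"
    show "t \<in> {rel x..}"
    proof (rule ccontr)
      assume "\<not> ?thesis"
      hence "t \<in> fil ?K B s e" using t pend_snoc_before[of s t x js B] by (auto simp: fil_def arr_snoc)
      thus False using B(2) by simp
    qed
  qed
  have card: "int (card (fil ?L B s e)) \<le> ptime x"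
  proof (cases "fil ?L B s e = {}")
    case True thus ?thesis using px by simp
  next
    case False
    \<comment> \<open>If there were more than \<open>ptime x\<close> such slots, the new job would
      be finished before the last one, which would then be useless even with the new job.\<close>
    define u where "u = Max (fil ?L B s e)"
    have uF: "u \<in> fil ?L B s e" unfolding u_def using False by simp
    have u: "s \<le> u" "u < e" "rel x \<le> u" "u \<in> B" "pend ?L B s u = 0" "?L u = 0" using uF F by (auto simp: fil_def)
    let ?F = "{v \<in> fil ?L B s u. rel x \<le> v}"
    have "fil ?L B s e \<subseteq> insert u ?F"
    proof
      fix v assume v: "v \<in> fil ?L B s e"
      hence "v \<le> u" unfolding u_def by simp
      thus "v \<in> insert u ?F" using v F by (auto simp: fil_def)
    qed
    hence "card (fil ?L B s e) \<le> card (insert u ?F)" by (intro card_mono) auto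
    also have "\<dots> \<le> Suc (card ?F)" by (rule card_insert_le_m1) auto
    finally have le: "card (fil ?L B s e) \<le> Suc (card ?F)" .
    show ?thesis
    proof (cases "u = rel x")
      case True
      hence "?F = {}" by (auto simp: fil_def)
      hence "card ?F = 0" by (simp only: card.empty)
      thus ?thesis using le px by linarith
    next
      case False
      have "0 < pend ?K B s u + ?K u" using B(2) u by (auto simp: fil_def)
      hence "0 < nat (ptime x) - card ?F" using pend_snoc[OF x(1) u(1), of js B] u False by (auto simp: arr_snoc)
      thus ?thesis using le by linarith
    qed
  qed
  have "s \<le> T" using x by simp
  from chain_complete[OF gj this BL x(3) less_imp_le[OF x(2)] F B(3) refl]
  obtain \<mu> h c where "chain (mreach T js) js (rel x) s \<mu> h c" "h \<le> k" "c \<le> int (card (fil ?L B s e))"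
    "rel x \<le> mreach T js \<mu> (k - h)" "e - int (card (fil ?L B s e)) \<le> mreach T js \<mu> (k - h) - c" by blast
  thus ?thesis using card by (intro exI[of _ \<mu>] exI[of _ h] exI[of _ c]) auto
qed

text \<open>From \<open>dl x\<close> on nothing arrives and nothing is pending, so a piece without
  useless slots is idle there. Cutting off this last idle run, which starts at \<open>dl x\<close>
  or earlier, saves one run and leaves an end after all releases. Hence a reach is either capped by
  \<open>dl x\<close> or obtained by idling on.\<close>

lemma reach_past_dl:
  assumes g: "good T (js @ [x])" and R: "reach (js @ [x]) s k e" and e: "dl x < e" and s: "s \<le> rel x"
  shows "\<exists>e' \<le> dl x. \<exists>k'. k = Suc k' \<and> reach (js @ [x]) s k' e' \<and> (\<forall>y\<in>set (js @ [x]). rel y < e')"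
proof -
  let ?K = "arr (js @ [x])"
  obtain B where B: "sched (js @ [x]) B s e" "fil ?K B s e = {}" "runs B s e \<le> k" using R by (auto simp: reach_def)
  have d: "dl y \<le> dl x" "rel y < dl y" "1 \<le> ptime y" if "y \<in> set (js @ [x])" for y
    using g that unfolding good_def by (auto simp: sorted_append)
  have na: "?K t = 0" if "dl x \<le> t" for t
  proof (rule arr_eq_0, rule notI)
    assume "t \<in> rel ` set (js @ [x])"
    then obtain y where "y \<in> set (js @ [x])" "t = rel y" by blast
    thus False using d(1,2)[of y] that by linarith
  qed
  have sd: "s \<le> dl x" using s d(2)[of x] by simp
  have p0: "pend ?K B s t = 0" if "dl x \<le> t" "t \<le> e" for t
    using B(1) that e sd unfolding sched_def dl_ok_snoc by auto
  have idle: "t \<notin> B" if "dl x \<le> t" "t < e" for t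
    using B(2) p0[of t] na[of t] that sd by (auto simp: fil_def)
  let ?S = "{t. s \<le> t \<and> t \<le> dl x \<and> {t..dl x} \<inter> B = {}}"
  have fin: "finite ?S" by (rule finite_subset[of _ "{s..dl x}"]) auto
  have "dl x \<in> ?S" using idle e sd by auto
  hence ne: "?S \<noteq> {}" by blast
  define e' where "e' = Min ?S"
  have e': "s \<le> e'" "e' \<le> dl x" "{e'..dl x} \<inter> B = {}" using Min_in[OF fin ne] unfolding e'_def by auto
  have start: "e' = s \<or> e' - 1 \<in> B"
  proof (rule ccontr)
    assume a: "\<not> ?thesis"
    have "{e' - 1..dl x} = insert (e' - 1) {e'..dl x}" using e'(2) by auto
    hence "{e' - 1..dl x} \<inter> B = {}" using e'(3) a by simp
    hence "e' - 1 \<in> ?S" using a e' by auto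
    hence "e' \<le> e' - 1" unfolding e'_def by (rule Min_le[OF fin])
    thus False by simp
  qed
  \<comment> \<open>While the machine idles nothing is worked off: whatever is pending at
    \<open>e'\<close> or arrives later would still be pending at \<open>dl x\<close>.\<close>
  have up: "pend ?K B s e' \<le> pend ?K B s t \<and> (\<forall>u. e' \<le> u \<and> u < t \<longrightarrow> ?K u \<le> pend ?K B s t)" if "e' \<le> t" "t \<le> dl x" for t
    using that
  proof (induction t rule: int_ge_induct)
    case (step i)
    have "i \<in> {e'..dl x}" using step by simp
    hence "i \<notin> B" using e'(3) by blast
    hence "pend ?K B s (i + 1) = pend ?K B s i + ?K i" using step e' by (simp add: pend_step)
    moreover have "pend ?K B s e' \<le> pend ?K B s i" "\<forall>u. e' \<le> u \<and> u < i \<longrightarrow> ?K u \<le> pend ?K B s i"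
      using step by auto
    moreover have "u < i + 1 \<longleftrightarrow> u = i \<or> u < i" for u by linarith
    ultimately show ?case by (auto intro: trans_le_add1)
  qed simp
  have z: "pend ?K B s e' = 0" "\<And>u. e' \<le> u \<Longrightarrow> u < dl x \<Longrightarrow> ?K u = 0"
    using up[of "dl x"] e'(2) p0[of "dl x"] e by auto
  have "rel y < e'" if y: "y \<in> set (js @ [x])" for y
  proof (rule ccontr)
    assume "\<not> ?thesis"
    hence "?K (rel y) = 0" using z(2)[of "rel y"] d[OF y] by simp
    moreover have "0 < ?K (rel y)" using y d by (intro arr_pos) auto
    ultimately show False by simp
  qed
  moreover have "sched (js @ [x]) B s e'" using sched_split(1)[OF B(1) e'(1) _ z(1)] e'(2) e by simp
  moreover have "fil ?K B s e' = {}" using B(2) e'(2) e by (auto simp: fil_def)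
  moreover have "Suc (runs B s e') \<le> runs B s e"
  proof -
    let ?Q = "\<lambda>e. {t. s \<le> t \<and> t < e \<and> t \<notin> B \<and> (t = s \<or> t - 1 \<in> B)}"
    have "insert e' (?Q e') \<subseteq> ?Q e" using e' e start by auto
    hence "card (insert e' (?Q e')) \<le> card (?Q e)" by (intro card_mono) auto
    thus ?thesis unfolding runs_def by simp
  qed
  ultimately show ?thesis using e'(2) B(3) unfolding reach_def
    by (intro exI[of _ e'] conjI exI[of _ "k - 1"] exI[of _ B]) auto
qed

text \<open>\<open>V1\<close> to \<open>V3\<close> say that \<open>V\<close> is the maximum of the
  old reach and of all chain candidates, in the form in which the relaxations deliver it. The cap at
  \<open>dl x\<close> is lifted only if one idle run fewer already passes all releases: the spare
  run then idles up to \<open>T\<close>.\<close>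

theorem mreach_snoc:
  assumes g: "good T (js @ [x])" and s: "s \<le> rel x"
    and V1: "mreach T js s k \<le> V"
    and V2: "\<And>\<mu> h c. chain (mreach T js) js (rel x) s \<mu> h c \<Longrightarrow> h \<le> k \<Longrightarrow> c \<le> ptime x \<Longrightarrow>
        rel x \<le> mreach T js \<mu> (k - h) \<Longrightarrow> mreach T js \<mu> (k - h) + ptime x - c \<le> V"
    and V3: "V = mreach T js s k \<or> (\<exists>\<mu> h c. chain (mreach T js) js (rel x) s \<mu> h c \<and> h \<le> k \<and> c \<le> ptime x \<and>
        rel x \<le> mreach T js \<mu> (k - h) \<and> V = mreach T js \<mu> (k - h) + ptime x - c)"
  shows "mreach T (js @ [x]) s k =
    (if 0 < k \<and> (\<forall>y\<in>set (js @ [x]). rel y < mreach T (js @ [x]) s (k - 1)) then T else min (dl x) V)"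
proof -
  let ?R = "mreach T js" and ?R' = "mreach T (js @ [x])"
  have px: "1 \<le> ptime x" "rel x < dl x" "dl x < T" and gj: "good T js" using g good_snocD[OF g] by (auto simp: good_def)
  have sT: "s \<le> T" using px s by simp
  note P = mreach_props[OF gj sT] and P' = mreach_props[OF g sT]
  show ?thesis
  proof (cases "0 < k \<and> (\<forall>y\<in>set (js @ [x]). rel y < ?R' s (k - 1))")
    case True
    have "reach (js @ [x]) s ((k - 1) + 1) T"
      using P'(2) True by (intro reach_idle[OF g P'(3)[of "k - 1"]]) auto
    hence "reach (js @ [x]) s k T" using True by simp
    hence "T \<le> ?R' s k" using P'(4) by blast
    thus ?thesis using True P'(2)[of k] by (simp add: order_antisym)
  next
    case False
    have "?R' s k \<le> min (dl x) V"
    proof (cases "?R' s k \<le> rel x")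
      case True
      hence "reach js s k (?R' s k)" using reach_snoc_before[OF g, of s "?R' s k" k] P'(3) by simp
      hence "?R' s k \<le> ?R s k" using P(4) P'(2) by blast
      thus ?thesis using True px V1 by simp
    next
      case rF: False
      have dle: "?R' s k \<le> dl x"
      proof (rule ccontr)
        assume "\<not> ?thesis"
        then obtain e' k' where e': "k = Suc k'" "reach (js @ [x]) s k' e'" "\<forall>y\<in>set (js @ [x]). rel y < e'" "e' \<le> dl x"
          using reach_past_dl[OF g P'(3)[of k] _ s] by auto
        hence "e' \<le> ?R' s k'" using P'(4) px by simp
        thus False using e' False by fastforce
      qed
      obtain \<mu> h c where "chain ?R js (rel x) s \<mu> h c" "h \<le> k" "c \<le> ptime x" "rel x \<le> ?R \<mu> (k - h)"
        "?R' s k \<le> ?R \<mu> (k - h) + ptime x - c"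
        using reach_snoc_complete[OF g P'(3)[of k] s] rF P'(2)[of k] by auto
      thus ?thesis using V2[of \<mu> h c] dle by auto
    qed
    moreover have "min (dl x) V \<le> ?R' s k"
      using V3
    proof
      assume V: "V = ?R s k"
      show ?thesis
      proof (cases "?R s k \<le> rel x")
        case True
        hence "reach (js @ [x]) s k (?R s k)" using reach_snoc_before[OF g, of s "?R s k" k] P(3) by simp
        hence "?R s k \<le> ?R' s k" using P'(4) P(2) by blast
        thus ?thesis using V by simp
      next
        case False
        obtain B where B: "sched js B s (?R s k)" "fil (arr js) B s (?R s k) = {}" "runs B s (?R s k) \<le> k"
          using P(3)[of k] by (auto simp: reach_def)
        obtain e' where "reach (js @ [x]) s k e'" "e' \<le> T" "min (dl x) (?R s k + ptime x) \<le> e'"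
          using reach_snoc_sound[OF g B(1) s _ _ _ B(3)] False B(2) px by auto
        thus ?thesis using P'(4)[of k e'] V px by auto
      qed
    next
      assume "\<exists>\<mu> h c. chain ?R js (rel x) s \<mu> h c \<and> h \<le> k \<and> c \<le> ptime x \<and>
        rel x \<le> ?R \<mu> (k - h) \<and> V = ?R \<mu> (k - h) + ptime x - c"
      then obtain \<mu> h c where c: "chain ?R js (rel x) s \<mu> h c" "h \<le> k" "c \<le> ptime x" "rel x \<le> ?R \<mu> (k - h)"
        "V = ?R \<mu> (k - h) + ptime x - c" by blast
      let ?e = "?R \<mu> (k - h)"
      have mT: "\<mu> \<le> T" using chain_le_T[OF gj sT c(1)] .
      obtain B where B: "sched js B s \<mu>" "runs B s \<mu> \<le> h" "fil (arr js) B s \<mu> \<subseteq> {rel x..}"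
        "int (card (fil (arr js) B s \<mu>)) = c" using chain_sound[OF gj sT c(1)] by blast
      obtain B2 where B2: "sched js B2 \<mu> ?e" "fil (arr js) B2 \<mu> ?e = {}" "runs B2 \<mu> ?e \<le> k - h"
        using mreach_props(3)[OF gj mT, of "k - h"] by (auto simp: reach_def)
      let ?B = "join_at \<mu> B B2"
      have le: "s \<le> \<mu>" "\<mu> \<le> ?e" "pend (arr js) B s \<mu> = 0" using B B2 by (auto simp: sched_def)
      have F: "fil (arr js) ?B s ?e = fil (arr js) B s \<mu>" using fil_cut[OF le, of B2] B2(2) by simp
      have "runs ?B s ?e \<le> k" using runs_cut[OF le(1,2), of B B2] B(2) B2(3) c(2) by simp
      from reach_snoc_sound[OF g sched_cut[OF B(1) B2(1)] s c(4) _ _ this]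
      obtain e' where "reach (js @ [x]) s k e'" "e' \<le> T" "min (dl x) (?e + ptime x - c) \<le> e'"
        unfolding F using B(3,4) c(3) by auto
      thus ?thesis using P'(4)[of k e'] c(5) by auto
    qed
    ultimately show ?thesis using False by auto
  qed
qed

text \<open>Without jobs every busy slot is useless, so nothing but an idle run leads away from
  \<open>s\<close>. These values fill the initial table.\<close>

lemma mreach_Nil:
  assumes "s < T"
  shows "mreach T [] s k = (if k = 0 then s else T)"
proof -
  have g: "good T []" by (simp add: good_def dl_ok_def)
  note P = mreach_props[OF g less_imp_le[OF assms]]
  show ?thesis
  proof (cases "k = 0")
    case False
    have "reach [] s (0 + 1) T" using assms by (intro reach_idle[OF g reach_refl[OF g]]) auto
    hence "reach [] s k T" using False reach_mono[of "[]" s 1 T k] by simp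
    thus ?thesis using P(4)[of k T] P(2)[of k] False by simp
  next
    case True
    obtain B where B: "fil (arr []) B s (mreach T [] s 0) = {}" "runs B s (mreach T [] s 0) = 0"
      using P(3)[of 0] by (auto simp: reach_def)
    have "\<not> s < mreach T [] s 0"
    proof
      assume a: "s < mreach T [] s 0"
      have "s \<notin> B" using B(1) a by (auto simp: fil_def)
      hence "s \<in> {t. s \<le> t \<and> t < mreach T [] s 0 \<and> t \<notin> B \<and> (t = s \<or> t - 1 \<in> B)}" using a by simp
      thus False using B(2) unfolding runs_def by (subst (asm) card_0_eq) auto
    qed
    thus ?thesis using P(1)[of 0] True by simp
  qed
qed

text \<open>Each further idle run passes at least one more release time, and there are at most
  \<open>length js\<close> of them. Hence columns 0 to n of the tables suffice.\<close>

lemma mreach_complete_bound: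
  assumes g: "good T js" and s: "s \<le> T"
  shows "\<forall>x\<in>set js. rel x < mreach T js s (length js)"
proof -
  let ?S = "\<lambda>k. {r \<in> rel ` set js. mreach T js s k \<le> r}"
  have "card (?S k) \<le> length js - k" for k
  proof (induction k)
    case 0
    have "card (?S 0) \<le> card (rel ` set js)" by (intro card_mono) auto
    also have "\<dots> \<le> length js" using card_image_le[of "set js" rel] card_length[of js] by simp
    finally show ?case by simp
  next
    case (Suc k)
    show ?case
    proof (cases "?S k = {}")
      case True
      have "?S (Suc k) \<subseteq> ?S k" using mreach_mono[OF g s, of k "Suc k"] by auto
      hence "card (?S (Suc k)) \<le> card ({} :: int set)" unfolding True by (intro card_mono) auto
      thus ?thesis unfolding card.empty by linarith
    next
      case False
      let ?\<nu> = "Min (?S k)"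
      have m: "?\<nu> \<in> ?S k" using False by (intro Min_in) auto
      have "?\<nu> \<le> r" if "r \<in> ?S k" for r using that by (intro Min_le) auto
      hence "is_next js (mreach T js s k) ?\<nu>" using m unfolding is_next_def by auto
      hence "?\<nu> < mreach T js s (Suc k)" by (rule mreach_passes_next[OF g s])
      hence "?\<nu> \<notin> ?S (Suc k)" by simp
      moreover have "?S (Suc k) \<subseteq> ?S k" using mreach_mono[OF g s, of k "Suc k"] by auto
      ultimately have "?S (Suc k) \<subset> ?S k" using m by blast
      hence "card (?S (Suc k)) < card (?S k)" by (intro psubset_card_mono) auto
      thus ?thesis using Suc by simp
    qed
  qed
  from this[of "length js"] have "card (?S (length js)) = 0" by simp
  hence "?S (length js) = {}" by simp
  thus ?thesis by force
qed


section \<open>Schedules and busy sets\<close>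

text \<open>The work that \<open>S\<close> itself has still to do at \<open>t\<close>. Only jobs
  released strictly before \<open>t\<close> count, which matches the timing of
  \<open>pend\<close>.\<close>

definition rem :: "job list \<Rightarrow> schedule \<Rightarrow> nat set \<Rightarrow> int \<Rightarrow> nat" where
  "rem J S I t = (\<Sum>j\<in>I. if rel (J ! j) < t then card {u. t \<le> u \<and> S u = Some j} else 0)"

lemma arr_map:
  assumes "distinct ks"
  shows "arr (map ((!) J) ks) t = (\<Sum>j\<in>set ks. if rel (J ! j) = t then nat (ptime (J ! j)) else 0)"
  using assms unfolding arr_def by (simp add: sum_list_distinct_conv_sum_set comp_def)

lemma rem_step:
  assumes fs: "feasible_schedule J S" and I: "finite I" "I \<subseteq> {..<length J}"
  shows "rem J S I (t + 1) + (if \<exists>j\<in>I. S t = Some j then 1 else 0) =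
    rem J S I t + (\<Sum>j\<in>I. if rel (J ! j) = t then nat (ptime (J ! j)) else 0)"
proof -
  have one: "(if rel (J ! j) < t + 1 then card {u. t + 1 \<le> u \<and> S u = Some j} else 0) + (if S t = Some j then 1 else 0)
     = (if rel (J ! j) < t then card {u. t \<le> u \<and> S u = Some j} else 0) +
       (if rel (J ! j) = t then nat (ptime (J ! j)) else 0)" if j: "j \<in> I" for j
  proof -
    have fin: "finite {u. S u = Some j}" and c: "int (card {u. S u = Some j}) = ptime (J ! j)"
      using fs j I by (auto simp: feasible_schedule_def)
    have r: "rel (J ! j) \<le> u" if "S u = Some j" for u using fs that by (auto simp: feasible_schedule_def)
    have "{u. t \<le> u \<and> S u = Some j} = {u. t + 1 \<le> u \<and> S u = Some j} \<union> (if S t = Some j then {t} else {})"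
      by (auto simp: le_less)
    moreover have "card ({u. t + 1 \<le> u \<and> S u = Some j} \<union> (if S t = Some j then {t} else {})) =
      card {u. t + 1 \<le> u \<and> S u = Some j} + (if S t = Some j then 1 else 0)"
      using fin by (subst card_Un_disjoint) (auto intro: finite_subset)
    ultimately have eq: "card {u. t \<le> u \<and> S u = Some j} = card {u. t + 1 \<le> u \<and> S u = Some j} + (if S t = Some j then 1 else 0)"
      by simp
    consider "rel (J ! j) < t" | "rel (J ! j) = t" | "t < rel (J ! j)" by linarith
    thus ?thesis
    proof cases
      case 2
      have "{u. t \<le> u \<and> S u = Some j} = {u. S u = Some j}" using r 2 by auto
      thus ?thesis using 2 eq c by simp
    next
      case 3 thus ?thesis using r[of t] by auto
    qed (use eq in simp)
  qed
  have "(\<Sum>j\<in>I. if S t = Some j then 1 else 0) = (if \<exists>j\<in>I. S t = Some j then 1 else (0::nat))"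
  proof (cases "\<exists>j\<in>I. S t = Some j")
    case True
    then obtain j where j: "j \<in> I" "S t = Some j" by blast
    have "(\<Sum>i\<in>I. if S t = Some i then 1 else 0) = (\<Sum>i\<in>I. if i = j then 1 else (0::nat))" using j by (intro sum.cong) auto
    thus ?thesis using j I(1) True by simp
  qed simp
  moreover have "(\<Sum>j\<in>I. (if rel (J ! j) < t + 1 then card {u. t + 1 \<le> u \<and> S u = Some j} else 0) + (if S t = Some j then 1 else 0))
    = (\<Sum>j\<in>I. (if rel (J ! j) < t then card {u. t \<le> u \<and> S u = Some j} else 0) +
       (if rel (J ! j) = t then nat (ptime (J ! j)) else 0))" by (rule sum.cong[OF refl one])
  ultimately show ?thesis unfolding rem_def by (simp only: sum.distrib)
qed

text \<open>Earliest deadline service works on the jobs of \<open>ks\<close> whenever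
  \<open>S\<close> is busy and one of them is pending, whereas \<open>S\<close> may serve another
  job. Applied to the prefixes by deadline, this takes the place of the usual exchange
  argument.\<close>

lemma pend_le_rem:
  assumes fs: "feasible_schedule J S" and ks: "distinct ks" "set ks \<subseteq> {..<length J}" and st: "s \<le> t"
  shows "pend (arr (map ((!) J) ks)) {t. S t \<noteq> None} s t \<le> rem J S (set ks) t"
  using st
proof (induction t rule: int_ge_induct)
  case (step i)
  show ?case using step rem_step[OF fs, of "set ks" i] ks arr_map[OF ks(1), of J i]
    by (auto simp: pend_step split: if_splits)
qed simp

lemma dl_ok_schedule:
  assumes fs: "feasible_schedule J S" and ks: "distinct ks" "set ks \<subseteq> {..<length J}"
    and so: "sorted (map dl (map ((!) J) ks))"
  shows "dl_ok (map ((!) J) ks) {t. S t \<noteq> None} s e"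
  unfolding dl_ok_def
proof (intro allI impI)
  fix i t assume i: "i < length (map ((!) J) ks)" and t: "s \<le> t \<and> dl (map ((!) J) ks ! i) \<le> t \<and> t \<le> e"
  let ?k = "take (Suc i) ks"
  have d: "dl (J ! j) \<le> t" if "j \<in> set ?k" for j
  proof -
    obtain l where l: "l \<le> i" "j = ks ! l" using \<open>j \<in> set ?k\<close> i by (auto simp: in_set_conv_nth less_Suc_eq_le)
    have "map dl (map ((!) J) ks) ! l \<le> map dl (map ((!) J) ks) ! i" using so i l by (intro sorted_nth_mono) auto
    thus ?thesis using l i t by simp
  qed
  have "rem J S (set ?k) t = 0" unfolding rem_def
  proof (intro sum.neutral ballI)
    fix j assume j: "j \<in> set ?k"
    have "u < t" if "S u = Some j" for u using fs d[OF j] that unfolding feasible_schedule_def by (meson less_le_trans)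
    hence "{u. t \<le> u \<and> S u = Some j} = {}" by (auto dest: leD)
    thus "(if rel (J ! j) < t then card {u. t \<le> u \<and> S u = Some j} else 0) = 0" by (simp only: card.empty if_cancel)
  qed
  moreover have "set ?k \<subseteq> {..<length J}" using set_take_subset ks(2) by (rule subset_trans)
  ultimately have "pend (arr (map ((!) J) ?k)) {t. S t \<noteq> None} s t = 0"
    using pend_le_rem[OF fs distinct_take[OF ks(1)], of "Suc i" s t] t by simp
  thus "pend (arr (take (Suc i) (map ((!) J) ks))) {t. S t \<noteq> None} s t = 0" by (simp add: take_map)
qed

lemma slot_exists:
  assumes "valid_instance J" "feasible_schedule J S" "j < length J"
  shows "\<exists>t. S t = Some j"
proof -
  have "int (card {t. S t = Some j}) = ptime (J ! j)" "1 \<le> ptime (J ! j)"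
    using assms by (auto simp: feasible_schedule_def valid_instance_def)
  hence "{t. S t = Some j} \<noteq> {}" by force
  thus ?thesis by blast
qed

lemma good_levels:
  assumes v: "valid_instance J" and fs: "feasible_schedule J S" and ks: "distinct ks" "set ks \<subseteq> {..<length J}"
    and so: "sorted (map dl (map ((!) J) ks))" and T: "\<And>j. j < length J \<Longrightarrow> dl (J ! j) < T"
  shows "good T (map ((!) J) ks)"
  unfolding good_def
proof (intro conjI ballI allI so)
  fix x assume "x \<in> set (map ((!) J) ks)"
  then obtain j where j: "j < length J" "x = J ! j" using ks(2) by auto
  show p: "1 \<le> ptime x" using v j by (auto simp: valid_instance_def)
  obtain t where "S t = Some j" using slot_exists[OF v fs j(1)] by blast
  thus "rel x < dl x" using fs j by (fastforce simp: feasible_schedule_def)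
  show "dl x < T" using T j by simp
next
  fix s e show "dl_ok (map ((!) J) ks) UNIV s e"
    using dl_ok_mono[OF dl_ok_schedule[OF fs ks so, of s e], of e UNIV] by auto
qed

text \<open>With a start before all releases the leading idle run is counted, hence the extra one.\<close>
lemma schedule_reach:
  assumes v: "valid_instance J" and fs: "feasible_schedule J S" and ks: "distinct ks" "set ks = {..<length J}"
    and so: "sorted (map dl (map ((!) J) ks))" and s: "\<And>j. j < length J \<Longrightarrow> s < rel (J ! j)"
    and T: "\<And>j. j < length J \<Longrightarrow> dl (J ! j) < T" and J: "J \<noteq> []"
  shows "\<exists>e \<le> T. reach (map ((!) J) ks) s (num_gaps S + 1) e \<and> (\<forall>j<length J. rel (J ! j) < e)"
proof -
  let ?js = "map ((!) J) ks" and ?B = "{t. S t \<noteq> None}"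
  have finB: "finite ?B"
  proof -
    have "?B \<subseteq> (\<Union>j<length J. {t. S t = Some j})" using fs by (auto simp: feasible_schedule_def)
    moreover have "finite (\<Union>j<length J. {t. S t = Some j})" using fs by (auto simp: feasible_schedule_def)
    ultimately show ?thesis by (rule finite_subset)
  qed
  note slot = slot_exists[OF v fs]
  have ne: "?B \<noteq> {}" using slot[of 0] J by auto
  define e where "e = Max ?B + 1"
  have eB: "e - 1 \<in> ?B" unfolding e_def using Max_in[OF finB ne] by simp
  have Be: "t < e" if "t \<in> ?B" for t using Max_ge[OF finB that] unfolding e_def by simp
  have Bs: "s < t" if "t \<in> ?B" for t using that fs s unfolding feasible_schedule_def by fastforce
  have all: "rel (J ! j) < e" if j: "j < length J" for j
  proof -
    obtain t where "S t = Some j" using slot[OF j] by blast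
    hence "t < e" "rel (J ! j) \<le> t" using Be[of t] fs unfolding feasible_schedule_def by auto
    thus ?thesis by simp
  qed
  have eT: "e \<le> T"
  proof -
    obtain j where "S (e - 1) = Some j" using eB by auto
    hence "j < length J" "e - 1 < dl (J ! j)" using fs unfolding feasible_schedule_def by auto
    thus ?thesis using T[of j] by simp
  qed
  have in_I: "(\<exists>j\<in>set ks. S t = Some j) \<longleftrightarrow> t \<in> ?B" for t using fs ks(2) by (auto simp: feasible_schedule_def)
  \<comment> \<open>With all jobs in the list, every busy slot of \<open>S\<close> serves one of
    them, so the inequality becomes an equality; this is why no busy slot is useless.\<close>
  have eq: "pend (arr ?js) ?B s t = rem J S (set ks) t" if "s \<le> t" for t
    using that
  proof (induction t rule: int_ge_induct)
    case base
    show ?case using s ks(2) by (auto simp: rem_def intro!: sum.neutral[symmetric] dest: less_asym)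
  next
    case (step i)
    show ?case using step rem_step[OF fs, of "set ks" i] ks arr_map[OF ks(1), of J i] in_I[of i]
      by (auto simp: pend_step split: if_splits)
  qed
  have "fil (arr ?js) ?B s e = {}"
  proof (rule ccontr)
    assume "fil (arr ?js) ?B s e \<noteq> {}"
    then obtain t where t: "s \<le> t" "t \<in> ?B" "pend (arr ?js) ?B s t + arr ?js t = 0" by (auto simp: fil_def)
    thus False using rem_step[OF fs, of "set ks" t] ks arr_map[OF ks(1), of J t] in_I[of t] eq[of t]
      by (auto split: if_splits)
  qed
  moreover have "sched ?js ?B s e"
  proof -
    have "rem J S (set ks) e = 0" unfolding rem_def
    proof (intro sum.neutral ballI)
      fix j
      have "{u. e \<le> u \<and> S u = Some j} = {}" using Be by (auto dest: leD)
      thus "(if rel (J ! j) < e then card {u. e \<le> u \<and> S u = Some j} else 0) = 0" by (simp only: card.empty if_cancel)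
    qed
    thus ?thesis unfolding sched_def using eq[of e] Bs[OF eB] dl_ok_schedule[OF fs ks(1) _ so] ks(2) by simp
  qed
  moreover have "runs ?B s e \<le> num_gaps S + 1"
  proof -
    let ?Q = "{t. s \<le> t \<and> t < e \<and> t \<notin> ?B \<and> (t = s \<or> t - 1 \<in> ?B)}"
    \<comment> \<open>An idle run that does not start at \<open>s\<close> follows a busy slot, and
      it ends by the last busy slot \<open>e - 1\<close>; so its start is the start of a
      gap.\<close>
    have "?Q \<subseteq> insert s (fst ` gaps S)"
    proof
      fix a assume a: "a \<in> ?Q"
      show "a \<in> insert s (fst ` gaps S)"
      proof (cases "a = s")
        case False
        hence b: "a - 1 \<in> ?B" "a \<notin> ?B" "a < e" using a by auto
        let ?N = "{t \<in> ?B. a \<le> t}"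
        have "e - 1 \<in> ?N" using eB b(3) by simp
        hence N: "finite ?N" "?N \<noteq> {}" using finB by auto
        define b' where "b' = Min ?N"
        have b': "b' \<in> ?N" unfolding b'_def using N by (rule Min_in)
        have "S t = None" if "a \<le> t" "t < b'" for t
        proof (rule ccontr)
          assume "S t \<noteq> None"
          hence "b' \<le> t" unfolding b'_def using that N(1) by (intro Min_le) auto
          thus False using that by simp
        qed
        moreover have "a < b'" using b' b(2) by (auto simp: le_less)
        ultimately have "(a, b') \<in> gaps S" using b b' by (auto simp: gaps_def)
        thus ?thesis by force
      qed simp
    qed
    moreover have fg: "finite (gaps S)"
    proof (rule finite_subset)
      show "gaps S \<subseteq> ((\<lambda>t. t + 1) ` ?B) \<times> ?B" by (auto simp: gaps_def image_iff) (metis diff_add_cancel)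
    qed (use finB in auto)
    ultimately have "card ?Q \<le> card (insert s (fst ` gaps S))" by (intro card_mono) auto
    also have "\<dots> \<le> Suc (card (fst ` gaps S))" by (rule card_insert_le_m1) auto
    also have "\<dots> \<le> Suc (card (gaps S))" using card_image_le[OF fg] by simp
    finally show ?thesis by (simp add: runs_def num_gaps_def)
  qed
  ultimately show ?thesis using all eT unfolding reach_def by blast
qed

text \<open>Conservation of work. Differences between consecutive prefixes give the number of slots
  of a single job.\<close>

lemma served_card:
  assumes "s \<le> t"
  shows "pend A B s t + card {u. s \<le> u \<and> u < t \<and> u \<in> B \<and> 0 < pend A B s u + A u} = (\<Sum>u\<in>{s..<t}. A u)"
  using assms
proof (induction t rule: int_ge_induct)
  case base show ?case by simp
next
  case (step i)
  let ?S = "\<lambda>t. {u. s \<le> u \<and> u < t \<and> u \<in> B \<and> 0 < pend A B s u + A u}"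
  have S: "?S (i + 1) = (if i \<in> B \<and> 0 < pend A B s i + A i then insert i (?S i) else ?S i)"
    using step(1) by (auto simp: le_less zle_add1_eq_le)
  have "card (?S (i + 1)) = (if i \<in> B \<and> 0 < pend A B s i + A i then Suc (card (?S i)) else card (?S i))"
    unfolding S by (subst card_insert_disjoint[symmetric]) auto
  moreover have "{s..<i + 1} = insert i {s..<i}" using step(1) by auto
  ultimately show ?case using step by (auto simp: pend_step split: if_splits)
qed

text \<open>Earliest deadline service is read off the busy set: \<open>srv i\<close> consists of the
  slots serving one of the first \<open>i\<close> jobs, these sets grow with \<open>i\<close>, and
  the job at position \<open>i\<close> receives \<open>srv (Suc i) - srv i\<close>.\<close>

lemma reach_schedule:
  assumes ks: "distinct ks" "set ks = {..<length J}" and g: "good T (map ((!) J) ks)"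
    and s: "\<And>j. j < length J \<Longrightarrow> s < rel (J ! j)" and R: "reach (map ((!) J) ks) s k e"
    and e: "\<And>j. j < length J \<Longrightarrow> rel (J ! j) < e" and J: "J \<noteq> []"
  shows "\<exists>S. feasible_schedule J S \<and> num_gaps S + 1 \<le> k"
proof -
  let ?js = "map ((!) J) ks" and ?n = "length J"
  have n: "length ks = ?n" using ks distinct_card[of ks] by simp
  obtain B where B: "sched ?js B s e" "fil (arr ?js) B s e = {}" "runs B s e \<le> k" using R by (auto simp: reach_def)
  have se: "s \<le> e" using B(1) by (simp add: sched_def)
  define A where "A i = arr (take i ?js)" for i
  define srv where "srv i = {u. s \<le> u \<and> u < e \<and> u \<in> B \<and> 0 < pend (A i) B s u + A i u}" for i
  have A_Suc: "A (Suc i) t = A i t + (if rel (J ! (ks ! i)) = t then nat (ptime (J ! (ks ! i))) else 0)"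
    if "i < ?n" for i t using that n by (simp add: A_def take_Suc_conv_app_nth arr_snoc)
  have pm: "pend (A i) B s t \<le> pend (A (Suc i)) B s t" if "i < ?n" "s \<le> t" for i t
    using that A_Suc by (intro pend_mono) auto
  have srv_mono: "srv i \<subseteq> srv (Suc i)" if "i < ?n" for i
    unfolding srv_def using pm[OF that] A_Suc[OF that] by fastforce
  have srv_mono': "srv i \<subseteq> srv i'" if "i \<le> i'" "i' \<le> ?n" for i i'
    using that
  proof (induction i' rule: dec_induct)
    case (step n) thus ?case using srv_mono[of n] by fastforce
  qed simp
  have fin: "finite (srv i)" for i unfolding srv_def by simp
  have card_srv: "card (srv i) = (\<Sum>u\<in>{s..<e}. A i u)" for i
  proof -
    have "pend (A i) B s e = 0" unfolding A_def using B(1) by (intro pend_take_0) (auto simp: sched_def)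
    thus ?thesis using served_card[OF se, of "A i" B] by (simp add: srv_def)
  qed
  have cd: "int (card (srv (Suc i) - srv i)) = ptime (J ! (ks ! i))" if i: "i < ?n" for i
  proof -
    have j: "ks ! i < ?n" using ks(2) i n nth_mem[of i ks] by auto
    have p: "1 \<le> ptime (J ! (ks ! i))" using g i n by (auto simp: good_def)
    have "(\<Sum>u\<in>{s..<e}. A (Suc i) u) = (\<Sum>u\<in>{s..<e}. A i u) + (\<Sum>u\<in>{s..<e}. if rel (J ! (ks ! i)) = u then nat (ptime (J ! (ks ! i))) else 0)"
      using A_Suc[OF i] by (simp add: sum.distrib)
    also have "(\<Sum>u\<in>{s..<e}. if rel (J ! (ks ! i)) = u then nat (ptime (J ! (ks ! i))) else 0) = nat (ptime (J ! (ks ! i)))"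
      using s[OF j] e[OF j] by simp
    finally show ?thesis using card_srv[of i] card_srv[of "Suc i"] srv_mono[OF i] fin p by (simp add: card_Diff_subset)
  qed
  define S :: schedule where "S t = (if t \<in> srv ?n then Some (ks ! (LEAST i. t \<in> srv (Suc i))) else None)" for t
  have srv0: "srv 0 = {}"
  proof -
    have "A 0 u = 0" for u by (simp add: A_def)
    moreover have "pend (A 0) B s t = 0" if "s \<le> t" for t using that calculation by - (rule pend_no_arrivals[of s s], auto)
    ultimately show ?thesis by (auto simp: srv_def)
  qed
  have npos: "0 < ?n" using J by simp
  have S_iff: "S t = Some (ks ! i) \<longleftrightarrow> t \<in> srv (Suc i) - srv i" if i: "i < ?n" for i t
  proof
    assume a: "t \<in> srv (Suc i) - srv i"
    have "t \<in> srv ?n" using a srv_mono'[of "Suc i" ?n] i by auto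
    moreover have "(LEAST i. t \<in> srv (Suc i)) = i"
    proof (rule Least_equality)
      show "t \<in> srv (Suc i)" using a by simp
      fix y assume y: "t \<in> srv (Suc y)"
      show "i \<le> y" using srv_mono'[of "Suc y" i] y a i by (cases "i \<le> y") auto
    qed
    ultimately show "S t = Some (ks ! i)" by (simp add: S_def)
  next
    assume a: "S t = Some (ks ! i)"
    let ?l = "LEAST i. t \<in> srv (Suc i)"
    have t: "t \<in> srv ?n" using a by (auto simp: S_def split: if_splits)
    hence ex: "t \<in> srv (Suc (?n - 1))" using npos by simp
    have l: "t \<in> srv (Suc ?l)" using ex by (rule LeastI)
    have "?l \<le> ?n - 1" using ex by (rule Least_le)
    hence ln: "?l < ?n" using npos by linarith
    have "ks ! ?l = ks ! i" using a t by (simp add: S_def)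
    hence li: "?l = i" using ks(1) ln i n by (simp add: nth_eq_iff_index_eq)
    have "t \<notin> srv i"
    proof (cases i)
      case (Suc i')
      have "i' < ?l" using li Suc by simp
      thus ?thesis using not_less_Least[of i' "\<lambda>i. t \<in> srv (Suc i)"] Suc by simp
    qed (simp add: srv0)
    thus "t \<in> srv (Suc i) - srv i" using l li by simp
  qed
  have ex_i: "\<exists>i<?n. ks ! i = j" if "j < ?n" for j using ks(2) that n by (metis in_set_conv_nth lessThan_iff)
  have S_in: "\<exists>i<?n. t \<in> srv (Suc i) - srv i \<and> j = ks ! i" if "S t = Some j" for t j
  proof -
    have t: "t \<in> srv ?n" using that by (auto simp: S_def split: if_splits)
    let ?l = "LEAST i. t \<in> srv (Suc i)"
    have "t \<in> srv (Suc (?n - 1))" using t npos by simp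
    hence "?l \<le> ?n - 1" by (rule Least_le)
    hence "?l < ?n" using npos by linarith
    moreover have "j = ks ! ?l" using that t by (simp add: S_def)
    ultimately show ?thesis using S_iff[of ?l t] that by auto
  qed
  have fS: "feasible_schedule J S"
    unfolding feasible_schedule_def
  proof (intro conjI allI impI)
    fix t j assume "S t = Some j"
    then obtain i where i: "i < ?n" "t \<in> srv (Suc i) - srv i" "j = ks ! i" using S_in by blast
    show "j < ?n" using ks(2) i n nth_mem[of i ks] by auto
    let ?x = "J ! j"
    have st: "s \<le> t" "t < e" "t \<in> B" "0 < pend (A (Suc i)) B s t + A (Suc i) t" "pend (A i) B s t + A i t = 0"
      using i by (auto simp: srv_def)
    show "rel ?x \<le> t"
    proof (rule ccontr)
      assume a: "\<not> rel ?x \<le> t"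
      have "pend (A (Suc i)) B s t = pend (A i) B s t" using a A_Suc[OF i(1)] i(3) st by (intro pend_cong) auto
      thus False using st a A_Suc[OF i(1)] i(3) by simp
    qed
    show "t < dl ?x"
    proof (rule ccontr)
      assume a: "\<not> t < dl ?x"
      have "pend (A (Suc i)) B s t = 0" using B(1) a i n st unfolding sched_def dl_ok_def A_def by auto
      moreover have "A (Suc i) t = 0" unfolding A_def
      proof (rule arr_eq_0, rule notI)
        assume "t \<in> rel ` set (take (Suc i) ?js)"
        then obtain l where l: "l \<le> i" "t = rel (?js ! l)" using i n by (auto simp: in_set_conv_nth less_Suc_eq_le)
        have "map dl ?js ! l \<le> map dl ?js ! i" using g i l n by (intro sorted_nth_mono) (auto simp: good_def)
        moreover have "rel (?js ! l) < dl (?js ! l)" using g i l n by (auto simp: good_def)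
        ultimately show False using a i l n by simp
      qed
      ultimately show False using st by simp
    qed
  next
    fix j assume "j < ?n"
    then obtain i where i: "i < ?n" "ks ! i = j" using ex_i by blast
    have eq: "{t. S t = Some j} = srv (Suc i) - srv i" using S_iff[OF i(1)] i(2) by auto
    show "finite {t. S t = Some j}" unfolding eq using fin by simp
    show "int (card {t. S t = Some j}) = ptime (J ! j)" unfolding eq using cd[OF i(1)] i(2) by simp
  qed
  have busy: "S t \<noteq> None \<longleftrightarrow> s \<le> t \<and> t < e \<and> t \<in> B" for t
  proof -
    have "A ?n = arr ?js" using n by (simp add: A_def)
    hence "srv ?n = {t. s \<le> t \<and> t < e \<and> t \<in> B}" using B(2) unfolding srv_def fil_def by fastforce
    thus ?thesis by (simp add: S_def)
  qed
  have "num_gaps S + 1 \<le> runs B s e"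
  proof -
    let ?Q = "{t. s \<le> t \<and> t < e \<and> t \<notin> B \<and> (t = s \<or> t - 1 \<in> B)}"
    have inj: "inj_on fst (gaps S)"
    proof (rule inj_onI)
      fix x y assume x: "x \<in> gaps S" and y: "y \<in> gaps S" and xy: "fst x = fst y"
      obtain a b b' where ab: "x = (a, b)" "y = (a, b')" using xy by (cases x, cases y) auto
      have "\<not> b < b'" "\<not> b' < b" using x y unfolding ab gaps_def by auto
      thus "x = y" using ab by simp
    qed
    have se': "s < e" using s[of 0] e[of 0] J by force
    \<comment> \<open>Nothing is released at \<open>s\<close>, so a busy slot there would be
      useless. The idle run starting at \<open>s\<close> is not a gap and accounts for the
      \<open>+ 1\<close>.\<close>
    have sB: "s \<notin> B"
    proof
      assume "s \<in> B"
      hence "0 < arr ?js s" using B(2) se' by (auto simp: fil_def)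
      thus False using arr_eq_0[of s ?js] s ks(2) by force
    qed
    have "insert s (fst ` gaps S) \<subseteq> ?Q"
    proof
      fix a assume "a \<in> insert s (fst ` gaps S)"
      thus "a \<in> ?Q"
      proof
        assume "a \<in> fst ` gaps S"
        then obtain b where b: "a < b" "\<forall>t. a \<le> t \<and> t < b \<longrightarrow> S t = None" "S (a - 1) \<noteq> None" "S b \<noteq> None"
          by (auto simp: gaps_def)
        hence "S a = None" by simp
        thus ?thesis using b busy[of a] busy[of "a - 1"] busy[of b] by auto
      qed (use sB se' in simp)
    qed
    hence "card (insert s (fst ` gaps S)) \<le> card ?Q" by (intro card_mono) auto
    moreover have "s \<notin> fst ` gaps S" using busy by (fastforce simp: gaps_def)
    moreover have "finite (fst ` gaps S)" using \<open>insert s (fst ` gaps S) \<subseteq> ?Q\<close> finite_int_range[of s e "\<lambda>t. t \<notin> B \<and> (t = s \<or> t - 1 \<in> B)"]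
      by (meson finite_subset finite_insert)
    ultimately have "Suc (card (fst ` gaps S)) \<le> card ?Q" by simp
    thus ?thesis unfolding runs_def num_gaps_def using card_image[OF inj] by simp
  qed
  thus ?thesis using fS B(3) le_trans by blast
qed

theorem opt_gaps_mreach:
  assumes v: "valid_instance J" and fi: "feasible_instance J" and ks: "distinct ks" "set ks = {..<length J}"
    and so: "sorted (map dl (map ((!) J) ks))" and s: "\<And>j. j < length J \<Longrightarrow> s < rel (J ! j)"
    and T: "\<And>j. j < length J \<Longrightarrow> dl (J ! j) < T" and J: "J \<noteq> []"
    and k1: "\<And>j. j < length J \<Longrightarrow> rel (J ! j) < mreach T (map ((!) J) ks) s k"
    and k2: "\<And>k'. k' < k \<Longrightarrow> \<exists>j<length J. mreach T (map ((!) J) ks) s k' \<le> rel (J ! j)"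
  shows "opt_gaps J + 1 = k"
proof -
  obtain S0 where S0: "feasible_schedule J S0" using fi by (auto simp: feasible_instance_def)
  have g: "good T (map ((!) J) ks)" using good_levels[OF v S0 ks(1) _ so T] ks(2) by simp
  have sT: "s \<le> T"
  proof -
    have "J ! 0 \<in> set (map ((!) J) ks)" using ks(2) J by auto
    hence "rel (J ! 0) < dl (J ! 0)" using g by (auto simp: good_def)
    thus ?thesis using s[of 0] T[of 0] J by force
  qed
  have low: "k \<le> num_gaps S + 1" if fs: "feasible_schedule J S" for S
  proof (rule ccontr)
    assume "\<not> ?thesis"
    hence "num_gaps S + 1 < k" by simp
    from k2[OF this] obtain j where j: "j < length J" "mreach T (map ((!) J) ks) s (num_gaps S + 1) \<le> rel (J ! j)" by blast
    obtain e where "e \<le> T" "reach (map ((!) J) ks) s (num_gaps S + 1) e" "\<forall>j<length J. rel (J ! j) < e"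
      using schedule_reach[OF v fs ks so s T J] by blast
    thus False using mreach_props(4)[OF g sT, of "num_gaps S + 1" e] j by force
  qed
  obtain S where S: "feasible_schedule J S" "num_gaps S + 1 \<le> k"
    using reach_schedule[OF ks g s mreach_props(3)[OF g sT] k1 J] by blast
  have "opt_gaps J = num_gaps S" unfolding opt_gaps_def
  proof (rule Least_equality)
    show "\<exists>S'. feasible_schedule J S' \<and> num_gaps S' = num_gaps S" using S(1) by blast
    fix y assume "\<exists>S. feasible_schedule J S \<and> num_gaps S = y"
    thus "num_gaps S \<le> y" using low S(2) by fastforce
  qed
  thus ?thesis using S low[OF S(1)] by simp
qed

section \<open>A structured language over the machine\<close>

datatype com = SKIP | SETC nat int | ADD nat nat nat | SUB nat nat nat | LOAD nat nat | STORE nat nat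
  | SEQ com com (infixr ";;" 60) | IFLE nat nat com com | WHILELE nat nat com

type_synonym regs = "nat \<Rightarrow> int"
type_synonym heap = "int \<Rightarrow> int"

text \<open>Registers live at the negative addresses and the heap at the nonnegative ones. The third
  component of a state counts (an upper bound of) the elapsed machine steps.\<close>
inductive big :: "com \<Rightarrow> regs \<times> heap \<times> nat \<Rightarrow> regs \<times> heap \<times> nat \<Rightarrow> bool" where
  "big SKIP s s"
| "big (SETC x k) (v, H, t) (v(x := k), H, t + 1)"
| "big (ADD x y z) (v, H, t) (v(x := v y + v z), H, t + 1)"
| "big (SUB x y z) (v, H, t) (v(x := v y - v z), H, t + 1)"
| "0 \<le> v y \<Longrightarrow> big (LOAD x y) (v, H, t) (v(x := H (v y)), H, t + 1)"
| "0 \<le> v x \<Longrightarrow> big (STORE x y) (v, H, t) (v, H(v x := v y), t + 1)"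
| "big c1 s s' \<Longrightarrow> big c2 s' s'' \<Longrightarrow> big (c1 ;; c2) s s''"
| "v x \<le> v y \<Longrightarrow> big c1 (v, H, t + 2) s \<Longrightarrow> big (IFLE x y c1 c2) (v, H, t) s"
| "\<not> v x \<le> v y \<Longrightarrow> big c2 (v, H, t + 2) s \<Longrightarrow> big (IFLE x y c1 c2) (v, H, t) s"
| "\<not> v x \<le> v y \<Longrightarrow> big (WHILELE x y c) (v, H, t) (v, H, t + 2)"
| "v x \<le> v y \<Longrightarrow> big c (v, H, t + 2) s \<Longrightarrow> big (WHILELE x y c) s s' \<Longrightarrow> big (WHILELE x y c) (v, H, t) s'"

text \<open>Input and output use addresses from 0 on and all other cells start with 0, so the
  negative addresses are zeroed registers out of reach of the heap operations.\<close>

definition rg :: "nat \<Rightarrow> int" where "rg x = - 1 - int x"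

definition mem :: "regs \<Rightarrow> heap \<Rightarrow> int \<Rightarrow> int" where
  "mem v H a = (if a < 0 then v (nat (- 1 - a)) else H a)"

fun csize :: "com \<Rightarrow> nat" where
  "csize SKIP = 0"
| "csize (c1 ;; c2) = csize c1 + csize c2"
| "csize (IFLE x y c1 c2) = csize c1 + csize c2 + 2"
| "csize (WHILELE x y c) = csize c + 3"
| "csize _ = 1"

text \<open>\<open>JumpLe 0 0 k\<close> is an unconditional jump. A true test jumps, so the second
  branch is placed first. The program halts by running off its end.\<close>

fun comp :: "com \<Rightarrow> nat \<Rightarrow> prog" where
  "comp SKIP i = []"
| "comp (SETC x k) i = [LoadConst (rg x) k]"
| "comp (ADD x y z) i = [AddI (rg x) (rg y) (rg z)]"
| "comp (SUB x y z) i = [SubI (rg x) (rg y) (rg z)]"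
| "comp (LOAD x y) i = [LoadInd (rg x) (rg y)]"
| "comp (STORE x y) i = [StoreInd (rg x) (rg y)]"
| "comp (c1 ;; c2) i = comp c1 i @ comp c2 (i + csize c1)"
| "comp (IFLE x y c1 c2) i = [JumpLe (rg x) (rg y) (i + csize c2 + 2)] @ comp c2 (i + 1) @
     [JumpLe 0 0 (i + csize c2 + 2 + csize c1)] @ comp c1 (i + csize c2 + 2)"
| "comp (WHILELE x y c) i = [JumpLe (rg x) (rg y) (i + 2), JumpLe 0 0 (i + csize c + 3)] @
     comp c (i + 2) @ [JumpLe 0 0 i]"

lemma length_comp [simp]: "length (comp c i) = csize c"
  by (induction c arbitrary: i) auto

definition at :: "prog \<Rightarrow> nat \<Rightarrow> prog \<Rightarrow> bool" where
  "at P i Q \<longleftrightarrow> (\<forall>j<length Q. i + j < length P \<and> P ! (i + j) = Q ! j)"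

lemma at_append: "at P i (Q1 @ Q2) \<longleftrightarrow> at P i Q1 \<and> at P (i + length Q1) Q2"
proof
  assume a: "at P i (Q1 @ Q2)"
  have "i + j < length P \<and> P ! (i + j) = Q1 ! j" if "j < length Q1" for j
    using a that unfolding at_def by (auto simp: nth_append dest: spec[of _ j])
  moreover have "i + length Q1 + j < length P \<and> P ! (i + length Q1 + j) = Q2 ! j" if "j < length Q2" for j
    using a[unfolded at_def, rule_format, of "length Q1 + j"] that by (auto simp: nth_append add.assoc)
  ultimately show "at P i Q1 \<and> at P (i + length Q1) Q2" by (auto simp: at_def)
next
  assume a: "at P i Q1 \<and> at P (i + length Q1) Q2"
  show "at P i (Q1 @ Q2)" unfolding at_def
  proof (intro allI impI)
    fix j assume j: "j < length (Q1 @ Q2)"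
    show "i + j < length P \<and> P ! (i + j) = (Q1 @ Q2) ! j"
    proof (cases "j < length Q1")
      case True thus ?thesis using a by (auto simp: at_def nth_append)
    next
      case False
      hence "j - length Q1 < length Q2" "i + length Q1 + (j - length Q1) = i + j" using j by auto
      thus ?thesis using a False by (auto simp: at_def nth_append)
    qed
  qed
qed

lemma at_Cons: "at P i (x # Q) \<longleftrightarrow> (i < length P \<and> P ! i = x) \<and> at P (Suc i) Q"
  using at_append[of P i "[x]" Q] by (auto simp: at_def)

lemma at_Nil [simp]: "at P i []"
  by (simp add: at_def)

lemma step_at:
  assumes "i < length P" "P ! i = x" "x \<noteq> Halt"
  shows "step P (i, M) = exec_instr x (i, M)"
  using assms by (simp add: step_def halted_def)

lemma mem_rg [simp]: "mem v H (rg x) = v x"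
  by (simp add: mem_def rg_def)

lemma mem_heap [simp]: "0 \<le> a \<Longrightarrow> mem v H a = H a"
  by (simp add: mem_def)

lemma mem_upd_rg [simp]: "(mem v H)(rg x := k) = mem (v(x := k)) H"
  by (rule ext) (auto simp: mem_def rg_def)

lemma mem_upd_heap [simp]: "0 \<le> a \<Longrightarrow> (mem v H)(a := k) = mem v (H(a := k))"
  by (rule ext) (auto simp: mem_def)

definition steps :: "prog \<Rightarrow> nat \<Rightarrow> config \<Rightarrow> config \<Rightarrow> bool" where
  "steps P n c c' \<longleftrightarrow> (\<exists>k\<le>n. (step P ^^ k) c = c')"

lemma steps_trans: "steps P n c c' \<Longrightarrow> steps P m c' c'' \<Longrightarrow> steps P (n + m) c c''"
proof -
  assume "steps P n c c'" "steps P m c' c''"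
  then obtain k l where "k \<le> n" "l \<le> m" "(step P ^^ k) c = c'" "(step P ^^ l) c' = c''" by (auto simp: steps_def)
  hence "l + k \<le> n + m" "(step P ^^ (l + k)) c = c''" by (auto simp: funpow_add)
  thus ?thesis unfolding steps_def by blast
qed

lemma steps_refl [simp]: "steps P n c c"
  unfolding steps_def by (rule exI[of _ 0]) simp

lemma steps_1: "step P c = c' \<Longrightarrow> steps P 1 c c'"
  unfolding steps_def by (rule exI[of _ 1]) simp

lemma steps_mono: "steps P n c c' \<Longrightarrow> n \<le> m \<Longrightarrow> steps P m c c'"
  unfolding steps_def using le_trans by blast

text \<open>A test is charged 2: this covers the test itself and the jump that closes a branch or a
  loop body, or leaves the loop. So the ghost time bounds the machine steps.\<close>

lemma compile_correct:
  "big c s s' \<Longrightarrow> at P i (comp c i) \<Longrightarrow>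
    snd (snd s) \<le> snd (snd s') \<and>
    steps P (snd (snd s') - snd (snd s)) (i, mem (fst s) (fst (snd s))) (i + csize c, mem (fst s') (fst (snd s')))"
proof (induction arbitrary: i rule: big.induct)
  case (7 c1 s s' c2 s'')
  have a: "at P i (comp c1 i)" "at P (i + csize c1) (comp c2 (i + csize c1))" using 7(5) by (auto simp: at_append)
  note b = 7(3)[OF a(1)] 7(4)[OF a(2)]
  have "steps P ((snd (snd s') - snd (snd s)) + (snd (snd s'') - snd (snd s'))) (i, mem (fst s) (fst (snd s)))
    (i + csize c1 + csize c2, mem (fst s'') (fst (snd s'')))" using b steps_trans by blast
  thus ?case using b by (auto simp: add.assoc intro: steps_mono)
next
  case (8 v x y c1 H t s c2)
  have a: "i < length P" "P ! i = JumpLe (rg x) (rg y) (i + csize c2 + 2)"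
    "at P (i + csize c2 + 2) (comp c1 (i + csize c2 + 2))" using 8(4) by (auto simp: at_append at_Cons)
  have "step P (i, mem v H) = (i + csize c2 + 2, mem v H)" using 8(1) step_at[OF a(1,2)] by simp
  from steps_trans[OF steps_1[OF this]] 8(3)[OF a(3)]
  have "t + 2 \<le> snd (snd s)" "steps P (1 + (snd (snd s) - (t + 2))) (i, mem v H) (i + csize c2 + 2 + csize c1, mem (fst s) (fst (snd s)))"
    by auto
  thus ?case by (auto simp: algebra_simps elim!: steps_mono)
next
  case (9 v x y c2 H t s c1)
  have a: "i < length P" "P ! i = JumpLe (rg x) (rg y) (i + csize c2 + 2)" "at P (i + 1) (comp c2 (i + 1))"
    "i + 1 + csize c2 < length P" "P ! (i + 1 + csize c2) = JumpLe 0 0 (i + csize c2 + 2 + csize c1)"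
    using 9(4) by (auto simp: at_append at_Cons)
  have "step P (i, mem v H) = (i + 1, mem v H)" using 9(1) step_at[OF a(1,2)] by simp
  from steps_trans[OF steps_1[OF this]] 9(3)[OF a(3)]
  have b: "t + 2 \<le> snd (snd s)" "steps P (1 + (snd (snd s) - (t + 2))) (i, mem v H) (i + 1 + csize c2, mem (fst s) (fst (snd s)))"
    by auto
  have "step P (i + 1 + csize c2, mem (fst s) (fst (snd s))) = (i + csize c2 + 2 + csize c1, mem (fst s) (fst (snd s)))"
    using step_at[OF a(4,5)] by simp
  from steps_trans[OF b(2) steps_1[OF this]] b(1) show ?case by (auto simp: algebra_simps elim!: steps_mono)
next
  case (10 v x y c H t)
  have a: "i < length P" "P ! i = JumpLe (rg x) (rg y) (i + 2)" "i + 1 < length P" "P ! (i + 1) = JumpLe 0 0 (i + csize c + 3)"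
    using 10(2) by (auto simp: at_append at_Cons)
  have "step P (i, mem v H) = (i + 1, mem v H)" using 10(1) step_at[OF a(1,2)] by simp
  moreover have "step P (i + 1, mem v H) = (i + csize c + 3, mem v H)" using step_at[OF a(3,4)] by simp
  ultimately have "steps P (1 + 1) (i, mem v H) (i + csize c + 3, mem v H)" using steps_trans steps_1 by blast
  thus ?case by (simp add: algebra_simps numeral_2_eq_2)
next
  case (11 v x y c H t s s')
  have a: "i < length P" "P ! i = JumpLe (rg x) (rg y) (i + 2)" "at P (i + 2) (comp c (i + 2))"
    "i + 2 + csize c < length P" "P ! (i + 2 + csize c) = JumpLe 0 0 i" using 11(6) by (auto simp: at_append at_Cons)
  have "step P (i, mem v H) = (i + 2, mem v H)" using 11(1) step_at[OF a(1,2)] by simp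
  from steps_trans[OF steps_1[OF this]] 11(4)[OF a(3)]
  have b: "t + 2 \<le> snd (snd s)" "steps P (1 + (snd (snd s) - (t + 2))) (i, mem v H) (i + 2 + csize c, mem (fst s) (fst (snd s)))"
    by auto
  have "step P (i + 2 + csize c, mem (fst s) (fst (snd s))) = (i, mem (fst s) (fst (snd s)))" using step_at[OF a(4,5)] by simp
  from steps_trans[OF b(2) steps_1[OF this]]
  have c: "steps P (snd (snd s) - t) (i, mem v H) (i, mem (fst s) (fst (snd s)))" using b(1) by (auto elim!: steps_mono)
  from 11(5)[OF 11(6)] have d: "snd (snd s) \<le> snd (snd s')"
    "steps P (snd (snd s') - snd (snd s)) (i, mem (fst s) (fst (snd s))) (i + csize (WHILELE x y c), mem (fst s') (fst (snd s')))" by auto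
  from steps_trans[OF c d(2)] show ?case using b d by (auto elim!: steps_mono)
qed (auto simp: at_Cons intro!: steps_1[simplified] simp: step_at)

section \<open>Total correctness with elapsed time in the state\<close>

definition wp :: "com \<Rightarrow> (regs \<Rightarrow> heap \<Rightarrow> nat \<Rightarrow> bool) \<Rightarrow> regs \<Rightarrow> heap \<Rightarrow> nat \<Rightarrow> bool" where
  "wp c Q v H t \<longleftrightarrow> (\<exists>v' H' t'. big c (v, H, t) (v', H', t') \<and> Q v' H' t')"

lemma wp_simps:
  "Q v H t \<Longrightarrow> wp SKIP Q v H t"
  "Q (v(x := k)) H (t + 1) \<Longrightarrow> wp (SETC x k) Q v H t"
  "Q (v(x := v y + v z)) H (t + 1) \<Longrightarrow> wp (ADD x y z) Q v H t"
  "Q (v(x := v y - v z)) H (t + 1) \<Longrightarrow> wp (SUB x y z) Q v H t"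
  "0 \<le> v y \<Longrightarrow> Q (v(x := H (v y))) H (t + 1) \<Longrightarrow> wp (LOAD x y) Q v H t"
  "0 \<le> v x \<Longrightarrow> Q v (H(v x := v y)) (t + 1) \<Longrightarrow> wp (STORE x y) Q v H t"
  "wp c1 (wp c2 Q) v H t \<Longrightarrow> wp (c1 ;; c2) Q v H t"
  "(v x \<le> v y \<Longrightarrow> wp c1 Q v H (t + 2)) \<Longrightarrow> (\<not> v x \<le> v y \<Longrightarrow> wp c2 Q v H (t + 2)) \<Longrightarrow>
     wp (IFLE x y c1 c2) Q v H t"
  unfolding wp_def by (blast intro: big.intros)+

lemma wp_conseq: "wp c Q v H t \<Longrightarrow> (\<And>v' H' t'. Q v' H' t' \<Longrightarrow> Q' v' H' t') \<Longrightarrow> wp c Q' v H t"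
  unfolding wp_def by blast

text \<open>For loops with a known number \<open>N\<close> of rounds. The counter \<open>i\<close>
  is a ghost, so the invariant can bound the time by a multiple of \<open>i\<close>; the outcome of
  the test follows from the invariant.\<close>

lemma wp_for:
  assumes "I 0 v H t"
    and "\<And>i v H t. i < N \<Longrightarrow> I i v H t \<Longrightarrow> v x \<le> v y \<and> wp c (I (Suc i)) v H (t + 2)"
    and "\<And>v H t. I N v H t \<Longrightarrow> \<not> v x \<le> v y \<and> Q v H (t + 2)"
  shows "wp (WHILELE x y c) Q v H t"
proof -
  have "wp (WHILELE x y c) Q v H t" if "j \<le> N" "I (N - j) v H t" for j v H t
    using that
  proof (induction j arbitrary: v H t)
    case 0
    thus ?case using assms(3)[of v H t] unfolding wp_def by (auto simp del: add_2_eq_Suc' intro: big.intros)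
  next
    case (Suc j)
    have lt: "N - Suc j < N" "Suc (N - Suc j) = N - j" using Suc by auto
    from assms(2)[OF lt(1) Suc.prems(2)] obtain v' H' t' where
      b: "v x \<le> v y" "big c (v, H, t + 2) (v', H', t')" "I (N - j) v' H' t'" unfolding wp_def lt(2) by blast
    have "wp (WHILELE x y c) Q v' H' t'" using Suc b(3) by simp
    thus ?case using b unfolding wp_def by (blast intro: big.intros)
  qed
  from this[of N] assms(1) show ?thesis by simp
qed

text \<open>For the sweep over the release times, whose number of rounds is not fixed in advance.
  \<open>f\<close> gives termination only; the time bound is left to \<open>I\<close>.\<close>

lemma wp_while:
  assumes "I v H t"
    and "\<And>v H t. I v H t \<Longrightarrow> v x \<le> v y \<Longrightarrow> wp c (\<lambda>v' H' t'. I v' H' t' \<and> f v' H' < (f v H :: nat)) v H (t + 2)"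
    and "\<And>v H t. I v H t \<Longrightarrow> \<not> v x \<le> v y \<Longrightarrow> Q v H (t + 2)"
  shows "wp (WHILELE x y c) Q v H t"
  using assms(1)
proof (induction "f v H" arbitrary: v H t rule: less_induct)
  case less
  show ?case
  proof (cases "v x \<le> v y")
    case True
    from assms(2)[OF less(2) True] obtain v' H' t' where
      b: "big c (v, H, t + 2) (v', H', t')" "I v' H' t'" "f v' H' < f v H" unfolding wp_def by blast
    have "wp (WHILELE x y c) Q v' H' t'" using less b by simp
    thus ?thesis using b True unfolding wp_def by (blast intro: big.intros)
  next
    case False thus ?thesis using assms(3)[OF less(2) False] unfolding wp_def by (blast intro: big.intros)
  qed
qed

lemma computes_within_wp:
  assumes "wp c (\<lambda>v H t. H 0 = r \<and> t \<le> T) (\<lambda>_. 0) (encode J) 0"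
  shows "computes_within (comp c 0) J T r"
proof -
  let ?P = "comp c 0"
  obtain v' H' t' where b: "big c (\<lambda>_. 0, encode J, 0) (v', H', t')" "H' 0 = r" "t' \<le> T"
    using assms unfolding wp_def by blast
  have m: "mem (\<lambda>_. 0) (encode J) = encode J" by (rule ext) (auto simp: mem_def encode_def)
  have "at ?P 0 ?P" by (simp add: at_def)
  from compile_correct[OF b(1) this] m obtain k where k: "k \<le> t'" "(step ?P ^^ k) (0, encode J) = (csize c, mem v' H')"
    by (auto simp: steps_def)
  have "halted ?P (csize c, mem v' H')" by (simp add: halted_def)
  thus ?thesis unfolding computes_within_def using k b by (intro exI[of _ k]) auto
qed

section \<open>The program\<close>

text \<open>The numbering keeps the set of registers a routine overwrites to a few intervals: below
  20 the constants, with \<open>rR\<close>, \<open>rNew\<close> and \<open>rK\<close> changing once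
  per level; 20 to 25 the search; 31 to 36 the present job and rows; from 40 on the scratch of the
  loops.\<close>

abbreviation (input) "rZ \<equiv> 0 :: nat"
abbreviation (input) "rOne \<equiv> 1 :: nat"
abbreviation (input) "rN \<equiv> 2 :: nat"
abbreviation (input) "rW \<equiv> 3 :: nat"
abbreviation (input) "rX0 \<equiv> 4 :: nat"
abbreviation (input) "rXN \<equiv> 5 :: nat"
abbreviation (input) "rT \<equiv> 6 :: nat"
abbreviation (input) "rR \<equiv> 7 :: nat"
abbreviation (input) "rNew \<equiv> 8 :: nat"
abbreviation (input) "rC \<equiv> 9 :: nat"
abbreviation (input) "rTwo \<equiv> 10 :: nat"
abbreviation (input) "rThree \<equiv> 11 :: nat"
abbreviation (input) "rK \<equiv> 12 :: nat"
abbreviation (input) "rT1 \<equiv> 13 :: nat"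
abbreviation (input) "rE \<equiv> 20 :: nat"
abbreviation (input) "rJ \<equiv> 21 :: nat"
abbreviation (input) "rRJ \<equiv> 22 :: nat"
abbreviation (input) "rX \<equiv> 23 :: nat"
abbreviation (input) "rA \<equiv> 24 :: nat"
abbreviation (input) "rB \<equiv> 25 :: nat"
abbreviation (input) "rKp \<equiv> 31 :: nat"
abbreviation (input) "rP \<equiv> 32 :: nat"
abbreviation (input) "rRel \<equiv> 33 :: nat"
abbreviation (input) "rD \<equiv> 34 :: nat"
abbreviation (input) "rS \<equiv> 35 :: nat"
abbreviation (input) "rM \<equiv> 36 :: nat"
abbreviation (input) "rPR \<equiv> 40 :: nat"
abbreviation (input) "rPE \<equiv> 41 :: nat"
abbreviation (input) "rCE \<equiv> 42 :: nat"
abbreviation (input) "rNS \<equiv> 43 :: nat"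
abbreviation (input) "rHH \<equiv> 44 :: nat"
abbreviation (input) "rPC \<equiv> 45 :: nat"
abbreviation (input) "rPN \<equiv> 46 :: nat"
abbreviation (input) "rPJ \<equiv> 47 :: nat"
abbreviation (input) "rDiff \<equiv> 48 :: nat"
abbreviation (input) "rEp \<equiv> 49 :: nat"
abbreviation (input) "rc \<equiv> 50 :: nat"
abbreviation (input) "rVal \<equiv> 51 :: nat"
abbreviation (input) "rOld \<equiv> 52 :: nat"
abbreviation (input) "rPd \<equiv> 53 :: nat"
abbreviation (input) "rL \<equiv> 54 :: nat"

text \<open>The search keeps in \<open>rRJ\<close> the least value of field \<open>f\<close> that is
  at least \<open>rE\<close>, and its row in \<open>rJ\<close>. On ties the first row stays, so each
  release time is always represented by the same row.\<close>

definition scan_body :: "nat \<Rightarrow> com" where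
  "scan_body f =
     ADD rA rX f ;; LOAD rB rA ;;
     IFLE rE rB (IFLE rRJ rB SKIP (ADD rJ rX rZ ;; ADD rRJ rB rZ)) SKIP ;;
     ADD rX rX rW"

definition scan :: "nat \<Rightarrow> com" where
  "scan f = SETC rJ 0 ;; ADD rRJ rT rZ ;; ADD rX rX0 rZ ;; WHILELE rX rXN (scan_body f)"

text \<open>Without multiplication, addresses are advanced instead of computed: \<open>rPC\<close>
  runs over the costs of row \<open>rM\<close> from column 0 on, while \<open>rPN\<close> and
  \<open>rPJ\<close> run, from column \<open>h\<close> on, over the candidates and the costs of the
  next row. Comparing with \<open>rT1\<close>, which is \<open>T - 1\<close>, tests strictly whether
  a next release exists.\<close>

definition gloop_body :: com where
  "gloop_body =
     LOAD rc rPC ;;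
     IFLE rc rP
       (SUB rVal rEp rc ;; LOAD rOld rPN ;; IFLE rVal rOld SKIP (STORE rPN rVal) ;;
        IFLE rRJ rT1 (ADD rVal rc rDiff ;; LOAD rOld rPJ ;; IFLE rOld rVal SKIP (STORE rPJ rVal)) SKIP)
       SKIP ;;
     ADD rPC rPC rOne ;; ADD rPN rPN rOne ;; ADD rPJ rPJ rOne"

definition gloop :: com where
  "gloop = ADD rPC rM rC ;; ADD rPN rNS rZ ;; ADD rPJ rJ rHH ;; SUB rDiff rRJ rE ;; ADD rEp rE rP ;;
     WHILELE rPC rCE gloop_body"

definition hloop_body :: com where
  "hloop_body =
     LOAD rE rPR ;; IFLE rRel rE (scan rOne ;; gloop) SKIP ;;
     ADD rPR rPR rOne ;; SUB rCE rCE rOne ;; ADD rNS rNS rOne ;; ADD rHH rHH rOne"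

definition hloop :: com where
  "hloop = ADD rPR rM rR ;; ADD rL rPR rN ;; ADD rCE rM rC ;; ADD rCE rCE rN ;; ADD rNS rS rNew ;;
     ADD rHH rC rZ ;; WHILELE rPR rL hloop_body"

text \<open>Searching from the present release time plus one visits the later release times once
  each in increasing order, a topological order of the shortest path problem.\<close>

definition mloop_body :: com where
  "mloop_body = ADD rM rJ rZ ;; hloop ;; LOAD rE rM ;; ADD rE rE rOne ;; scan rOne"

definition mloop :: com where
  "mloop = ADD rJ rS rZ ;; LOAD rRJ rS ;; WHILELE rRJ rT1 mloop_body"

definition copyrow :: com where
  "copyrow = ADD rPR rS rR ;; ADD rPE rPR rN ;; ADD rPN rS rNew ;;
     WHILELE rPR rPE (LOAD rA rPR ;; STORE rPN rA ;; ADD rPR rPR rOne ;; ADD rPN rPN rOne)"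

definition clearcol :: com where
  "clearcol = ADD rPC rX rC ;; ADD rPE rPC rN ;; WHILELE rPC rPE (STORE rPC rVal ;; ADD rPC rPC rOne)"

text \<open>The cost \<open>p + 1\<close> stands for infinity, since a chain may not spend more than
  the work \<open>p\<close> of the new job.\<close>

definition clearC :: com where
  "clearC = ADD rVal rP rOne ;; ADD rX rX0 rZ ;; WHILELE rX rXN (clearcol ;; ADD rX rX rW) ;;
     ADD rPC rS rC ;; STORE rPC rZ"

text \<open>The flag \<open>rPd\<close> tells whether the previous column passes all releases, the
  old ones by the search and the new one by comparison with \<open>rRel\<close>; in that case the
  entry becomes \<open>T\<close>.\<close>

definition capl_body :: com where
  "capl_body =
     LOAD rE rPN ;; IFLE rOne rPd (ADD rE rT rZ) (IFLE rE rD SKIP (ADD rE rD rZ)) ;;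
     STORE rPN rE ;; scan rOne ;; SETC rPd 0 ;;
     IFLE rT rRJ (IFLE rE rRel SKIP (SETC rPd 1)) SKIP ;; ADD rPN rPN rOne"

definition capl :: com where
  "capl = SETC rPd 0 ;; ADD rPN rS rNew ;; ADD rPE rPN rN ;; WHILELE rPN rPE capl_body"

text \<open>A row that starts after the release of the new job is not affected by it, so copying
  completes such a row.\<close>

definition rowc :: com where
  "rowc = copyrow ;; LOAD rA rS ;; IFLE rA rRel (clearC ;; mloop ;; capl) SKIP"

text \<open>The start time stored in row 0 lies below all deadlines, so the search in field 2 from
  there yields an untreated job of earliest deadline. At the end its release becomes visible in
  field 1 and its deadline is hidden by \<open>T\<close>.\<close>

definition level :: com where
  "level = LOAD rE rX0 ;; scan rTwo ;; ADD rKp rJ rZ ;; ADD rD rRJ rZ ;; LOAD rRel rKp ;;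
     ADD rA rKp rThree ;; LOAD rP rA ;; ADD rS rX0 rZ ;; WHILELE rS rXN (rowc ;; ADD rS rS rW) ;;
     ADD rA rKp rOne ;; STORE rA rRel ;; ADD rA rKp rTwo ;; STORE rA rT ;;
     ADD rA rR rZ ;; ADD rR rNew rZ ;; ADD rNew rA rZ"

definition levels :: com where
  "levels = ADD rK rOne rZ ;; WHILELE rK rN (level ;; ADD rK rK rOne)"

text \<open>The count starts at -1 because the leading idle run is not a gap.\<close>

definition answer :: com where
  "answer = SETC rVal (-1) ;; ADD rPR rX0 rR ;; LOAD rE rPR ;; scan rOne ;;
     WHILELE rRJ rT1 (ADD rVal rVal rOne ;; ADD rPR rPR rOne ;; LOAD rE rPR ;; scan rOne) ;;
     STORE rZ rVal"

text \<open>A row has 4 fields and 3 blocks of length n + 1, hence the width 3n + 7 and the block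
  offsets 4, n + 5 and 2n + 6.\<close>

definition layout :: com where
  "layout = ADD rA rN rN ;; ADD rA rA rN ;; ADD rX0 rA rOne ;; SETC rB 7 ;; ADD rW rA rB ;; SETC rR 4 ;;
     SETC rB 5 ;; ADD rNew rN rB ;; ADD rC rNew rN ;; ADD rC rC rOne"

definition minmax_body :: com where
  "minmax_body =
     ADD rPC rPR rOne ;; LOAD rB rPC ;; IFLE rRel rB SKIP (ADD rRel rB rZ) ;;
     ADD rPC rPR rTwo ;; LOAD rB rPC ;; IFLE rB rT1 SKIP (ADD rT1 rB rZ) ;;
     ADD rXN rXN rW ;; ADD rPR rPR rThree"

definition minmax :: com where
  "minmax = LOAD rRel rTwo ;; LOAD rT1 rThree ;; ADD rXN rX0 rZ ;; ADD rPR rOne rZ ;;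
     WHILELE rPR rA minmax_body ;; ADD rT rT1 rOne"

definition fillrow :: com where
  "fillrow = STORE rX rRel ;; ADD rB rX rOne ;; STORE rB rT ;; ADD rB rX rTwo ;; STORE rB rD ;;
     ADD rB rX rThree ;; STORE rB rP ;; ADD rPC rX rR ;; ADD rPE rPC rN ;; STORE rPC rRel ;;
     ADD rPC rPC rOne ;; WHILELE rPC rPE (STORE rPC rT ;; ADD rPC rPC rOne)"

definition fillrows :: com where
  "fillrows = SUB rRel rRel rOne ;; ADD rD rT rZ ;; ADD rX rX0 rZ ;; fillrow ;; ADD rPR rOne rZ ;;
     WHILELE rPR rA (ADD rX rX rW ;; LOAD rP rPR ;; ADD rPR rPR rOne ;; LOAD rRel rPR ;;
       ADD rPR rPR rOne ;; LOAD rD rPR ;; ADD rPR rPR rOne ;; fillrow)"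

definition main :: com where
  "main = SETC rOne 1 ;; SETC rTwo 2 ;; SETC rThree 3 ;; LOAD rN rZ ;;
     IFLE rOne rN (layout ;; minmax ;; fillrows ;; levels ;; answer) SKIP"

text \<open>The heap behind the input holds a row for each job and row 0 for the start before all releases.
  Its entries are the release time, the release time or \<open>T\<close> if the job is not yet treated, the deadline
  or \<open>T\<close> if it is, and the work, followed by three blocks of length \<open>n + 1\<close>: the reaches of the present
  and of the next level, which change places at each level, and the costs of the chains.\<close>
definition cell :: "nat \<Rightarrow> nat \<Rightarrow> int \<Rightarrow> int" where
  "cell n i k = 3 * int n + 1 + int i * (3 * int n + 7) + k"

text \<open>Offsets are smaller than the row width, so row and offset are quotient and
  remainder.\<close>

lemma cell_eq:
  assumes "0 \<le> k" "k < 3 * int n + 7" "0 \<le> k'" "k' < 3 * int n + 7"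
  shows "cell n i k = cell n i' k' \<longleftrightarrow> i = i' \<and> k = k'"
proof
  assume a: "cell n i k = cell n i' k'"
  let ?W = "3 * int n + 7"
  have e: "int i * ?W + k = int i' * ?W + k'" using a by (simp add: cell_def)
  have "(int i * ?W + k) div ?W = int i" "(int i' * ?W + k') div ?W = int i'" using assms by auto
  hence "i = i'" using e by simp
  thus "i = i' \<and> k = k'" using e by simp
qed simp

lemma cell_nonneg: "0 \<le> k \<Longrightarrow> 0 \<le> cell n i k"
  by (simp add: cell_def)

lemma cell_gt_input: "0 \<le> k \<Longrightarrow> 3 * int n < cell n i k"
proof -
  assume "0 \<le> k"
  moreover have "0 \<le> int i * (3 * int n + 7)" by simp
  ultimately show ?thesis unfolding cell_def by linarith
qed

lemma cell_le [simp]: "cell n i k \<le> cell n i k' \<longleftrightarrow> k \<le> k'"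
  by (simp add: cell_def)

lemma cell_add [simp]: "cell n i k + l = cell n i (k + l)" "cell n i k - l = cell n i (k - l)"
  by (simp_all add: cell_def)

lemma cell_next: "cell n i (3 * int n + 7) = cell n (Suc i) 0"
  by (simp add: cell_def algebra_simps)

lemma row_le [simp]: "cell n i 0 \<le> cell n j 0 \<longleftrightarrow> i \<le> j"
  by (simp add: cell_def)

abbreviation (input) "cost_cell n i x \<equiv> cell n i (2 * int n + 6 + int x)"
abbreviation (input) "keeps X v v' \<equiv> \<forall>x. x \<notin> X \<longrightarrow> v' x = v x"

definition cst :: "nat \<Rightarrow> int \<Rightarrow> regs \<Rightarrow> bool" where
  "cst n T v \<longleftrightarrow> v rZ = 0 \<and> v rOne = 1 \<and> v rN = int n \<and> v rW = 3 * int n + 7 \<and> v rX0 = cell n 0 0 \<and>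
     v rXN = cell n n 0 \<and> v rT = T \<and> v rT1 = T - 1 \<and> v rC = 2 * int n + 6 \<and> v rTwo = 2 \<and> v rThree = 3"

definition offs :: "nat \<Rightarrow> int \<Rightarrow> int \<Rightarrow> bool" where
  "offs n a b \<longleftrightarrow> (a = 4 \<and> b = int n + 5) \<or> (a = int n + 5 \<and> b = 4)"

text \<open>A result \<open>T\<close> means that there is no next value, and then \<open>j\<close> is arbitrary.\<close>
definition nxt :: "(nat \<Rightarrow> int) \<Rightarrow> nat \<Rightarrow> int \<Rightarrow> int \<Rightarrow> int \<Rightarrow> nat \<Rightarrow> bool" where
  "nxt f m T e \<rho> j \<longleftrightarrow> \<rho> \<le> T \<and> (\<forall>i<m. e \<le> f i \<longrightarrow> \<rho> \<le> f i) \<and>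
     (\<rho> < T \<longrightarrow> j < m \<and> f j = \<rho> \<and> e \<le> \<rho> \<and> (\<forall>i<j. f i \<noteq> \<rho>))"

text \<open>After \<open>i\<close> rounds, \<open>nxt\<close> holds for the first \<open>i\<close>
  rows. The constants in the time bounds, here and later, are rounded up generously.\<close>

lemma scan_spec:
  assumes c: "cst n T v" and f: "v fr = k" "fr \<notin> {21..25}" "0 \<le> k" and H: "\<And>i. i \<le> n \<Longrightarrow> H (cell n i k) = f i"
  shows "wp (scan fr) (\<lambda>v' H' t'. H' = H \<and> t' \<le> t + 20 * Suc n \<and>
      (\<exists>j. nxt f (Suc n) T (v rE) (v' rRJ) j \<and> (v' rRJ < T \<longrightarrow> v' rJ = cell n j 0)) \<and>
      keeps {21..25} v v') v H t" (is "wp _ ?Q _ _ _")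
proof -
  define I where "I i v' H' t' \<longleftrightarrow> H' = H \<and> t' \<le> t + 3 + 13 * i \<and> v' rX = cell n i 0 \<and>
      (\<exists>j. nxt f i T (v rE) (v' rRJ) j \<and> (v' rRJ < T \<longrightarrow> v' rJ = cell n j 0)) \<and>
      keeps {21..25} v v'" for i :: nat and v' :: regs and H' :: heap and t' :: nat
  have loop: "wp (WHILELE rX rXN (scan_body fr)) ?Q v' H' t'" if "I 0 v' H' t'" for v' H' t'
  proof (rule wp_for[where I = I and N = "Suc n", OF that])
    fix i v1 H1 t1 assume i: "i < Suc n" and I: "I i v1 H1 t1"
    have H1: "H1 = H" and t1: "t1 \<le> t + 3 + 13 * i" and X: "v1 rX = cell n i 0" and
      fr: "\<And>x. x \<notin> {21..25} \<Longrightarrow> v1 x = v x" using I by (auto simp: I_def)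
    obtain j where j: "nxt f i T (v rE) (v1 rRJ) j" "v1 rRJ < T \<longrightarrow> v1 rJ = cell n j 0" using I by (auto simp: I_def)
    have r: "v1 rZ = 0" "v1 rXN = cell n n 0" "v1 rW = 3 * int n + 7" "v1 rE = v rE" "v1 fr = k"
      using fr[of rZ] fr[of rXN] fr[of rW] fr[of rE] fr[of fr] c f by (auto simp: cst_def)
    have a: "H (cell n i k) = f i" "0 \<le> cell n i k" using H i f(3) cell_nonneg by auto
    have n1: "nxt f (Suc i) T (v rE) (v1 rRJ) j" if "v rE \<le> f i \<longrightarrow> v1 rRJ \<le> f i"
      using j(1) that by (auto simp: nxt_def less_Suc_eq)
    have n2: "nxt f (Suc i) T (v rE) (f i) i" if "v rE \<le> f i" "\<not> v1 rRJ \<le> f i"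
      using j(1) that by (auto simp: nxt_def less_Suc_eq not_le)
    show "v1 rX \<le> v1 rXN \<and> wp (scan_body fr) (I (Suc i)) v1 H1 (t1 + 2)"
    proof
      show "v1 rX \<le> v1 rXN" using X r i by simp
      show "wp (scan_body fr) (I (Suc i)) v1 H1 (t1 + 2)"
        unfolding scan_body_def
        apply (intro wp_simps)
        using X r H1 a f(2) t1 fr j n1 n2 by (auto simp: I_def cell_next)
    qed
  next
    fix v1 H1 t1 assume I: "I (Suc n) v1 H1 t1"
    hence "v1 rXN = cell n n 0" "v1 rX = cell n (Suc n) 0" using c by (auto simp: I_def cst_def)
    hence "\<not> v1 rX \<le> v1 rXN" by simp
    thus "\<not> v1 rX \<le> v1 rXN \<and> ?Q v1 H1 (t1 + 2)" using I by (auto simp: I_def)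
  qed
  show ?thesis unfolding scan_def
    apply (intro wp_simps)
    apply (rule loop)
    using c by (auto simp: I_def cst_def nxt_def)
qed


section \<open>Relaxing the edges out of one row for a fixed number of idle runs\<close>

definition gup :: "nat \<Rightarrow> nat \<Rightarrow> int \<Rightarrow> nat \<Rightarrow> nat \<Rightarrow> nat \<Rightarrow> int \<Rightarrow> int \<Rightarrow> int \<Rightarrow> bool \<Rightarrow> heap \<Rightarrow> nat \<Rightarrow> heap \<Rightarrow> bool" where
  "gup n S b m j h e p \<rho> live H g H' \<longleftrightarrow>
    (\<forall>x\<le>n. H' (cell n S (b + int x)) =
       (if h \<le> x \<and> x < h + g \<and> H (cost_cell n m (x - h)) \<le> p
        then max (H (cell n S (b + int x))) (e + p - H (cost_cell n m (x - h)))
        else H (cell n S (b + int x)))) \<and>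
    (\<forall>i\<le>n. \<forall>x\<le>n. H' (cost_cell n i x) =
       (if live \<and> i = j \<and> h \<le> x \<and> x < h + g \<and> H (cost_cell n m (x - h)) \<le> p
        then min (H (cost_cell n i x)) (H (cost_cell n m (x - h)) + (\<rho> - e))
        else H (cost_cell n i x))) \<and>
    (\<forall>a. (\<forall>x\<le>n. a \<noteq> cell n S (b + int x)) \<longrightarrow> (\<forall>i\<le>n. \<forall>x\<le>n. a \<noteq> cost_cell n i x) \<longrightarrow> H' a = H a)"

lemma cell_same [simp]: "cell n i k = cell n i k' \<longleftrightarrow> k = k'"
  by (simp add: cell_def)

text \<open>As row \<open>j\<close> differs from row \<open>m\<close>, the costs read are never
  overwritten meanwhile; so the state after \<open>g\<close> rounds can be expressed by the initial
  heap \<open>H\<close> alone.\<close>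

lemma gup_step:
  assumes g: "gup n S b m j h e p \<rho> live H g H1" and b: "b = 4 \<or> b = int n + 5"
    and z: "z = h + g" and le: "z \<le> n" "S \<le> n" "m \<le> n" "live \<Longrightarrow> j \<le> n \<and> j \<noteq> m"
    and c: "c = H1 (cost_cell n m g)"
    and H2: "H2 = (if c \<le> p then
        (let Ha = H1(cell n S (b + int z) := max (H1 (cell n S (b + int z))) (e + p - c)) in
         if live then Ha(cost_cell n j z :=
           min (Ha (cost_cell n j z)) (c + (\<rho> - e))) else Ha) else H1)"
  shows "gup n S b m j h e p \<rho> live H (Suc g) H2"
proof -
  have d1: "cost_cell n i y \<noteq> cell n i' (b + int x)" "cell n i' (b + int x) \<noteq> cost_cell n i y"
    if "x \<le> n" "y \<le> n" for i i' x y
    using b that cell_eq[of "2 * int n + 6 + int y" n "b + int x" i i'] by auto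
  have d3: "cost_cell n i y = cost_cell n i' x \<longleftrightarrow> i = i' \<and> y = x"
    if "x \<le> n" "y \<le> n" for i i' x y
    using that cell_eq[of "2 * int n + 6 + int y" n "2 * int n + 6 + int x" i i'] by auto
  have G1: "H1 (cell n S (b + int x)) =
       (if h \<le> x \<and> x < h + g \<and> H (cost_cell n m (x - h)) \<le> p
        then max (H (cell n S (b + int x))) (e + p - H (cost_cell n m (x - h)))
        else H (cell n S (b + int x)))" if "x \<le> n" for x
    using g that unfolding gup_def by blast
  have G2: "H1 (cost_cell n i x) =
       (if live \<and> i = j \<and> h \<le> x \<and> x < h + g \<and> H (cost_cell n m (x - h)) \<le> p
        then min (H (cost_cell n i x)) (H (cost_cell n m (x - h)) + (\<rho> - e))
        else H (cost_cell n i x))" if "x \<le> n" "i \<le> n" for x i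
    using g that unfolding gup_def by blast
  have G3: "H1 a = H a" if "\<forall>x\<le>n. a \<noteq> cell n S (b + int x)" "\<forall>i\<le>n. \<forall>x\<le>n. a \<noteq> cost_cell n i x" for a
    using g that unfolding gup_def by blast
  have cH: "c = H (cost_cell n m g)" using G2[of g m] le c z by auto
  have x_eq: "h \<le> x \<and> x < h + Suc g \<longleftrightarrow> (h \<le> x \<and> x < h + g) \<or> x = z" for x using z by auto
  show ?thesis unfolding gup_def
  proof (intro conjI allI impI)
    fix x assume x: "x \<le> n"
    have hd: "H2 (cell n S (b + int x)) = (if c \<le> p \<and> x = z then max (H1 (cell n S (b + int x))) (e + p - c) else H1 (cell n S (b + int x)))"
      unfolding H2 Let_def using d1 x le by simp
    show "H2 (cell n S (b + int x)) =
       (if h \<le> x \<and> x < h + Suc g \<and> H (cost_cell n m (x - h)) \<le> p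
        then max (H (cell n S (b + int x))) (e + p - H (cost_cell n m (x - h)))
        else H (cell n S (b + int x)))"
      unfolding hd G1[OF x] using cH x_eq[of x] z by auto
  next
    fix i x assume i: "i \<le> n" and x: "x \<le> n"
    have hd: "H2 (cost_cell n i x) = (if c \<le> p \<and> live \<and> i = j \<and> x = z then
        min (H1 (cost_cell n i x)) (c + (\<rho> - e)) else H1 (cost_cell n i x))"
      unfolding H2 Let_def using d1 d3 x le by auto
    show "H2 (cost_cell n i x) =
       (if live \<and> i = j \<and> h \<le> x \<and> x < h + Suc g \<and> H (cost_cell n m (x - h)) \<le> p
        then min (H (cost_cell n i x)) (H (cost_cell n m (x - h)) + (\<rho> - e))
        else H (cost_cell n i x))"
      unfolding hd G2[OF x i] using cH x_eq[of x] z by auto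
  next
    fix a assume a: "\<forall>x\<le>n. a \<noteq> cell n S (b + int x)" "\<forall>i\<le>n. \<forall>x\<le>n. a \<noteq> cost_cell n i x"
    have "a \<noteq> cell n S (b + int z)" "live \<Longrightarrow> a \<noteq> cost_cell n j z" using a le by blast+
    hence "H2 a = H1 a" unfolding H2 Let_def by simp
    thus "H2 a = H a" using G3[OF a] by simp
  qed
qed

lemma gloop_spec:
  assumes c: "cst n T v" and b: "b = 4 \<or> b = int n + 5"
    and le: "h \<le> n" "S \<le> n" "m \<le> n" "v rRJ < T \<Longrightarrow> j \<le> n \<and> j \<noteq> m \<and> v rJ = cell n j 0"
    and r: "v rM = cell n m 0" "v rNS = cell n S (b + int h)" "v rHH = 2 * int n + 6 + int h"
      "v rCE = cost_cell n m (n - h)"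
  shows "wp gloop (\<lambda>v' H' t'. gup n S b m j h (v rE) (v rP) (v rRJ) (v rRJ < T) H (Suc n - h) H' \<and>
      t' \<le> t + 40 * Suc n \<and> keeps {45..52} v v') v H t"
proof -
  define live where "live \<longleftrightarrow> v rRJ < T"
  define GU where "GU = gup n S b m j h (v rE) (v rP) (v rRJ) live H"
  define I where "I g v' H' t' \<longleftrightarrow> GU g H' \<and> t' \<le> t + 5 + 25 * g \<and>
      v' rPC = cost_cell n m g \<and> v' rPN = cell n S (b + int (h + g)) \<and>
      (live \<longrightarrow> v' rPJ = cost_cell n j (h + g)) \<and> v' rDiff = v rRJ - v rE \<and> v' rEp = v rE + v rP \<and>
      keeps {45..52} v v'" for g :: nat and v' :: regs and H' :: heap and t' :: nat
  let ?Q = "\<lambda>v' H' t'. GU (Suc n - h) H' \<and>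
      t' \<le> t + 40 * Suc n \<and> keeps {45..52} v v'"
  have loop: "wp (WHILELE rPC rCE gloop_body) ?Q v' H' t'" if "I 0 v' H' t'" for v' H' t'
  proof (rule wp_for[where I = I and N = "Suc n - h", OF that])
    fix g v1 H1 t1 assume g: "g < Suc n - h" and I: "I g v1 H1 t1"
    have G: "GU g H1" and t1: "t1 \<le> t + 5 + 25 * g" and
      p: "v1 rPC = cost_cell n m g" "v1 rPN = cell n S (b + int (h + g))"
        "live \<Longrightarrow> v1 rPJ = cost_cell n j (h + g)" "v1 rDiff = v rRJ - v rE" "v1 rEp = v rE + v rP"
      and fr: "\<And>x. x \<notin> {45..52} \<Longrightarrow> v1 x = v x" using I by (auto simp: I_def)
    have q: "v1 rOne = 1" "v1 rCE = cost_cell n m (n - h)" "v1 rP = v rP" "v1 rRJ = v rRJ" "v1 rT1 = T - 1"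
      using fr[of rOne] fr[of rCE] fr[of rP] fr[of rRJ] fr[of rT1] c r by (auto simp: cst_def)
    have nn: "0 \<le> cost_cell n m g" "0 \<le> cell n S (b + int (h + g))" "0 \<le> cost_cell n j (h + g)"
      using b by (auto intro!: cell_nonneg)
    let ?c = "H1 (cost_cell n m g)"
    let ?a1 = "cell n S (b + int (h + g))" and ?a2 = "cost_cell n j (h + g)"
    have st: "GU (Suc g) H2"
      if "H2 = (if ?c \<le> v rP then
        (let Ha = H1(?a1 := max (H1 ?a1) (v rE + v rP - ?c)) in
         if live then Ha(?a2 := min (Ha ?a2) (?c + (v rRJ - v rE))) else Ha) else H1)" for H2
      unfolding GU_def using gup_step[OF G[unfolded GU_def] b refl _ le(2,3) _ refl that] g le(4) by (auto simp: live_def)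
    have lv: "v rRJ \<le> T - 1 \<longleftrightarrow> live" by (auto simp: live_def)
    show "v1 rPC \<le> v1 rCE \<and> wp gloop_body (I (Suc g)) v1 H1 (t1 + 2)"
    proof
      show "v1 rPC \<le> v1 rCE" using p q g by simp
      show "wp gloop_body (I (Suc g)) v1 H1 (t1 + 2)"
        unfolding gloop_body_def
        apply (intro wp_simps)
        using p q nn t1 fr lv
        by (auto simp: I_def Let_def max_def min_def intro!: st fun_upd_idem[symmetric])
    qed
  next
    fix v1 H1 t1 assume I: "I (Suc n - h) v1 H1 t1"
    hence "v1 rCE = cost_cell n m (n - h)" "v1 rPC = cost_cell n m (Suc n - h)"
      using r by (auto simp: I_def)
    hence "\<not> v1 rPC \<le> v1 rCE" using le(1) by simp
    thus "\<not> v1 rPC \<le> v1 rCE \<and> ?Q v1 H1 (t1 + 2)" using I by (auto simp: I_def)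
  qed
  have "GU 0 H" by (auto simp: GU_def gup_def)
  thus ?thesis unfolding gloop_def live_def[symmetric] GU_def[symmetric]
    apply (intro wp_simps)
    apply (rule loop)
    using c r le by (auto simp: I_def cst_def live_def)
qed


lemma nxt_unique: "nxt f m T e \<rho> j \<Longrightarrow> nxt f m T e \<rho>' j' \<Longrightarrow> \<rho> = \<rho>' \<and> (\<rho> < T \<longrightarrow> j = j')"
  unfolding nxt_def by (smt (verit) linorder_neqE_nat)

text \<open>The relaxation of one group of chain steps, for a row \<open>S\<close> and a job with work \<open>p\<close> released at
  \<open>\<rho>\<close>. Columns \<open>a\<close> hold the old reach table \<open>R\<close>, columns \<open>b\<close> of row \<open>S\<close> the candidates, and the
  last block the cheapest chain costs.\<close>
locale dp =
  fixes n :: nat and T :: int and R :: "nat \<Rightarrow> nat \<Rightarrow> int" and rr f :: "nat \<Rightarrow> int" and p \<rho> :: int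
    and S :: nat and a b :: int and ch :: "nat \<Rightarrow> nat \<Rightarrow> int \<Rightarrow> bool"
  assumes ab: "offs n a b" and Sn: "S \<le> n"
    and ch0: "ch S 0 0"
    and chs: "\<And>i h \<sigma> j g c. i \<le> n \<Longrightarrow> h \<le> n \<Longrightarrow> \<rho> \<le> R i h \<Longrightarrow> nxt f (Suc n) T (R i h) \<sigma> j \<Longrightarrow> \<sigma> < T \<Longrightarrow>
      ch i g c \<Longrightarrow> ch j (g + h) (c + (\<sigma> - R i h))"
    and up: "\<And>i h \<sigma> j. i \<le> n \<Longrightarrow> h \<le> n \<Longrightarrow> nxt f (Suc n) T (R i h) \<sigma> j \<Longrightarrow> \<sigma> < T \<Longrightarrow> rr i < rr j"
    and fr: "\<And>i. i \<le> n \<Longrightarrow> f i < T \<Longrightarrow> f i = rr i"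
    and rS: "rr S < T"
    and p0: "0 \<le> p"
begin

definition NV :: "heap \<Rightarrow> nat \<Rightarrow> int" where "NV H x = H (cell n S (b + int x))"
definition CV :: "heap \<Rightarrow> nat \<Rightarrow> nat \<Rightarrow> int" where "CV H i x = H (cost_cell n i x)"

text \<open>Frame condition: only the candidates of row \<open>S\<close> and the costs may differ.
  The old reaches that the relaxations read lie elsewhere.\<close>

definition sm :: "heap \<Rightarrow> heap \<Rightarrow> bool" where
  "sm H H' \<longleftrightarrow> (\<forall>k. (\<forall>x\<le>n. k \<noteq> cell n S (b + int x)) \<longrightarrow>
     (\<forall>i\<le>n. \<forall>x\<le>n. k \<noteq> cost_cell n i x) \<longrightarrow> H' k = H k)"

definition hp :: "heap \<Rightarrow> bool" where
  "hp H \<longleftrightarrow> (\<forall>i\<le>n. H (cell n i 0) = rr i \<and> H (cell n i 1) = f i \<and> (\<forall>x\<le>n. H (cell n i (a + int x)) = R i x))"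

text \<open>One half of the shortest path argument: whatever is stored is realised by a chain. Costs
  above \<open>p\<close> represent infinity and are exempt.\<close>

definition sound :: "heap \<Rightarrow> bool" where
  "sound H \<longleftrightarrow> (\<forall>x\<le>n. R S x \<le> NV H x \<and> (NV H x = R S x \<or>
      (\<exists>i\<le>n. \<exists>h\<le>x. \<exists>c. ch i (x - h) c \<and> c \<le> p \<and> \<rho> \<le> R i h \<and> NV H x = R i h + p - c))) \<and>
     (\<forall>i\<le>n. \<forall>x\<le>n. CV H i x \<le> p \<longrightarrow> ch i x (CV H i x)) \<and> CV H S 0 \<le> 0"

text \<open>The other half: the Bellman inequalities for the edges that leave row \<open>i\<close>
  with \<open>h\<close> further idle runs, and the same inequality for the candidate obtained by
  stopping there.\<close>

definition edge :: "heap \<Rightarrow> nat \<Rightarrow> nat \<Rightarrow> bool" where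
  "edge H i h \<longleftrightarrow> (\<rho> \<le> R i h \<longrightarrow> (\<forall>g. g + h \<le> n \<longrightarrow> CV H i g \<le> p \<longrightarrow> R i h + p - CV H i g \<le> NV H (g + h) \<and>
     (\<forall>\<sigma> j. nxt f (Suc n) T (R i h) \<sigma> j \<longrightarrow> \<sigma> < T \<longrightarrow> CV H j (g + h) \<le> CV H i g + (\<sigma> - R i h))))"

lemma b_bounds: "b = 4 \<or> b = int n + 5" "a = 4 \<or> a = int n + 5"
  using ab by (auto simp: offs_def)

lemma sm_trans: "sm H H' \<Longrightarrow> sm H' H'' \<Longrightarrow> sm H H''"
  unfolding sm_def by simp

lemma sm_other:
  assumes "sm H H'" "0 \<le> k" "k < 2 * int n + 6" "i \<noteq> S \<or> k < b \<or> b + int n < k"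
  shows "H' (cell n i k) = H (cell n i k)"
proof -
  have "cell n i k \<noteq> cell n S (b + int x)" if "x \<le> n" for x
    using cell_eq[of k n "b + int x" i S] assms b_bounds that by auto
  moreover have "cell n i k \<noteq> cost_cell n i' x" if "x \<le> n" for i' x
    using cell_eq[of k n "2 * int n + 6 + int x" i i'] assms that by auto
  ultimately show ?thesis using assms(1) unfolding sm_def by blast
qed

lemma sm_hp: "hp H \<Longrightarrow> sm H H' \<Longrightarrow> hp H'"
  unfolding hp_def using sm_other[of H H' 0] sm_other[of H H' 1] sm_other[of H H' "a + int _"] ab
  by (auto simp: offs_def)

lemma gup_sm: "gup n S b m j h e p \<sigma> live H g H' \<Longrightarrow> sm H H'"
  unfolding gup_def sm_def by blast

text \<open>Only costs of row \<open>j\<close>, released after row \<open>m\<close>, can decrease.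
  Costs of rows released up to that time are final, and in their edges the remaining quantities move
  in the favourable direction, so what was relaxed stays relaxed.\<close>

lemma gup_update:
  assumes s: "sound H" and m: "m \<le> n" and h: "h \<le> n" and e: "\<rho> \<le> R m h"
    and nx: "nxt f (Suc n) T (R m h) \<sigma> j" and G: "gup n S b m j h (R m h) p \<sigma> (\<sigma> < T) H (Suc n - h) H'"
  shows "sound H'" "edge H' m h"
    "\<And>i h'. i \<le> n \<Longrightarrow> h' \<le> n \<Longrightarrow> rr i \<le> rr m \<Longrightarrow> edge H i h' \<Longrightarrow> edge H' i h'"
proof -
  let ?e = "R m h"
  have j: "j \<le> n" "rr m < rr j" "f j = \<sigma>" if "\<sigma> < T" using nx that up[OF m h nx that] by (auto simp: nxt_def)
  have N: "NV H' x = (if h \<le> x \<and> CV H m (x - h) \<le> p then max (NV H x) (?e + p - CV H m (x - h)) else NV H x)"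
    if "x \<le> n" for x using G that unfolding gup_def NV_def CV_def by auto
  have C: "CV H' i x = (if \<sigma> < T \<and> i = j \<and> h \<le> x \<and> CV H m (x - h) \<le> p
        then min (CV H i x) (CV H m (x - h) + (\<sigma> - ?e)) else CV H i x)" if "x \<le> n" "i \<le> n" for i x
    using G that unfolding gup_def NV_def CV_def by auto
  have C_le: "CV H' i x \<le> CV H i x" if "x \<le> n" "i \<le> n" for i x using C[OF that] by auto
  have N_ge: "NV H x \<le> NV H' x" if "x \<le> n" for x using N[OF that] by auto
  have C_eq: "CV H' i x = CV H i x" if "x \<le> n" "i \<le> n" "rr i \<le> rr m" for i x using C[OF that(1,2)] j that(3) by auto
  show "sound H'" unfolding sound_def
  proof (intro conjI allI impI)
    fix x assume x: "x \<le> n"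
    show "R S x \<le> NV H' x" using s N_ge[OF x] x unfolding sound_def by force
    show "NV H' x = R S x \<or> (\<exists>i\<le>n. \<exists>h\<le>x. \<exists>c. ch i (x - h) c \<and> c \<le> p \<and> \<rho> \<le> R i h \<and> NV H' x = R i h + p - c)"
    proof (cases "NV H' x = NV H x")
      case True thus ?thesis using s x unfolding sound_def by auto
    next
      case False
      hence hx: "h \<le> x" "CV H m (x - h) \<le> p" "NV H' x = ?e + p - CV H m (x - h)"
        using N[OF x] by (auto split: if_splits simp: max_def)
      have "ch m (x - h) (CV H m (x - h))" using s m hx x unfolding sound_def by auto
      thus ?thesis using m hx e by blast
    qed
  next
    fix i x assume i: "i \<le> n" and x: "x \<le> n" and le: "CV H' i x \<le> p"
    show "ch i x (CV H' i x)"
    proof (cases "CV H' i x = CV H i x")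
      case True thus ?thesis using s i x le unfolding sound_def by auto
    next
      case False
      hence hx: "\<sigma> < T" "i = j" "h \<le> x" "CV H m (x - h) \<le> p" "CV H' i x = CV H m (x - h) + (\<sigma> - ?e)"
        using C[OF x i] by (auto split: if_splits simp: min_def)
      have "ch m (x - h) (CV H m (x - h))" using s m hx x unfolding sound_def by auto
      from chs[OF m h e nx hx(1) this] show ?thesis using hx by simp
    qed
  next
    show "CV H' S 0 \<le> 0" using C_le[of 0 S] Sn s unfolding sound_def by force
  qed
  show "edge H' m h" unfolding edge_def
  proof (intro impI allI conjI)
    fix g assume g: "g + h \<le> n" "CV H' m g \<le> p"
    have c: "CV H' m g = CV H m g" using C_eq[of g m] g m by simp
    show "?e + p - CV H' m g \<le> NV H' (g + h)" using N[of "g + h"] g c by simp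
    fix \<sigma>' j' assume "nxt f (Suc n) T ?e \<sigma>' j'" "\<sigma>' < T"
    hence "\<sigma>' = \<sigma>" "j' = j" "\<sigma> < T" using nxt_unique[OF nx] by auto
    thus "CV H' j' (g + h) \<le> CV H' m g + (\<sigma>' - ?e)" using C[of "g + h" j] g c j by simp
  qed
  fix i h' assume i: "i \<le> n" "h' \<le> n" "rr i \<le> rr m" "edge H i h'"
  show "edge H' i h'" unfolding edge_def
  proof (intro impI allI conjI)
    fix g assume r: "\<rho> \<le> R i h'" and g: "g + h' \<le> n" "CV H' i g \<le> p"
    have c: "CV H' i g = CV H i g" using C_eq[of g i] g i by simp
    show "R i h' + p - CV H' i g \<le> NV H' (g + h')" using i(4) r g c N_ge[of "g + h'"] unfolding edge_def by force
    fix \<sigma>' j' assume nx': "nxt f (Suc n) T (R i h') \<sigma>' j'" "\<sigma>' < T"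
    have "j' \<le> n" using nx' by (auto simp: nxt_def)
    hence "CV H' j' (g + h') \<le> CV H j' (g + h')" using C_le g by simp
    also have "\<dots> \<le> CV H i g + (\<sigma>' - R i h')" using i(4) r g c nx' unfolding edge_def by auto
    finally show "CV H' j' (g + h') \<le> CV H' i g + (\<sigma>' - R i h')" using c by simp
  qed
qed

text \<open>\<open>Z\<close> holds the rows handled before. Each of the n + 1 rounds makes one
  search and one pass over the costs, both linear, hence the square.\<close>

lemma hloop_spec:
  assumes c: "cst n T v" and r: "v rR = a" "v rNew = b" "v rM = cell n m 0" "v rS = cell n S 0" "v rP = p" "v rRel = \<rho>"
    and m: "m \<le> n" and H: "hp H" "sound H" and Z: "\<And>i. i \<in> Z \<Longrightarrow> i \<le> n \<and> rr i \<le> rr m"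
    and ed: "\<And>i h. i \<in> Z \<Longrightarrow> h \<le> n \<Longrightarrow> edge H i h"
  shows "wp hloop (\<lambda>v' H' t'. sm H H' \<and> sound H' \<and> (\<forall>i\<in>insert m Z. \<forall>h\<le>n. edge H' i h) \<and>
      t' \<le> t + 90 * Suc n ^ 2 \<and> keeps ({20..25} \<union> {40..52} \<union> {54}) v v') v H t" (is "wp _ ?Q _ _ _")
proof -
  let ?fr = "{20..25} \<union> {40..52} \<union> {54} :: nat set"
  define I where "I h v' H' t' \<longleftrightarrow> sm H H' \<and> sound H' \<and> (\<forall>i\<in>Z. \<forall>h\<le>n. edge H' i h) \<and> (\<forall>h'<h. edge H' m h') \<and>
      t' \<le> t + 6 + h * (75 * Suc n) \<and> v' rPR = cell n m (a + int h) \<and> v' rL = cell n m (a + int n) \<and>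
      v' rCE = cell n m (2 * int n + 6 + int n - int h) \<and> v' rNS = cell n S (b + int h) \<and> v' rHH = 2 * int n + 6 + int h \<and>
      keeps ?fr v v'" for h :: nat and v' :: regs and H' :: heap and t' :: nat
  have loop: "wp (WHILELE rPR rL hloop_body) ?Q v' H' t'" if "I 0 v' H' t'" for v' H' t'
  proof (rule wp_for[where I = I and N = "Suc n", OF that])
    fix h v1 H1 t1 assume h: "h < Suc n" and I: "I h v1 H1 t1"
    have s1: "sm H H1" "sound H1" "\<And>i h. i \<in> Z \<Longrightarrow> h \<le> n \<Longrightarrow> edge H1 i h" "\<And>h'. h' < h \<Longrightarrow> edge H1 m h'"
      and t1: "t1 \<le> t + 6 + h * (75 * Suc n)" and q: "v1 rPR = cell n m (a + int h)" "v1 rL = cell n m (a + int n)"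
      "v1 rCE = cell n m (2 * int n + 6 + int n - int h)" "v1 rNS = cell n S (b + int h)" "v1 rHH = 2 * int n + 6 + int h"
      and fr1: "\<And>x. x \<notin> ?fr \<Longrightarrow> v1 x = v x" using I by (auto simp: I_def)
    have c1: "cst n T v1" using c fr1 by (auto simp: cst_def)
    have r1: "v1 rM = cell n m 0" "v1 rP = p" "v1 rRel = \<rho>" "v1 rOne = 1" using fr1 r c by (auto simp: cst_def)
    have hp1: "hp H1" using sm_hp[OF H(1) s1(1)] .
    have e: "H1 (cell n m (a + int h)) = R m h" using hp1 m h by (auto simp: hp_def)
    have nn: "0 \<le> cell n m (a + int h)" using b_bounds by (auto intro!: cell_nonneg)
    let ?rest = "ADD rPR rPR rOne ;; SUB rCE rCE rOne ;; ADD rNS rNS rOne ;; ADD rHH rHH rOne"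
    let ?v = "v1(rE := R m h)"
    have rest: "wp ?rest (I (Suc h)) v2 H2 t2" if "sm H H2" "sound H2" "\<And>i h. i \<in> Z \<Longrightarrow> h \<le> n \<Longrightarrow> edge H2 i h"
      "\<And>h'. h' < Suc h \<Longrightarrow> edge H2 m h'" "t2 \<le> t1 + 60 * Suc n + 6" "\<And>x. x \<notin> {20..25} \<union> {45..52} \<Longrightarrow> v2 x = v1 x" for v2 H2 t2
      apply (intro wp_simps)
      using that q fr1 r1 t1 by (auto simp: I_def)
    have main: "wp (IFLE rRel rE (scan rOne ;; gloop) SKIP) (wp ?rest (I (Suc h))) ?v H1 (t1 + 3)"
    proof (rule wp_simps(8))
      assume "?v rRel \<le> ?v rE"
      hence re: "\<rho> \<le> R m h" using r1 by simp
      have cv: "cst n T ?v" using c1 by (simp add: cst_def)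
      have one: "?v rOne = 1" using r1 by simp
      have fH: "\<And>i. i \<le> n \<Longrightarrow> H1 (cell n i 1) = f i" using hp1 by (auto simp: hp_def)
      show "wp (scan rOne ;; gloop) (wp ?rest (I (Suc h))) ?v H1 (t1 + 3 + 2)"
      proof (rule wp_simps(7), rule wp_conseq[OF scan_spec[where v = ?v and H = H1 and f = f and k = 1 and t = "t1 + 3 + 2", OF cv one]])
        fix v2 H2 t2 assume A: "H2 = H1 \<and> t2 \<le> t1 + 3 + 2 + 20 * Suc n \<and>
          (\<exists>j. nxt f (Suc n) T (?v rE) (v2 rRJ) j \<and> (v2 rRJ < T \<longrightarrow> v2 rJ = cell n j 0)) \<and>
          keeps {21..25} ?v v2"
        then obtain j where j: "nxt f (Suc n) T (R m h) (v2 rRJ) j" "v2 rRJ < T \<longrightarrow> v2 rJ = cell n j 0" by auto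
        have fr2: "\<And>x. x \<notin> {21..25} \<Longrightarrow> v2 x = ?v x" using A by blast
        have c2: "cst n T v2" using cv fr2 by (auto simp: cst_def)
        have r2: "v2 rE = R m h" "v2 rP = p" "v2 rM = cell n m 0" "v2 rNS = cell n S (b + int h)" "v2 rHH = 2 * int n + 6 + int h"
          "v2 rCE = cost_cell n m (n - h)" using fr2 r1 q h by (auto simp: of_nat_diff)
        have jn: "v2 rRJ < T \<Longrightarrow> j \<le> n \<and> j \<noteq> m \<and> v2 rJ = cell n j 0"
          using j up[OF m _ j(1)] h by (auto simp: nxt_def)
        have hn: "h \<le> n" using h by simp
        show "wp gloop (wp ?rest (I (Suc h))) v2 H2 t2"
        proof (rule wp_conseq[OF gloop_spec[OF c2 b_bounds(1) hn Sn m jn r2(3,4,5,6), of H2 t2]])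
          fix v3 H3 t3 assume B: "gup n S b m j h (v2 rE) (v2 rP) (v2 rRJ) (v2 rRJ < T) H2 (Suc n - h) H3 \<and>
            t3 \<le> t2 + 40 * Suc n \<and> keeps {45..52} v2 v3"
          hence G: "gup n S b m j h (R m h) p (v2 rRJ) (v2 rRJ < T) H1 (Suc n - h) H3" using r2 A by simp
          note U = gup_update[OF s1(2) m hn re j(1) G]
          have fr3: "v3 x = v1 x" if "x \<notin> {20..25} \<union> {45..52}" for x
            using that B fr2[of x] by auto
          show "wp ?rest (I (Suc h)) v3 H3 t3"
          proof (rule rest)
            show "sm H H3" using sm_trans[OF s1(1) gup_sm[OF G]] .
            show "edge H3 m h'" if "h' < Suc h" for h'
              using U(2) U(3)[OF m _ order_refl s1(4)] that hn by (cases "h' = h") auto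
          qed (use U s1 Z A B fr3 in auto)
        qed auto
      qed (use fH in auto)
    next
      assume "\<not> ?v rRel \<le> ?v rE"
      hence "edge H1 m h" using r1 by (simp add: edge_def)
      thus "wp SKIP (wp ?rest (I (Suc h))) ?v H1 (t1 + 3 + 2)"
        using s1 by (intro wp_simps(1) rest) (auto simp: less_Suc_eq)
    qed
    show "v1 rPR \<le> v1 rL \<and> wp hloop_body (I (Suc h)) v1 H1 (t1 + 2)"
    proof
      show "v1 rPR \<le> v1 rL" using q h by simp
      show "wp hloop_body (I (Suc h)) v1 H1 (t1 + 2)"
        unfolding hloop_body_def
        apply (rule wp_simps(7), rule wp_simps(5))
         using q nn apply simp
        apply (rule wp_simps(7))
        using main q e by (simp add: numeral_eq_Suc)
    qed
  next
    fix v1 H1 t1 assume I: "I (Suc n) v1 H1 t1"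
    hence "\<not> v1 rPR \<le> v1 rL" by (auto simp: I_def)
    moreover have "t1 + 2 \<le> t + 90 * Suc n ^ 2"
    proof -
      have "Suc n * (75 * Suc n) = 75 * Suc n ^ 2" "1 \<le> Suc n ^ 2" by (auto simp: power2_eq_square algebra_simps)
      moreover have "t1 \<le> t + 6 + Suc n * (75 * Suc n)" using I unfolding I_def by blast
      ultimately show ?thesis by linarith
    qed
    ultimately show "\<not> v1 rPR \<le> v1 rL \<and> ?Q v1 H1 (t1 + 2)" using I by (auto simp: I_def less_Suc_eq_le)
  qed
  have "sm H H" by (simp add: sm_def)
  thus ?thesis unfolding hloop_def
    apply (intro wp_simps)
    apply (rule loop)
    using c r H ed by (auto simp: I_def cst_def)
qed


text \<open>The rows whose turn comes before time \<open>\<sigma>\<close>: the start row, and for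
  every later release time of a treated job the first row having it.\<close>

definition vis :: "int \<Rightarrow> nat set" where
  "vis \<sigma> = {i. i \<le> n \<and> ((i = S \<and> rr S < \<sigma>) \<or> (f i < \<sigma> \<and> f i < T \<and> rr S < f i \<and> (\<forall>i'<i. f i' \<noteq> f i)))}"

lemma mloop_spec:
  assumes c: "cst n T v" and r: "v rR = a" "v rNew = b" "v rS = cell n S 0" "v rP = p" "v rRel = \<rho>"
    and H: "hp H" "sound H"
  shows "wp mloop (\<lambda>v' H' t'. sm H H' \<and> sound H' \<and> (\<forall>i\<in>vis T. \<forall>h\<le>n. edge H' i h) \<and>
      t' \<le> t + 130 * Suc n ^ 3 \<and> keeps ({20..25} \<union> {36} \<union> {40..52} \<union> {54}) v v') v H t" (is "wp _ ?Q _ _ _")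
proof -
  let ?fr = "{20..25} \<union> {36} \<union> {40..52} \<union> {54} :: nat set"
  let ?K = "120 * Suc n ^ 2"
  define I where "I v' H' t' \<longleftrightarrow> sm H H' \<and> sound H' \<and> v' rRJ \<le> T \<and> (\<forall>i\<in>vis (v' rRJ). \<forall>h\<le>n. edge H' i h) \<and>
      t' \<le> t + 2 + card (vis (v' rRJ)) * ?K \<and>
      (v' rRJ < T \<longrightarrow> (\<exists>j\<le>n. v' rJ = cell n j 0 \<and> rr j = v' rRJ \<and>
        (j = S \<or> (f j = v' rRJ \<and> rr S < f j \<and> (\<forall>i'<j. f i' \<noteq> f j))))) \<and>
      keeps ?fr v v'" for v' :: regs and H' :: heap and t' :: nat
  have fin: "finite (vis \<sigma>)" "card (vis \<sigma>) \<le> Suc n" for \<sigma>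
  proof -
    have "vis \<sigma> \<subseteq> {..n}" by (auto simp: vis_def)
    thus "finite (vis \<sigma>)" "card (vis \<sigma>) \<le> Suc n" using card_mono[of "{..n}" "vis \<sigma>"] finite_subset by auto
  qed
  have loop: "wp (WHILELE rRJ rT1 mloop_body) ?Q v' H' t'" if "I v' H' t'" for v' H' t'
  proof (rule wp_while[where I = I and f = "\<lambda>v _. nat (T - v rRJ)", OF that])
    fix v1 H1 t1 assume I: "I v1 H1 t1" and le: "v1 rRJ \<le> v1 rT1"
    have s1: "sm H H1" "sound H1" "\<And>i h. i \<in> vis (v1 rRJ) \<Longrightarrow> h \<le> n \<Longrightarrow> edge H1 i h"
      and t1: "t1 \<le> t + 2 + card (vis (v1 rRJ)) * ?K" and fr1: "\<And>x. x \<notin> ?fr \<Longrightarrow> v1 x = v x" using I by (auto simp: I_def)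
    have c1: "cst n T v1" using c fr1 by (auto simp: cst_def)
    hence lt: "v1 rRJ < T" using le by (simp add: cst_def)
    obtain m where m: "m \<le> n" "v1 rJ = cell n m 0" "rr m = v1 rRJ"
      "m = S \<or> (f m = v1 rRJ \<and> rr S < f m \<and> (\<forall>i'<m. f i' \<noteq> f m))" using I lt by (auto simp: I_def)
    define \<sigma> where "\<sigma> = v1 rRJ"
    let ?v = "v1(rM := v1 rJ + v1 rZ)"
    have cv: "cst n T ?v" using c1 by (simp add: cst_def)
    have rv: "?v rR = a" "?v rNew = b" "?v rM = cell n m 0" "?v rS = cell n S 0" "?v rP = p" "?v rRel = \<rho>"
      using fr1 r m c1 by (auto simp: cst_def)
    have hp1: "hp H1" using sm_hp[OF H(1) s1(1)] .
    have Z: "i \<le> n \<and> rr i \<le> rr m" if "i \<in> vis \<sigma>" for i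
      using that fr[of i] m(3) unfolding vis_def \<sigma>_def by auto
    \<comment> \<open>From one release time to the next exactly the row \<open>m\<close> just
      handled joins; other rows with its release time are not the first of their kind or share the
      time of the start. So the size of \<open>vis\<close>, at most n + 1, counts the
      rounds.\<close>
    have vis_step: "vis \<sigma>' = insert m (vis \<sigma>)" "m \<notin> vis \<sigma>" if nx: "nxt f (Suc n) T (\<sigma> + 1) \<sigma>' j" for \<sigma>' j
    proof -
      have s: "\<sigma> < \<sigma>'" using nx lt by (auto simp: nxt_def \<sigma>_def)
      have rm: "rr m = \<sigma>" using m(3) \<sigma>_def by simp
      show "m \<notin> vis \<sigma>" using m(4) rm by (auto simp: vis_def \<sigma>_def)
      show "vis \<sigma>' = insert m (vis \<sigma>)"
      proof (intro set_eqI iffI)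
        fix i assume i: "i \<in> vis \<sigma>'"
        show "i \<in> insert m (vis \<sigma>)"
        proof (cases "i = S \<and> rr S < \<sigma>'")
          case True thus ?thesis using m rm Sn by (auto simp: vis_def \<sigma>_def)
        next
          case False
          hence fi: "i \<le> n" "f i < \<sigma>'" "f i < T" "rr S < f i" "\<forall>i'<i. f i' \<noteq> f i" using i by (auto simp: vis_def)
          have "\<sigma> + 1 \<le> f i \<longrightarrow> \<sigma>' \<le> f i" using nx fi(1) by (simp add: nxt_def)
          hence "\<not> \<sigma> + 1 \<le> f i" using fi(2) by simp
          hence "f i < \<sigma> \<or> f i = \<sigma>" by linarith
          thus ?thesis
          proof
            assume "f i < \<sigma>" thus ?thesis using fi by (simp add: vis_def)
          next
            assume e: "f i = \<sigma>"
            hence "m \<noteq> S" using fi(4) rm by auto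
            hence "f m = f i" "\<forall>i'<m. f i' \<noteq> f m" using m(4) e \<sigma>_def by auto
            hence "m = i" using fi(5) by (metis linorder_neqE_nat)
            thus ?thesis by simp
          qed
        qed
      next
        fix i assume "i \<in> insert m (vis \<sigma>)"
        thus "i \<in> vis \<sigma>'" using m rm s lt by (auto simp: vis_def \<sigma>_def)
      qed
    qed
    have main: "wp hloop (wp (LOAD rE rM ;; ADD rE rE rOne ;; scan rOne)
      (\<lambda>v' H' t'. I v' H' t' \<and> nat (T - v' rRJ) < nat (T - v1 rRJ))) ?v H1 (t1 + 3)"
    proof (rule wp_conseq[OF hloop_spec[OF cv rv m(1) hp1 s1(2) Z[unfolded \<sigma>_def] s1(3), where t = "t1 + 3"]])
      fix v2 H2 t2 assume A: "sm H1 H2 \<and> sound H2 \<and> (\<forall>i\<in>insert m (vis (v1 rRJ)). \<forall>h\<le>n. edge H2 i h) \<and>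
        t2 \<le> t1 + 3 + 90 * Suc n ^ 2 \<and> keeps ({20..25} \<union> {40..52} \<union> {54}) ?v v2"
      have fr2: "v2 x = ?v x" if "x \<notin> {20..25} \<union> {40..52} \<union> {54}" for x using A that by blast
      have sm2: "sm H H2" using A sm_trans[OF s1(1)] by blast
      have hp2: "hp H2" using sm_hp[OF H(1) sm2] .
      have c2: "cst n T v2" using cv fr2 by (auto simp: cst_def)
      have rM: "v2 rM = cell n m 0" using fr2[of rM] rv by simp
      have e2: "H2 (cell n m 0) = \<sigma>" "0 \<le> cell n m 0" using hp2 m by (auto simp: hp_def \<sigma>_def intro: cell_nonneg)
      let ?w = "v2(rE := \<sigma> + 1)"
      have cw: "cst n T ?w" "?w rOne = 1" using c2 by (auto simp: cst_def)
      have sc: "wp (scan rOne) (\<lambda>v' H' t'. I v' H' t' \<and> nat (T - v' rRJ) < nat (T - v1 rRJ)) ?w H2 (t2 + 2)"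
      proof (rule wp_conseq[OF scan_spec[where v = ?w and H = H2 and f = f and k = 1 and t = "t2 + 2", OF cw]])
        fix v3 H3 t3 assume B: "H3 = H2 \<and> t3 \<le> t2 + 2 + 20 * Suc n \<and>
          (\<exists>j. nxt f (Suc n) T (?w rE) (v3 rRJ) j \<and> (v3 rRJ < T \<longrightarrow> v3 rJ = cell n j 0)) \<and>
          keeps {21..25} ?w v3"
        then obtain j where j: "nxt f (Suc n) T (\<sigma> + 1) (v3 rRJ) j" "v3 rRJ < T \<longrightarrow> v3 rJ = cell n j 0" by auto
        have fr3: "v3 x = v x" if "x \<notin> ?fr" for x
        proof -
          have "v3 x = v2 x" using B that by auto
          thus ?thesis using fr2[of x] fr1[OF that] that by auto
        qed
        have lt3: "\<sigma> < v3 rRJ" using j(1) lt by (auto simp: nxt_def \<sigma>_def)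
        have j3: "\<exists>j\<le>n. v3 rJ = cell n j 0 \<and> rr j = v3 rRJ \<and>
          (j = S \<or> (f j = v3 rRJ \<and> rr S < f j \<and> (\<forall>i'<j. f i' \<noteq> f j)))" if l: "v3 rRJ < T"
        proof -
          have q: "j \<le> n" "f j = v3 rRJ" "\<forall>i'<j. f i' \<noteq> v3 rRJ" using j l by (auto simp: nxt_def)
          have "rr S \<le> \<sigma>" using m(3,4) unfolding \<sigma>_def by auto
          hence "rr S < f j" using q(2) lt3 by simp
          moreover have "rr j = v3 rRJ" using fr[OF q(1)] q(2) l by simp
          ultimately show ?thesis using q j(2) l by (intro exI[of _ j]) simp
        qed
        have t3: "t3 \<le> t + 2 + card (vis (v3 rRJ)) * ?K"
        proof -
          have cd: "card (vis (v3 rRJ)) = Suc (card (vis \<sigma>))" using vis_step[OF j(1)] fin by simp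
          have arith: "t3 \<le> t + 2 + X" if "N \<le> q" "1 \<le> q" "t3 \<le> t1 + 5 + 90 * q + 20 * N" "X = Y + 120 * q" "t1 \<le> t + 2 + Y"
            for N q X Y :: nat using that by linarith
          show ?thesis
          proof (rule arith)
            show "Suc n \<le> Suc n ^ 2" "1 \<le> Suc n ^ 2" by (auto simp: power2_eq_square)
            show "t3 \<le> t1 + 5 + 90 * Suc n ^ 2 + 20 * Suc n" using A B by linarith
            show "card (vis (v3 rRJ)) * ?K = card (vis \<sigma>) * ?K + ?K" unfolding cd by simp
            show "t1 \<le> t + 2 + card (vis \<sigma>) * ?K" using t1 by (simp add: \<sigma>_def)
          qed
        qed
        have "I v3 H3 t3" unfolding I_def
          using sm2 A B j3 fr3 t3 j(1) vis_step[OF j(1)] by (auto simp: nxt_def \<sigma>_def)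
        thus "I v3 H3 t3 \<and> nat (T - v3 rRJ) < nat (T - v1 rRJ)" using lt3 lt by (simp add: \<sigma>_def)
      qed (use hp2 in \<open>auto simp: hp_def\<close>)
      show "wp (LOAD rE rM ;; ADD rE rE rOne ;; scan rOne)
        (\<lambda>v' H' t'. I v' H' t' \<and> nat (T - v' rRJ) < nat (T - v1 rRJ)) v2 H2 t2"
        apply (rule wp_simps(7), rule wp_simps(5))
         using rM e2 apply simp
        apply (rule wp_simps(7), rule wp_simps(3))
        using sc rM e2 c2 by (simp add: cst_def)
    qed (use s1 in auto)
    show "wp mloop_body (\<lambda>v' H' t'. I v' H' t' \<and> nat (T - v' rRJ) < nat (T - v1 rRJ)) v1 H1 (t1 + 2)"
      unfolding mloop_body_def
      apply (rule wp_simps(7), rule wp_simps(3), rule wp_simps(7))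
      using main by (simp add: numeral_eq_Suc)
  next
    fix v1 H1 t1 assume I: "I v1 H1 t1" and le: "\<not> v1 rRJ \<le> v1 rT1"
    have "v1 rT1 = T - 1" using I c by (auto simp: I_def cst_def)
    hence e: "v1 rRJ = T" using I le by (auto simp: I_def)
    have "t1 \<le> t + 2 + card (vis T) * ?K" using I e by (auto simp: I_def)
    moreover have "card (vis T) * ?K \<le> Suc n * ?K" using fin by (intro mult_le_mono1) auto
    moreover have "Suc n * ?K = 120 * Suc n ^ 3" "1 \<le> Suc n ^ 3" by (auto simp: power2_eq_square power3_eq_cube algebra_simps)
    ultimately have "t1 + 2 \<le> t + 130 * Suc n ^ 3" by linarith
    thus "?Q v1 H1 (t1 + 2)" using I e by (auto simp: I_def)
  qed
  have v0: "vis (rr S) = {}" by (auto simp: vis_def)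
  have "sm H H" by (simp add: sm_def)
  moreover have "H (cell n S 0) = rr S" "0 \<le> cell n S 0" using H Sn by (auto simp: hp_def intro: cell_nonneg)
  ultimately show ?thesis unfolding mloop_def
    apply (intro wp_simps)
     using r apply simp
    apply (rule loop)
    using c r H v0 rS Sn by (auto simp: I_def cst_def)
qed


lemma sm_updN: "sm H H1 \<Longrightarrow> x \<le> n \<Longrightarrow> sm H (H1(cell n S (b + int x) := y))"
  unfolding sm_def by auto

lemma NV_updN [simp]: "NV (H(cell n S (b + int x) := y)) x' = (if x' = x then y else NV H x')"
  by (auto simp: NV_def)

section \<open>Initialising and capping one row\<close>

lemma copyrow_spec:
  assumes c: "cst n T v" and r: "v rR = a" "v rNew = b" "v rS = cell n S 0" and H: "hp H"
  shows "wp copyrow (\<lambda>v' H' t'. sm H H' \<and> (\<forall>x\<le>n. NV H' x = R S x) \<and>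
      t' \<le> t + 12 * Suc n \<and> keeps {24, 40, 41, 46} v v') v H t" (is "wp _ ?Q _ _ _")
proof -
  define I where "I h v' H' t' \<longleftrightarrow> sm H H' \<and> (\<forall>x<h. NV H' x = R S x) \<and> t' \<le> t + 3 + 6 * h \<and>
      v' rPR = cell n S (a + int h) \<and> v' rPE = cell n S (a + int n) \<and> v' rPN = cell n S (b + int h) \<and>
      keeps {24, 40, 41, 46} v v'" for h :: nat and v' :: regs and H' :: heap and t' :: nat
  let ?body = "LOAD rA rPR ;; STORE rPN rA ;; ADD rPR rPR rOne ;; ADD rPN rPN rOne"
  have loop: "wp (WHILELE rPR rPE ?body) ?Q v' H' t'" if "I 0 v' H' t'" for v' H' t'
  proof (rule wp_for[where I = I and N = "Suc n", OF that])
    fix h v1 H1 t1 assume h: "h < Suc n" and I: "I h v1 H1 t1"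
    have s1: "sm H H1" using I by (simp add: I_def)
    have e: "H1 (cell n S (a + int h)) = R S h" using sm_hp[OF H s1] Sn h by (auto simp: hp_def)
    have nn: "0 \<le> cell n S (a + int h)" "0 \<le> cell n S (b + int h)" using b_bounds by (auto intro!: cell_nonneg)
    have s2: "sm H (H1(cell n S (b + int h) := R S h))" using sm_updN[OF s1] h by simp
    have o: "v1 rOne = 1" using I c by (auto simp: I_def cst_def)
    show "v1 rPR \<le> v1 rPE \<and> wp ?body (I (Suc h)) v1 H1 (t1 + 2)"
    proof
      show "v1 rPR \<le> v1 rPE" using I h by (simp add: I_def)
      show "wp ?body (I (Suc h)) v1 H1 (t1 + 2)"
        apply (intro wp_simps)
        using I e nn s2 o by (auto simp: I_def less_Suc_eq)
    qed
  next
    fix v1 H1 t1 assume I: "I (Suc n) v1 H1 t1"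
    thus "\<not> v1 rPR \<le> v1 rPE \<and> ?Q v1 H1 (t1 + 2)" by (auto simp: I_def less_Suc_eq_le)
  qed
  have "sm H H" by (simp add: sm_def)
  thus ?thesis unfolding copyrow_def
    apply (intro wp_simps)
    apply (rule loop)
    using c r by (auto simp: I_def cst_def)
qed

lemma clearcol_spec:
  assumes c: "cst n T v" and r: "v rX = cell n i 0"
  shows "wp clearcol (\<lambda>v' H' t'. (\<forall>x\<le>n. CV H' i x = v rVal) \<and>
      (\<forall>k. (\<forall>x\<le>n. k \<noteq> cost_cell n i x) \<longrightarrow> H' k = H k) \<and>
      t' \<le> t + 10 * Suc n \<and> keeps {41, 45} v v') v H t" (is "wp _ ?Q _ _ _")
proof -
  define I where "I h v' H' t' \<longleftrightarrow> (\<forall>x<h. CV H' i x = v rVal) \<and>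
      (\<forall>k. (\<forall>x\<le>n. k \<noteq> cost_cell n i x) \<longrightarrow> H' k = H k) \<and> t' \<le> t + 2 + 4 * h \<and>
      v' rPC = cost_cell n i h \<and> v' rPE = cost_cell n i n \<and>
      keeps {41, 45} v v'" for h :: nat and v' :: regs and H' :: heap and t' :: nat
  let ?body = "STORE rPC rVal ;; ADD rPC rPC rOne"
  have loop: "wp (WHILELE rPC rPE ?body) ?Q v' H' t'" if "I 0 v' H' t'" for v' H' t'
  proof (rule wp_for[where I = I and N = "Suc n", OF that])
    fix h v1 H1 t1 assume h: "h < Suc n" and I: "I h v1 H1 t1"
    have nn: "0 \<le> cost_cell n i h" by (auto intro!: cell_nonneg)
    have fm: "(H1(cost_cell n i h := y)) k = H k" if "\<forall>x\<le>n. k \<noteq> cost_cell n i x" for k y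
    proof -
      have "h \<le> n" using h by simp
      hence "k \<noteq> cost_cell n i h" using that by blast
      thus ?thesis using I that by (simp add: I_def)
    qed
    have o: "v1 rOne = 1" "v1 rVal = v rVal" using I c by (auto simp: I_def cst_def)
    show "v1 rPC \<le> v1 rPE \<and> wp ?body (I (Suc h)) v1 H1 (t1 + 2)"
    proof
      show "v1 rPC \<le> v1 rPE" using I h by (simp add: I_def)
      show "wp ?body (I (Suc h)) v1 H1 (t1 + 2)"
        apply (intro wp_simps)
        using I nn o fm by (auto simp: I_def less_Suc_eq CV_def simp del: fun_upd_apply) (auto simp: fun_upd_apply)
    qed
  next
    fix v1 H1 t1 assume I: "I (Suc n) v1 H1 t1"
    thus "\<not> v1 rPC \<le> v1 rPE \<and> ?Q v1 H1 (t1 + 2)" by (auto simp: I_def less_Suc_eq_le)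
  qed
  show ?thesis unfolding clearcol_def
    apply (intro wp_simps)
    apply (rule loop)
    using c r by (auto simp: I_def cst_def)
qed

lemma clearC_spec:
  assumes c: "cst n T v" and r: "v rS = cell n S 0" "v rP = p"
  shows "wp clearC (\<lambda>v' H' t'. sm H H' \<and> (\<forall>x\<le>n. NV H' x = NV H x) \<and>
      (\<forall>i\<le>n. \<forall>x\<le>n. CV H' i x = (if i = S \<and> x = 0 then 0 else p + 1)) \<and>
      t' \<le> t + 20 * Suc n ^ 2 \<and> keeps {23, 41, 45, 51} v v') v H t" (is "wp _ ?Q _ _ _")
proof -
  let ?F = "{23, 41, 45, 51} :: nat set"
  have d1: "cell n S (b + int x) \<noteq> cost_cell n i y" if "x \<le> n" "y \<le> n" for i x y
    using b_bounds that cell_eq[of "b + int x" n "2 * int n + 6 + int y" S i] by auto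
  have d3: "cost_cell n i y = cost_cell n i' x \<longleftrightarrow> i = i' \<and> y = x"
    if "x \<le> n" "y \<le> n" for i i' x y
    using that cell_eq[of "2 * int n + 6 + int y" n "2 * int n + 6 + int x" i i'] by auto
  define I where "I i v' H' t' \<longleftrightarrow> sm H H' \<and> (\<forall>x\<le>n. NV H' x = NV H x) \<and> (\<forall>i'<i. \<forall>x\<le>n. CV H' i' x = p + 1) \<and>
      t' \<le> t + 2 + i * (13 * Suc n) \<and> v' rX = cell n i 0 \<and> v' rVal = p + 1 \<and>
      keeps ?F v v'" for i :: nat and v' :: regs and H' :: heap and t' :: nat
  let ?fin = "ADD rPC rS rC ;; STORE rPC rZ"
  have loop: "wp (WHILELE rX rXN (clearcol ;; ADD rX rX rW)) (wp ?fin ?Q) v' H' t'" if "I 0 v' H' t'" for v' H' t'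
  proof (rule wp_for[where I = I and N = "Suc n", OF that])
    fix i v1 H1 t1 assume i: "i < Suc n" and I: "I i v1 H1 t1"
    have c1: "cst n T v1" using c I by (auto simp: I_def cst_def)
    have X: "v1 rX = cell n i 0" "v1 rVal = p + 1" using I by (auto simp: I_def)
    show "v1 rX \<le> v1 rXN \<and> wp (clearcol ;; ADD rX rX rW) (I (Suc i)) v1 H1 (t1 + 2)"
    proof
      show "v1 rX \<le> v1 rXN" using X c1 i by (simp add: cst_def)
      show "wp (clearcol ;; ADD rX rX rW) (I (Suc i)) v1 H1 (t1 + 2)"
      proof (rule wp_simps(7), rule wp_conseq[OF clearcol_spec[OF c1 X(1), of H1 "t1 + 2"]], rule wp_simps(3))
        fix v2 H2 t2 assume A: "(\<forall>x\<le>n. CV H2 i x = v1 rVal) \<and>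
          (\<forall>k. (\<forall>x\<le>n. k \<noteq> cost_cell n i x) \<longrightarrow> H2 k = H1 k) \<and>
          t2 \<le> t1 + 2 + 10 * Suc n \<and> keeps {41, 45} v1 v2"
        have N2: "NV H2 x = NV H x" if "x \<le> n" for x
        proof -
          have "NV H2 x = NV H1 x" using A d1 that unfolding NV_def by blast
          thus ?thesis using I that by (simp add: I_def)
        qed
        have C2: "CV H2 i' x = p + 1" if "i' < Suc i" "x \<le> n" for i' x
        proof (cases "i' = i")
          case True thus ?thesis using A X that by simp
        next
          case False
          have "CV H2 i' x = CV H1 i' x" using A d3 that False unfolding CV_def by blast
          thus ?thesis using I that False by (simp add: I_def)
        qed
        have "sm H1 H2" unfolding sm_def using A i by auto
        hence S2: "sm H H2" using I sm_trans by (auto simp: I_def)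
        have "t2 + 1 \<le> t + 2 + Suc i * (13 * Suc n)" using A I by (simp add: I_def)
        thus "I (Suc i) (v2(rX := v2 rX + v2 rW)) H2 (t2 + 1)"
          unfolding I_def using S2 N2 C2 A X I c1 by (auto simp: I_def cst_def cell_next)
      qed
    qed
  next
    fix v1 H1 t1 assume I: "I (Suc n) v1 H1 t1"
    have c1: "cst n T v1" using c I by (auto simp: I_def cst_def)
    have X: "v1 rX = cell n (Suc n) 0" "v1 rS = cell n S 0" using I r by (auto simp: I_def)
    have "\<not> v1 rX \<le> v1 rXN" using X c1 by (simp add: cst_def)
    moreover have "wp ?fin ?Q v1 H1 (t1 + 2)"
    proof -
      let ?a = "cost_cell n S 0"
      have nn: "0 \<le> ?a" by (auto intro!: cell_nonneg)
      have S2: "sm H (H1(?a := 0))" unfolding sm_def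
      proof (intro allI impI)
        fix k assume k: "\<forall>x\<le>n. k \<noteq> cell n S (b + int x)" "\<forall>i\<le>n. \<forall>x\<le>n. k \<noteq> cost_cell n i x"
        hence "k \<noteq> ?a" using Sn by blast
        moreover have "H1 k = H k" using I k unfolding I_def sm_def by blast
        ultimately show "(H1(?a := 0)) k = H k" by simp
      qed
      have N2: "NV (H1(?a := 0)) x = NV H x" if "x \<le> n" for x using I d1[OF that, of 0 S] that by (auto simp: I_def NV_def)
      have C2: "CV (H1(?a := 0)) i x = (if i = S \<and> x = 0 then 0 else p + 1)" if "i \<le> n" "x \<le> n" for i x
        using I that d3[of 0 x i S] by (auto simp: I_def CV_def)
      have "t1 + 2 + 2 \<le> t + 20 * Suc n ^ 2"
      proof -
        have "Suc n * (13 * Suc n) = 13 * Suc n ^ 2" "1 \<le> Suc n ^ 2" by (auto simp: power2_eq_square algebra_simps)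
        moreover have "t1 \<le> t + 2 + Suc n * (13 * Suc n)" using I unfolding I_def by blast
        ultimately show ?thesis by linarith
      qed
      thus ?thesis
        apply (intro wp_simps)
        using X c1 nn S2 N2 C2 I by (auto simp: cst_def I_def)
    qed
    ultimately show "\<not> v1 rX \<le> v1 rXN \<and> wp ?fin ?Q v1 H1 (t1 + 2)" by simp
  qed
  have "sm H H" by (simp add: sm_def)
  thus ?thesis unfolding clearC_def
    apply (intro wp_simps)
    apply (rule loop)
    using c r by (auto simp: I_def cst_def)
qed

text \<open>The recursion for \<open>G\<close> is that of \<open>mreach_snoc\<close>: a column
  depends on its own candidate and on the finished column before it, so one pass with one flag
  suffices.\<close>

lemma capl_spec:
  assumes c: "cst n T v" and r: "v rNew = b" "v rS = cell n S 0" "v rRel = \<rho>" "v rD = d" and H: "hp H"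
    and G: "\<And>x. x \<le> n \<Longrightarrow> G x = (if 0 < x \<and> \<rho> < G (x - 1) \<and> (\<forall>i\<le>n. f i < T \<longrightarrow> f i < G (x - 1)) then T else min d (NV H x))"
  shows "wp capl (\<lambda>v' H' t'. sm H H' \<and> (\<forall>x\<le>n. NV H' x = G x) \<and>
      t' \<le> t + 50 * Suc n ^ 2 \<and> keeps ({20..25} \<union> {41, 46, 53}) v v') v H t" (is "wp _ ?Q _ _ _")
proof -
  let ?F = "{20..25} \<union> {41, 46, 53} :: nat set"
  define dn where "dn x \<longleftrightarrow> \<rho> < G x \<and> (\<forall>i\<le>n. f i < T \<longrightarrow> f i < G x)" for x
  define I where "I h v' H' t' \<longleftrightarrow> sm H H' \<and> (\<forall>x\<le>n. NV H' x = (if x < h then G x else NV H x)) \<and>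
      t' \<le> t + 3 + h * (40 * Suc n) \<and> v' rPN = cell n S (b + int h) \<and> v' rPE = cell n S (b + int n) \<and>
      v' rPd = (if 0 < h \<and> dn (h - 1) then 1 else 0) \<and>
      keeps ?F v v'" for h :: nat and v' :: regs and H' :: heap and t' :: nat
  have loop: "wp (WHILELE rPN rPE capl_body) ?Q v' H' t'" if "I 0 v' H' t'" for v' H' t'
  proof (rule wp_for[where I = I and N = "Suc n", OF that])
    fix h v1 H1 t1 assume h: "h < Suc n" and I: "I h v1 H1 t1"
    have s1: "sm H H1" and fr1: "\<And>x. x \<notin> ?F \<Longrightarrow> v1 x = v x" and pn: "v1 rPN = cell n S (b + int h)" "v1 rPE = cell n S (b + int n)"
      and pd: "v1 rPd = (if 0 < h \<and> dn (h - 1) then 1 else 0)" using I by (auto simp: I_def)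
    have c1: "cst n T v1" using c fr1 by (auto simp: cst_def)
    have nn: "0 \<le> cell n S (b + int h)" using b_bounds by (auto intro!: cell_nonneg)
    have NH: "H1 (cell n S (b + int h)) = NV H h" using I h by (auto simp: I_def NV_def)
    define H2 where "H2 = H1(cell n S (b + int h) := G h)"
    have s2: "sm H H2" unfolding H2_def using sm_updN[OF s1] h by simp
    have hp2: "hp H2" using sm_hp[OF H s2] .
    have N2: "NV H2 x = (if x < Suc h then G x else NV H x)" if "x \<le> n" for x
      using I that unfolding H2_def by (auto simp: I_def)
    have Gh: "G h = (if 0 < h \<and> dn (h - 1) then T else min d (NV H h))" using G[of h] h by (simp add: dn_def)
    let ?rest = "SETC rPd 0 ;; IFLE rT rRJ (IFLE rE rRel SKIP (SETC rPd 1)) SKIP ;; ADD rPN rPN rOne"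
    have sc: "wp (scan rOne) (wp ?rest (I (Suc h))) v2 H2 t2"
      if fr2: "\<And>x. x \<noteq> rE \<Longrightarrow> v2 x = v1 x" and e2: "v2 rE = G h" and t2: "t2 \<le> t1 + 9" for v2 t2
    proof -
      have c2: "cst n T v2" "v2 rOne = 1" using c1 fr2 by (auto simp: cst_def)
      show ?thesis
      proof (rule wp_conseq[OF scan_spec[where v = v2 and H = H2 and f = f and k = 1 and t = t2, OF c2]])
        fix v3 H3 t3 assume B: "H3 = H2 \<and> t3 \<le> t2 + 20 * Suc n \<and>
          (\<exists>j. nxt f (Suc n) T (v2 rE) (v3 rRJ) j \<and> (v3 rRJ < T \<longrightarrow> v3 rJ = cell n j 0)) \<and>
          keeps {21..25} v2 v3"
        then obtain j where j: "nxt f (Suc n) T (G h) (v3 rRJ) j" using e2 by auto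
        have fr3: "v3 x = v1 x" if "x \<notin> {20..25}" for x using B fr2 that by auto
        have e3: "v3 rE = G h" "v3 rT = T" "v3 rRel = \<rho>" "v3 rOne = 1" "v3 rPN = cell n S (b + int h)"
          using B e2 fr3 c1 r fr1 pn by (auto simp: cst_def)
        have D: "dn h \<longleftrightarrow> \<rho> < G h \<and> T \<le> v3 rRJ"
        proof -
          have "(\<forall>i\<le>n. f i < T \<longrightarrow> f i < G h) \<longleftrightarrow> T \<le> v3 rRJ"
          proof
            assume a: "\<forall>i\<le>n. f i < T \<longrightarrow> f i < G h"
            show "T \<le> v3 rRJ"
            proof (rule ccontr)
              assume "\<not> T \<le> v3 rRJ"
              hence "j \<le> n" "f j < T" "G h \<le> f j" using j by (auto simp: nxt_def)
              thus False using a by auto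
            qed
          next
            assume a: "T \<le> v3 rRJ"
            show "\<forall>i\<le>n. f i < T \<longrightarrow> f i < G h"
            proof (intro allI impI, rule ccontr)
              fix i assume i: "i \<le> n" "f i < T" "\<not> f i < G h"
              hence "v3 rRJ \<le> f i" using j by (auto simp: nxt_def)
              thus False using a i by simp
            qed
          qed
          thus ?thesis by (simp add: dn_def)
        qed
        have tt: "t3 + 8 \<le> t + 3 + Suc h * (40 * Suc n)" using B t2 I by (simp add: I_def)
        have J: "I (Suc h) w H3 t'" if "w rPN = cell n S (b + int (Suc h))" "\<And>x. x \<notin> {20..25} \<union> {46, 53} \<Longrightarrow> w x = v1 x"
          "w rPd = (if dn h then 1 else 0)" "t' \<le> t3 + 8" for w t'
          unfolding I_def using that s2 N2 B tt fr1 pn by auto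
        show "wp ?rest (I (Suc h)) v3 H3 t3"
          apply (intro wp_simps; rule J)
          using e3 fr3 D by auto
      qed (use hp2 in \<open>auto simp: hp_def\<close>)
    qed
    show "v1 rPN \<le> v1 rPE \<and> wp capl_body (I (Suc h)) v1 H1 (t1 + 2)"
    proof
      show "v1 rPN \<le> v1 rPE" using pn h by simp
      have D: "v1 rD = d" "v1 rT = T" "v1 rOne = 1" "v1 rZ = 0" using fr1 r c by (auto simp: cst_def)
      let ?r2 = "wp (scan rOne) (wp ?rest (I (Suc h)))"
      have fin: "wp (STORE rPN rE) ?r2 w H1 t'" if "\<And>x. x \<noteq> rE \<Longrightarrow> w x = v1 x" "w rE = G h" "t' \<le> t1 + 8" for w t'
      proof (rule wp_simps(6))
        show "0 \<le> w rPN" using that(1)[of rPN] pn nn by simp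
        have "H1(w rPN := w rE) = H2" using that(1)[of rPN] that(2) pn H2_def by simp
        thus "?r2 w (H1(w rPN := w rE)) (t' + 1)" using sc[of w "t' + 1"] that by simp
      qed
      have fin': "wp (STORE rPN rE ;; scan rOne ;; ?rest) (I (Suc h)) w H1 t'"
        if "\<And>x. x \<noteq> rE \<Longrightarrow> w x = v1 x" "w rE = G h" "t' \<le> t1 + 8" for w t'
        using fin[OF that] by (intro wp_simps(7)) (auto elim!: wp_conseq intro: wp_simps(7))
      show "wp capl_body (I (Suc h)) v1 H1 (t1 + 2)" unfolding capl_body_def
        apply (rule wp_simps(7), rule wp_simps(5))
         using pn nn apply simp
        apply (rule wp_simps(7))
        apply (intro wp_simps(1,3,8); rule fin')
        using pn NH D pd Gh by (auto split: if_splits)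
    qed
  next
    fix v1 H1 t1 assume I: "I (Suc n) v1 H1 t1"
    have "Suc n * (40 * Suc n) = 40 * Suc n ^ 2" "1 \<le> Suc n ^ 2" by (auto simp: power2_eq_square algebra_simps)
    moreover have "t1 \<le> t + 3 + Suc n * (40 * Suc n)" using I unfolding I_def by blast
    ultimately have "t1 + 2 \<le> t + 50 * Suc n ^ 2" by linarith
    thus "\<not> v1 rPN \<le> v1 rPE \<and> ?Q v1 H1 (t1 + 2)" using I by (auto simp: I_def)
  qed
  have "sm H H" by (simp add: sm_def)
  thus ?thesis unfolding capl_def
    apply (intro wp_simps)
    apply (rule loop)
    using c r by (auto simp: I_def cst_def)
qed

end

section \<open>Correctness and running time\<close>

lemma mult_power_next: "N * (c * N ^ k) = c * N ^ Suc k" for N c :: nat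
  by simp

locale inst =
  fixes J :: "job list"
  assumes va: "valid_instance J" and fi: "feasible_instance J" and ne: "J \<noteq> []"
begin

abbreviation "n \<equiv> length J"
text \<open>Both bounds are strict: \<open>T\<close> differs from every release and deadline and can
  mean infinity, and an idle slot precedes all releases after \<open>r0\<close>.\<close>

definition "T = Max (dl ` set J) + 1"
definition "r0 = Min (rel ` set J) - 1"
definition "rr i = (if i = 0 then r0 else rel (J ! (i - 1)))"

definition "jss ks = map ((!) J) ks"

text \<open>\<open>ks\<close> is an initial part of an ordering of the jobs by deadline. Ties may be
  broken in any way, so the search is free in its choice.\<close>

definition "lvl ks \<longleftrightarrow> distinct ks \<and> set ks \<subseteq> {..<n} \<and> sorted (map dl (jss ks)) \<and>
  (\<forall>k\<in>set ks. \<forall>j<n. j \<notin> set ks \<longrightarrow> dl (J ! k) \<le> dl (J ! j))"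

definition "fa ks i = (if 0 < i \<and> i - 1 \<in> set ks then rr i else T)"
definition "fd ks i = (if 0 < i \<and> i - 1 \<notin> set ks then dl (J ! (i - 1)) else T)"

definition "hinv ks a H \<longleftrightarrow> (\<forall>i\<le>n. H (cell n i 0) = rr i \<and> H (cell n i 1) = fa ks i \<and> H (cell n i 2) = fd ks i \<and>
  (0 < i \<longrightarrow> H (cell n i 3) = ptime (J ! (i - 1))) \<and>
  (\<forall>x\<le>n. H (cell n i (a + int x)) = mreach T (jss ks) (rr i) x))"

lemma dl_lt_T: "j < n \<Longrightarrow> dl (J ! j) < T"
proof -
  assume "j < n"
  hence "dl (J ! j) \<le> Max (dl ` set J)" by (intro Max_ge) auto
  thus ?thesis by (simp add: T_def)
qed

lemma r0_lt: "j < n \<Longrightarrow> r0 < rel (J ! j)"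
proof -
  assume "j < n"
  hence "Min (rel ` set J) \<le> rel (J ! j)" by (intro Min_le) auto
  thus ?thesis by (simp add: r0_def)
qed

lemma lvl_good: "lvl ks \<Longrightarrow> good T (jss ks)"
proof -
  assume l: "lvl ks"
  obtain S where "feasible_schedule J S" using fi by (auto simp: feasible_instance_def)
  thus ?thesis using good_levels[OF va, of S ks T] l dl_lt_T by (auto simp: lvl_def jss_def)
qed

lemma job_bounds: "j < n \<Longrightarrow> 1 \<le> ptime (J ! j) \<and> rel (J ! j) < dl (J ! j)"
proof -
  assume j: "j < n"
  obtain S where fs: "feasible_schedule J S" using fi by (auto simp: feasible_instance_def)
  obtain t where "S t = Some j" using slot_exists[OF va fs j] by blast
  hence "rel (J ! j) < dl (J ! j)" using fs unfolding feasible_schedule_def by fastforce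
  thus ?thesis using va j by (simp add: valid_instance_def)
qed

lemma rr_lt_T: "i \<le> n \<Longrightarrow> rr i < T"
  using job_bounds[of "i - 1"] dl_lt_T[of "i - 1"] r0_lt[of 0] job_bounds[of 0] dl_lt_T[of 0] ne
  by (cases i) (auto simp: rr_def)

lemma fa_lt: "i \<le> n \<Longrightarrow> fa ks i < T \<Longrightarrow> fa ks i = rr i \<and> rr i \<in> rel ` set (jss ks)"
  by (auto simp: fa_def rr_def jss_def split: if_splits)

lemma fa_ex: "lvl ks \<Longrightarrow> x \<in> set (jss ks) \<Longrightarrow> \<exists>i\<le>n. fa ks i = rel x \<and> fa ks i < T"
proof -
  assume l: "lvl ks" and x: "x \<in> set (jss ks)"
  then obtain k where k: "k \<in> set ks" "x = J ! k" by (auto simp: jss_def)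
  have kn: "k < n" using l k by (auto simp: lvl_def)
  have "fa ks (Suc k) = rel x" using k by (simp add: fa_def rr_def)
  moreover have "rel x < T" using rr_lt_T[of "Suc k"] kn k by (simp add: rr_def)
  ultimately show ?thesis using kn by (intro exI[of _ "Suc k"]) auto
qed

lemma nxt_is_next:
  assumes l: "lvl ks" and nx: "nxt (fa ks) (Suc n) T e \<sigma> j" "\<sigma> < T"
  shows "is_next (jss ks) e \<sigma>" "rr j = \<sigma>" "j \<le> n"
proof -
  have j: "j \<le> n" "fa ks j = \<sigma>" "e \<le> \<sigma>" using nx by (auto simp: nxt_def)
  note f = fa_lt[OF j(1), of ks]
  show "rr j = \<sigma>" "j \<le> n" using f j nx by auto
  show "is_next (jss ks) e \<sigma>" unfolding is_next_def
  proof (intro conjI ballI impI)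
    show "\<sigma> \<in> rel ` set (jss ks)" using f j nx by auto
    show "e \<le> \<sigma>" by (rule j)
    fix x assume x: "x \<in> set (jss ks)" "e \<le> rel x"
    obtain i where "i \<le> n" "fa ks i = rel x" using fa_ex[OF l x(1)] by blast
    thus "\<sigma> \<le> rel x" using nx(1) x(2) unfolding nxt_def by (metis le_imp_less_Suc)
  qed
qed

lemma is_next_nxt:
  assumes l: "lvl ks" and nx: "is_next (jss ks) e \<sigma>"
  shows "\<sigma> < T" "\<exists>j. nxt (fa ks) (Suc n) T e \<sigma> j"
proof -
  obtain x where x: "x \<in> set (jss ks)" "\<sigma> = rel x" using nx by (auto simp: is_next_def)
  obtain i where i: "i \<le> n" "fa ks i = \<sigma>" "\<sigma> < T" using fa_ex[OF l x(1)] x(2) by auto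
  show "\<sigma> < T" by (rule i)
  define j where "j = (LEAST j. fa ks j = \<sigma>)"
  have j: "fa ks j = \<sigma>" "j \<le> i" unfolding j_def using i(2) by (rule LeastI, rule Least_le)
  have "fa ks i' \<noteq> \<sigma>" if "i' < j" for i' using not_less_Least[of i' "\<lambda>j. fa ks j = \<sigma>"] that j_def by auto
  moreover have "\<sigma> \<le> fa ks i'" if i': "i' < Suc n" "e \<le> fa ks i'" for i'
  proof (cases "fa ks i' < T")
    case True
    then obtain y where "y \<in> set (jss ks)" "fa ks i' = rel y" using fa_lt[of i' ks] i'(1) by auto
    thus ?thesis using nx i' unfolding is_next_def by auto
  qed (use i in auto)
  ultimately have "nxt (fa ks) (Suc n) T e \<sigma> j" using i j nx by (auto simp: nxt_def is_next_def)
  thus "\<exists>j. nxt (fa ks) (Suc n) T e \<sigma> j" by blast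
qed

lemma done_iff:
  assumes l: "lvl ks"
  shows "(\<forall>y\<in>set (jss ks). rel y < e) \<longleftrightarrow> (\<forall>i\<le>n. fa ks i < T \<longrightarrow> fa ks i < e)"
proof
  assume a: "\<forall>y\<in>set (jss ks). rel y < e"
  show "\<forall>i\<le>n. fa ks i < T \<longrightarrow> fa ks i < e" using fa_lt[of _ ks] a by fastforce
next
  assume a: "\<forall>i\<le>n. fa ks i < T \<longrightarrow> fa ks i < e"
  show "\<forall>y\<in>set (jss ks). rel y < e" using fa_ex[OF l] a by fastforce
qed

lemma lvl_snocD: "lvl (ks @ [k]) \<Longrightarrow> good T (jss ks @ [J ! k]) \<and> k < n \<and> k \<notin> set ks"
  using lvl_good[of "ks @ [k]"] by (auto simp: lvl_def jss_def)

text \<open>The essential obligation is that edges lead to later release times: a reach does not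
  precede its start, and when the start is itself the next release, the reach has already passed
  it.\<close>

lemma dp_inst:
  assumes l: "lvl ks" "lvl (ks @ [k])" and ab: "offs n a b" and S: "S \<le> n"
  shows "dp n T (\<lambda>i x. mreach T (jss ks) (rr i) x) rr (fa ks) (ptime (J ! k)) (rel (J ! k)) S a b
    (\<lambda>i x c. chain (mreach T (jss ks)) (jss ks) (rel (J ! k)) (rr S) (rr i) x c)"
proof (unfold_locales)
  note g = lvl_good[OF l(1)]
  fix i h \<sigma> j g' c
  assume i: "i \<le> n" and nx: "nxt (fa ks) (Suc n) T (mreach T (jss ks) (rr i) h) \<sigma> j" "\<sigma> < T"
  note N = nxt_is_next[OF l(1) nx]
  show "rr i < rr j"
  proof -
    have "rr i \<le> mreach T (jss ks) (rr i) h" using mreach_props(1)[OF g] rr_lt_T[OF i] by simp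
    moreover have "mreach T (jss ks) (rr i) h \<le> rr j" using N by (simp add: is_next_def)
    moreover have "rr i < mreach T (jss ks) (rr i) h" if "rr i = rr j"
      using mreach_gt_release[OF g, of "rr i" h] N that by (simp add: is_next_def)
    ultimately show ?thesis by linarith
  qed
  assume "rel (J ! k) \<le> mreach T (jss ks) (rr i) h" "chain (mreach T (jss ks)) (jss ks) (rel (J ! k)) (rr S) (rr i) g' c"
  from chain_step[OF this(2,1) N(1)]
  show "chain (mreach T (jss ks)) (jss ks) (rel (J ! k)) (rr S) (rr j) (g' + h) (c + (\<sigma> - mreach T (jss ks) (rr i) h))"
    using N(2) by simp
next
  show "0 \<le> ptime (J ! k)" using job_bounds[of k] lvl_snocD[OF l(2)] by simp
qed (use ab S fa_lt rr_lt_T chain_refl in auto)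

section \<open>One row, one level, all levels\<close>

lemma rowc_spec:
  assumes l: "lvl ks" "lvl (ks @ [k])" and ab: "offs n a b" and S: "S \<le> n"
    and c: "cst n T v" and r: "v rR = a" "v rNew = b" "v rS = cell n S 0" "v rP = ptime (J ! k)"
      "v rRel = rel (J ! k)" "v rD = dl (J ! k)" and H: "hinv ks a H"
  shows "wp rowc (\<lambda>v' H' t'.
      (\<forall>i\<le>n. \<forall>q. 0 \<le> q \<and> q < 2 * int n + 6 \<and> (i \<noteq> S \<or> q < b \<or> b + int n < q) \<longrightarrow> H' (cell n i q) = H (cell n i q)) \<and>
      (\<forall>x\<le>n. H' (cell n S (b + int x)) = mreach T (jss (ks @ [k])) (rr S) x) \<and>
      t' \<le> t + 230 * Suc n ^ 3 \<and> keeps ({20..25} \<union> {36} \<union> {40..54}) v v') v H t" (is "wp _ ?Q _ _ _")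
proof -
  let ?R = "\<lambda>i x. mreach T (jss ks) (rr i) x" and ?x = "J ! k"
  let ?js = "jss ks" and ?G = "mreach T (jss ks @ [J ! k]) (rr S)"
  interpret dp n T ?R rr "fa ks" "ptime ?x" "rel ?x" S a b
    "\<lambda>i x c. chain (mreach T ?js) ?js (rel ?x) (rr S) (rr i) x c"
    by (rule dp_inst[OF l ab S])
  have js: "jss (ks @ [k]) = ?js @ [?x]" by (simp add: jss_def)
  note kk = lvl_snocD[OF l(2)]
  have g: "good T (?js @ [?x])" and gj: "good T ?js" using kk lvl_good[OF l(1)] by auto
  have hp: "hp H" using H unfolding hinv_def hp_def by auto
  let ?F = "{20..25} \<union> {36} \<union> {40..54} :: nat set"
  let ?P = "\<lambda>H'. (\<forall>i\<le>n. \<forall>q. 0 \<le> q \<and> q < 2 * int n + 6 \<and> (i \<noteq> S \<or> q < b \<or> b + int n < q) \<longrightarrow> H' (cell n i q) = H (cell n i q)) \<and>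
      (\<forall>x\<le>n. H' (cell n S (b + int x)) = mreach T (jss (ks @ [k])) (rr S) x)"
  have fin: "?P H'" if "sm H H'" "\<forall>x\<le>n. NV H' x = ?G x" for H'
    using sm_other[OF that(1)] that(2) js by (auto simp: NV_def)
  have pw: "Suc n \<le> Suc n ^ 3" "Suc n ^ 2 \<le> Suc n ^ 3" "1 \<le> Suc n ^ 3"
    using power_increasing[of 1 3 "Suc n"] power_increasing[of 2 3 "Suc n"] by auto
  \<comment> \<open>Along any chain within the budget the stored costs stay at most the chain cost,
    because all edges out of visited rows are relaxed and each leads to a row that is visited as
    well.\<close>
  have complete: "\<exists>i\<in>vis T. rr i = \<mu> \<and> CV H' i g' \<le> c"
    if so: "sound H'" and ed: "\<forall>i\<in>vis T. \<forall>h\<le>n. edge H' i h"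
      and "chain (mreach T ?js) ?js (rel ?x) (rr S) \<mu> g' c" "c \<le> ptime ?x" "g' \<le> n" for H' \<mu> g' c
    using that(3-5)
  proof (induction rule: chain.induct)
    case chain_refl
    have "S \<in> vis T" using S rr_lt_T[OF S] by (simp add: vis_def)
    thus ?case using so by (auto simp: sound_def)
  next
    case (chain_step \<mu> g' c h \<nu>)
    have "mreach T ?js \<mu> h \<le> \<nu>" using chain_step(3) by (simp add: is_next_def)
    then obtain i where i: "i \<in> vis T" "rr i = \<mu>" "CV H' i g' \<le> c" using chain_step by force
    have i_n: "i \<le> n" using i by (simp add: vis_def)
    obtain j where j: "nxt (fa ks) (Suc n) T (mreach T ?js \<mu> h) \<nu> j" and nT: "\<nu> < T"
      using is_next_nxt[OF l(1) chain_step(3)] by blast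
    have hn: "h \<le> n" "g' + h \<le> n" using chain_step by auto
    have c_le: "CV H' i g' \<le> ptime ?x" using i(3) chain_step(5) \<open>mreach T ?js \<mu> h \<le> \<nu>\<close> by linarith
    have "edge H' i h" using ed i(1) hn by blast
    hence "CV H' j (g' + h) \<le> CV H' i g' + (\<nu> - mreach T ?js \<mu> h)"
      using i(2) chain_step(2) hn c_le j nT unfolding edge_def by blast
    moreover have "j \<in> vis T"
    proof -
      have jj: "j \<le> n" "fa ks j = \<nu>" "\<forall>i'<j. fa ks i' \<noteq> \<nu>" using j nT by (auto simp: nxt_def)
      have "rr i < rr j" using up[OF i_n hn(1)] j i(2) nT by blast
      moreover have "rr S \<le> rr i" using i(1) fr[OF i_n] by (auto simp: vis_def)
      moreover have "rr j = \<nu>" using fr[OF jj(1)] jj(2) nT by simp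
      ultimately show ?thesis using jj nT by (auto simp: vis_def)
    qed
    moreover have "rr j = \<nu>" using nxt_is_next[OF l(1) j nT] by simp
    ultimately show ?case using i(3) by (intro bexI[of _ j]) auto
  qed
  \<comment> \<open>Soundness and completeness of the relaxations make \<open>NV H' x\<close> the
    maximum that \<open>mreach_snoc\<close> calls \<open>V\<close>.\<close>
  have Geq: "?G x = (if 0 < x \<and> rel ?x < ?G (x - 1) \<and> (\<forall>i\<le>n. fa ks i < T \<longrightarrow> fa ks i < ?G (x - 1)) then T else min (dl ?x) (NV H' x))"
    if so: "sound H'" and ed: "\<forall>i\<in>vis T. \<forall>h\<le>n. edge H' i h" and x: "x \<le> n" and rs: "rr S \<le> rel ?x" for H' x
  proof -
    have "?G x = (if 0 < x \<and> (\<forall>y\<in>set (?js @ [?x]). rel y < ?G (x - 1)) then T else min (dl ?x) (NV H' x))"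
    proof (rule mreach_snoc[OF g rs])
      show "mreach T ?js (rr S) x \<le> NV H' x" using so x by (simp add: sound_def)
      show "NV H' x = mreach T ?js (rr S) x \<or> (\<exists>\<mu> h c. chain (mreach T ?js) ?js (rel ?x) (rr S) \<mu> h c \<and> h \<le> x \<and> c \<le> ptime ?x \<and>
        rel ?x \<le> mreach T ?js \<mu> (x - h) \<and> NV H' x = mreach T ?js \<mu> (x - h) + ptime ?x - c)"
      proof (cases "NV H' x = mreach T ?js (rr S) x")
        case False
        then obtain i h c where "i \<le> n" "h \<le> x" "chain (mreach T ?js) ?js (rel ?x) (rr S) (rr i) (x - h) c" "c \<le> ptime ?x"
          "rel ?x \<le> mreach T ?js (rr i) h" "NV H' x = mreach T ?js (rr i) h + ptime ?x - c" using so x by (auto simp: sound_def)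
        thus ?thesis by (intro disjI2 exI[of _ "rr i"] exI[of _ "x - h"] exI[of _ c]) auto
      qed simp
      fix \<mu> h c assume ch: "chain (mreach T ?js) ?js (rel ?x) (rr S) \<mu> h c" "h \<le> x" "c \<le> ptime ?x" "rel ?x \<le> mreach T ?js \<mu> (x - h)"
      obtain i where i: "i \<in> vis T" "rr i = \<mu>" "CV H' i h \<le> c" using complete[OF so ed ch(1,3)] ch(2) x by auto
      have "edge H' i (x - h)" using ed i(1) x by auto
      moreover have "h + (x - h) \<le> n" "CV H' i h \<le> ptime ?x" "rel ?x \<le> mreach T ?js (rr i) (x - h)" using i ch x by auto
      ultimately have "mreach T ?js (rr i) (x - h) + ptime ?x - CV H' i h \<le> NV H' (h + (x - h))"
        unfolding edge_def by blast
      hence "mreach T ?js \<mu> (x - h) + ptime ?x - CV H' i h \<le> NV H' (h + (x - h))" using i(2) by simp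
      thus "mreach T ?js \<mu> (x - h) + ptime ?x - c \<le> NV H' x" using i(3) ch(2) by simp
    qed
    thus ?thesis using done_iff[OF l(1), of "?G (x - 1)"] by auto
  qed
  show ?thesis unfolding rowc_def
  proof (rule wp_simps(7), rule wp_conseq[OF copyrow_spec[OF c r(1,2,3) hp, of t]])
    fix v1 H1 t1 assume A: "sm H H1 \<and> (\<forall>x\<le>n. NV H1 x = ?R S x) \<and> t1 \<le> t + 12 * Suc n \<and>
      keeps {24, 40, 41, 46} v v1"
    have fr1: "v1 x = v x" if "x \<notin> {24, 40, 41, 46}" for x using A that by blast
    have hp1: "hp H1" using sm_hp[OF hp] A by blast
    have rS1: "v1 rS = cell n S 0" "H1 (cell n S 0) = rr S" "0 \<le> cell n S 0" using fr1 r hp1 S by (auto simp: hp_def intro: cell_nonneg)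
    let ?v = "v1(rA := rr S)"
    have cv: "cst n T ?v" using c fr1 by (auto simp: cst_def)
    have rv: "?v rR = a" "?v rNew = b" "?v rS = cell n S 0" "?v rP = ptime ?x" "?v rRel = rel ?x" "?v rD = dl ?x" using r fr1 by auto
    have main: "wp (IFLE rA rRel (clearC ;; mloop ;; capl) SKIP) ?Q ?v H1 (t1 + 1)"
    proof (rule wp_simps(8))
      assume "?v rA \<le> ?v rRel"
      hence rs: "rr S \<le> rel ?x" using rv by simp
      show "wp (clearC ;; mloop ;; capl) ?Q ?v H1 (t1 + 1 + 2)"
      proof (rule wp_simps(7), rule wp_conseq[OF clearC_spec[OF cv rv(3,4), of H1 "t1 + 1 + 2"]])
        fix v2 H2 t2 assume B: "sm H1 H2 \<and> (\<forall>x\<le>n. NV H2 x = NV H1 x) \<and>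
          (\<forall>i\<le>n. \<forall>x\<le>n. CV H2 i x = (if i = S \<and> x = 0 then 0 else ptime ?x + 1)) \<and>
          t2 \<le> t1 + 1 + 2 + 20 * Suc n ^ 2 \<and> keeps {23, 41, 45, 51} ?v v2"
        have fr2: "v2 x = ?v x" if "x \<notin> {23, 41, 45, 51}" for x using B that by blast
        have hp2: "hp H2" using sm_hp[OF hp1] B by blast
        have so2: "sound H2" unfolding sound_def
        proof (intro conjI allI impI)
          fix x assume "x \<le> n"
          hence "NV H2 x = ?R S x" using A B by simp
          thus "?R S x \<le> NV H2 x" "NV H2 x = ?R S x \<or> (\<exists>i\<le>n. \<exists>h\<le>x. \<exists>c. chain (mreach T ?js) ?js (rel ?x) (rr S) (rr i) (x - h) c \<and>
            c \<le> ptime ?x \<and> rel ?x \<le> ?R i h \<and> NV H2 x = ?R i h + ptime ?x - c)" by auto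
        next
          fix i x assume "i \<le> n" "x \<le> n" "CV H2 i x \<le> ptime ?x"
          moreover from this have "CV H2 i x = (if i = S \<and> x = 0 then 0 else ptime ?x + 1)" using B by blast
          ultimately show "chain (mreach T ?js) ?js (rel ?x) (rr S) (rr i) x (CV H2 i x)"
            using chain_refl by (simp split: if_splits)
        next
          show "CV H2 S 0 \<le> 0" using B S by simp
        qed
        have c2: "cst n T v2" using cv fr2 by (auto simp: cst_def)
        have r2: "v2 rR = a" "v2 rNew = b" "v2 rS = cell n S 0" "v2 rP = ptime ?x" "v2 rRel = rel ?x" "v2 rD = dl ?x" using rv fr2 by auto
        show "wp (mloop ;; capl) ?Q v2 H2 t2"
        proof (rule wp_simps(7), rule wp_conseq[OF mloop_spec[OF c2 r2(1-5) hp2 so2, of t2]])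
          fix v3 H3 t3 assume D: "sm H2 H3 \<and> sound H3 \<and> (\<forall>i\<in>vis T. \<forall>h\<le>n. edge H3 i h) \<and>
            t3 \<le> t2 + 130 * Suc n ^ 3 \<and> keeps ({20..25} \<union> {36} \<union> {40..52} \<union> {54}) v2 v3"
          have fr3: "v3 x = v2 x" if "x \<notin> {20..25} \<union> {36} \<union> {40..52} \<union> {54}" for x using D that by blast
          have hp3: "hp H3" using sm_hp[OF hp2] D by blast
          have c3: "cst n T v3" using c2 fr3 by (auto simp: cst_def)
          have r3: "v3 rNew = b" "v3 rS = cell n S 0" "v3 rRel = rel ?x" "v3 rD = dl ?x" using r2 fr3 by auto
          show "wp capl ?Q v3 H3 t3"
          proof (rule wp_conseq[OF capl_spec[where G = ?G and t = t3, OF c3 r3 hp3]])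
            fix v4 H4 t4 assume E: "sm H3 H4 \<and> (\<forall>x\<le>n. NV H4 x = ?G x) \<and>
              t4 \<le> t3 + 50 * Suc n ^ 2 \<and> keeps ({20..25} \<union> {41, 46, 53}) v3 v4"
            have "sm H H1" "sm H1 H2" "sm H2 H3" "sm H3 H4" using A B D E by blast+
            hence "sm H H4" by (rule sm_trans[OF sm_trans[OF sm_trans]])
            hence P: "?P H4" using fin E by blast
            have fr4: "v4 x = v x" if "x \<notin> ?F" for x
            proof -
              have "v4 x = v3 x" using E that by auto
              also have "\<dots> = v2 x" using fr3[of x] that by auto
              also have "\<dots> = v1 x" using fr2[of x] that by auto
              also have "\<dots> = v x" using fr1[of x] that by auto
              finally show ?thesis .
            qed
            have "t4 \<le> t + 230 * Suc n ^ 3"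
            proof -
              have arith: "t4 \<le> t + 230 * q" if "N \<le> q" "N2 \<le> q" "1 \<le> q" "t1 \<le> t + 12 * N" "t2 \<le> t1 + 3 + 20 * N2" "t3 \<le> t2 + 130 * q" "t4 \<le> t3 + 50 * N2"
                for N N2 q :: nat using that by linarith
              show ?thesis by (rule arith[OF pw]) (use A B D E in auto)
            qed
            thus "?Q v4 H4 t4" using P fr4 by blast
          qed (use Geq D rs in blast)+
        qed
      qed
    next
      assume "\<not> ?v rA \<le> ?v rRel"
      hence "rel ?x < rr S" using rv by simp
      hence "?G x = ?R S x" for x using mreach_snoc_later[OF g] by simp
      hence P: "?P H1" using fin[of H1] A by simp
      have "t1 + 1 + 2 \<le> t + 230 * Suc n ^ 3"
      proof -
        have arith: "t1 + 1 + 2 \<le> t + 230 * q" if "N \<le> q" "1 \<le> q" "t1 \<le> t + 12 * N" for N q :: nat using that by linarith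
        show ?thesis by (rule arith[OF pw(1,3)]) (use A in auto)
      qed
      moreover have "?v x = v x" if "x \<notin> ?F" for x using fr1[of x] that by auto
      ultimately show "wp SKIP ?Q ?v H1 (t1 + 1 + 2)" using P by (intro wp_simps(1)) blast
    qed
    show "wp (LOAD rA rS ;; IFLE rA rRel (clearC ;; mloop ;; capl) SKIP) ?Q v1 H1 t1"
      apply (rule wp_simps(7), rule wp_simps(5))
       using rS1 apply simp
      using main rS1 by simp
  qed
qed


lemma lvl_snocI:
  assumes l: "lvl ks" and k: "k < n" "k \<notin> set ks" and m: "\<And>j. j < n \<Longrightarrow> j \<notin> set ks \<Longrightarrow> dl (J ! k) \<le> dl (J ! j)"
  shows "lvl (ks @ [k])"
  using l k m unfolding lvl_def jss_def by (auto simp: sorted_append)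

lemma level_spec:
  assumes l: "lvl ks" "length ks < n" and ab: "offs n a b"
    and c: "cst n T v" and r: "v rR = a" "v rNew = b" and H: "hinv ks a H"
  shows "wp level (\<lambda>v' H' t'. (\<exists>k. lvl (ks @ [k]) \<and> hinv (ks @ [k]) b H') \<and> v' rR = b \<and> v' rNew = a \<and>
      t' \<le> t + 280 * Suc n ^ 4 \<and> keeps ({7, 8} \<union> {20..25} \<union> {31..36} \<union> {40..54}) v v') v H t" (is "wp _ ?Q _ _ _")
proof -
  let ?F = "{7, 8} \<union> {20..25} \<union> {31..36} \<union> {40..54} :: nat set"
  let ?upd = "ADD rA rKp rOne ;; STORE rA rRel ;; ADD rA rKp rTwo ;; STORE rA rT ;;
     ADD rA rR rZ ;; ADD rR rNew rZ ;; ADD rNew rA rZ"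
  let ?loop = "WHILELE rS rXN (rowc ;; ADD rS rS rW)"
  let ?mid = "ADD rKp rJ rZ ;; ADD rD rRJ rZ ;; LOAD rRel rKp ;; ADD rA rKp rThree ;; LOAD rP rA ;; ADD rS rX0 rZ ;; ?loop ;; ?upd"
  have b0: "(a = 4 \<and> b = int n + 5) \<or> (a = int n + 5 \<and> b = 4)" using ab by (simp add: offs_def)
  define v0 where "v0 = v(rE := r0)"
  have H00: "H (cell n 0 0) = r0" using H by (auto simp: hinv_def rr_def)
  have c0: "cst n T v0" "v0 rTwo = 2" using c by (auto simp: cst_def v0_def)
  have after: "wp ?mid ?Q v1 H t1"
    if nx: "nxt (fd ks) (Suc n) T r0 (v1 rRJ) j" "v1 rRJ < T \<longrightarrow> v1 rJ = cell n j 0"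
      and fr1: "\<And>x. x \<notin> {20..25} \<Longrightarrow> v1 x = v x" and t1: "t1 \<le> t + 1 + 20 * Suc n" for v1 t1 j
  proof -
    have "\<exists>j<n. j \<notin> set ks"
    proof (rule ccontr)
      assume "\<not> ?thesis"
      hence "{..<n} \<subseteq> set ks" by auto
      hence "card {..<n} \<le> card (set ks)" by (intro card_mono) auto
      thus False using l card_length[of ks] by simp
    qed
    then obtain j0 where j0: "j0 < n" "j0 \<notin> set ks" by blast
    have low: "v1 rRJ \<le> dl (J ! j')" if "j' < n" "j' \<notin> set ks" for j'
    proof -
      have "fd ks (Suc j') = dl (J ! j')" using that by (simp add: fd_def)
      moreover have "r0 \<le> dl (J ! j')" using r0_lt[of j'] job_bounds[of j'] that by simp
      ultimately show ?thesis using nx(1) that unfolding nxt_def by (metis Suc_less_eq)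
    qed
    have lt: "v1 rRJ < T" using low[OF j0] dl_lt_T[OF j0(1)] by simp
    hence j: "j \<le> n" "fd ks j = v1 rRJ" "v1 rJ = cell n j 0" using nx by (auto simp: nxt_def)
    define k where "k = j - 1"
    have jk: "j = Suc k" "k < n" "k \<notin> set ks" "v1 rRJ = dl (J ! k)"
      using j lt by (auto simp: k_def fd_def split: if_splits)
    have l2: "lvl (ks @ [k])" using lvl_snocI[OF l(1) jk(2,3)] low jk(4) by simp
    have Hj: "H (cell n j 0) = rel (J ! k)" "H (cell n j 3) = ptime (J ! k)"
      using H j jk by (auto simp: hinv_def rr_def)
    \<comment> \<open>The bound \<open>2 * int n + 6\<close> leaves out the cost block, which is
      scratch. Outside it only the new reach block changes, so every row still reads the old
      table.\<close>
    define chg where "chg i H' \<longleftrightarrow> (\<forall>i'\<le>n. \<forall>q. 0 \<le> q \<and> q < 2 * int n + 6 \<and> (q < b \<or> b + int n < q) \<longrightarrow> H' (cell n i' q) = H (cell n i' q)) \<and>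
      (\<forall>i'<i. \<forall>x\<le>n. H' (cell n i' (b + int x)) = mreach T (jss (ks @ [k])) (rr i') x)" for i :: nat and H' :: heap
    have chg_hinv: "hinv ks a H'" if "chg i H'" for i H'
      unfolding hinv_def
    proof (intro allI impI conjI)
      fix i' assume i': "i' \<le> n"
      have e: "H' (cell n i' q) = H (cell n i' q)" if "0 \<le> q" "q < 2 * int n + 6" "q < b \<or> b + int n < q" for q
        using \<open>chg i H'\<close> i' that unfolding chg_def by blast
      have h: "H (cell n i' 0) = rr i'" "H (cell n i' 1) = fa ks i'" "H (cell n i' 2) = fd ks i'" using H i' by (auto simp: hinv_def)
      have b4: "4 \<le> b" using b0 by auto
      show "H' (cell n i' 0) = rr i'" "H' (cell n i' 1) = fa ks i'" "H' (cell n i' 2) = fd ks i'"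
        using e[of 0] e[of 1] e[of 2] h b4 by simp_all
      show "0 < i' \<Longrightarrow> H' (cell n i' 3) = ptime (J ! (i' - 1))" using e[of 3] b4 H i' by (simp add: hinv_def)
      fix x assume x: "x \<le> n"
      have "H' (cell n i' (a + int x)) = H (cell n i' (a + int x))" using b0 x by (intro e) auto
      thus "H' (cell n i' (a + int x)) = mreach T (jss ks) (rr i') x" using H i' x by (simp add: hinv_def)
    qed
    define I where "I i v' H' t' \<longleftrightarrow> chg i H' \<and> t' \<le> t1 + 6 + i * (235 * Suc n ^ 3) \<and> v' rS = cell n i 0 \<and> v' rKp = cell n j 0 \<and>
      v' rD = dl (J ! k) \<and> v' rRel = rel (J ! k) \<and> v' rP = ptime (J ! k) \<and>
      keeps ({20..25} \<union> {31..36} \<union> {40..54}) v v'" for i :: nat and v' :: regs and H' :: heap and t' :: nat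
    have fin: "wp ?upd ?Q v2 H2 t2" if I2: "I (Suc n) v2 H2 t0" "t2 \<le> t0 + 2" for v2 H2 t0 t2
    proof -
      have fr2: "\<And>x. x \<notin> {20..25} \<union> {31..36} \<union> {40..54} \<Longrightarrow> v2 x = v x" and c2: "chg (Suc n) H2"
        and r2: "v2 rKp = cell n j 0" "v2 rRel = rel (J ! k)" using I2 by (auto simp: I_def)
      have q2: "v2 rOne = 1" "v2 rTwo = 2" "v2 rZ = 0" "v2 rT = T" "v2 rR = a" "v2 rNew = b" using fr2 c r by (auto simp: cst_def)
      define H3 where "H3 = H2(cell n j 1 := rel (J ! k), cell n j 2 := T)"
      have H3: "H3 (cell n i q) = (if i = j \<and> q = 1 then rel (J ! k) else if i = j \<and> q = 2 then T else H2 (cell n i q))"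
        if "0 \<le> q" "q < 3 * int n + 7" for i q
        unfolding H3_def using cell_eq[of q n 1 i j] cell_eq[of q n 2 i j] that by auto
      have hv: "hinv (ks @ [k]) b H3" unfolding hinv_def
      proof (intro allI impI conjI)
        fix i assume i: "i \<le> n"
        have h0: "H2 (cell n i q) = H (cell n i q)" if "q \<in> {0, 1, 2, 3}" for q
          using c2 i that b0 unfolding chg_def by auto
        have hH: "H (cell n i 0) = rr i" "H (cell n i 1) = fa ks i" "H (cell n i 2) = fd ks i" using H i by (auto simp: hinv_def)
        show "H3 (cell n i 0) = rr i" using H3[of 0 i] h0 hH by simp
        have "H3 (cell n i 1) = (if i = j then rel (J ! k) else fa ks i)" using H3[of 1 i] h0[of 1] hH(2) by simp
        also have "\<dots> = fa (ks @ [k]) i" using jk(1) by (cases i) (auto simp: fa_def rr_def)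
        finally show "H3 (cell n i 1) = fa (ks @ [k]) i" .
        have "H3 (cell n i 2) = (if i = j then T else fd ks i)" using H3[of 2 i] h0[of 2] hH(3) by simp
        also have "\<dots> = fd (ks @ [k]) i" using jk(1) by (cases i) (auto simp: fd_def)
        finally show "H3 (cell n i 2) = fd (ks @ [k]) i" .
        show "0 < i \<Longrightarrow> H3 (cell n i 3) = ptime (J ! (i - 1))" using H3[of 3 i] h0 H i by (auto simp: hinv_def)
        fix x assume x: "x \<le> n"
        have "H3 (cell n i (b + int x)) = H2 (cell n i (b + int x))" using H3[of "b + int x" i] b0 x by auto
        also have "\<dots> = mreach T (jss (ks @ [k])) (rr i) x" using c2 i x unfolding chg_def by auto
        finally show "H3 (cell n i (b + int x)) = mreach T (jss (ks @ [k])) (rr i) x" .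
      qed
      have tt: "t2 + 7 \<le> t + 280 * Suc n ^ 4"
      proof -
        have arith: "t2 + 7 \<le> t + 280 * q" if "N \<le> q" "1 \<le> q" "t1 \<le> t + 1 + 20 * N" "t0 \<le> t1 + 6 + X" "X = 235 * q" "t2 \<le> t0 + 2"
          for N q X :: nat using that by linarith
        show ?thesis
        proof (rule arith)
          show "Suc n \<le> Suc n ^ 4" "1 \<le> Suc n ^ 4" using power_increasing[of 1 4 "Suc n"] by auto
          show "t1 \<le> t + 1 + 20 * Suc n" by (rule t1)
          show "t0 \<le> t1 + 6 + Suc n * (235 * Suc n ^ 3)" using I2 by (auto simp: I_def)
          show "Suc n * (235 * Suc n ^ 3) = 235 * Suc n ^ 4" using mult_power_next[of "Suc n" 235 3] by simp
          show "t2 \<le> t0 + 2" by (rule I2)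
        qed
      qed
      have nn: "0 \<le> cell n j 1" "0 \<le> cell n j 2" by (auto intro: cell_nonneg)
      have e3: "H2(cell n j 1 := v2 rRel, cell n j 2 := T) = H3" using r2 by (simp add: H3_def)
      have hv2: "\<exists>k. lvl (ks @ [k]) \<and> hinv (ks @ [k]) b H3" using l2 hv by blast
      show ?thesis
        apply (intro wp_simps)
        using r2 q2 nn hv2 e3 tt fr2 by auto
    qed
    have loop: "wp ?loop (wp ?upd ?Q) v' H' t'" if "I 0 v' H' t'" for v' H' t'
    proof (rule wp_for[where I = I and N = "Suc n", OF that])
      fix i v2 H2 t2 assume i: "i < Suc n" and I2: "I i v2 H2 t2"
      have fr2: "\<And>x. x \<notin> {20..25} \<union> {31..36} \<union> {40..54} \<Longrightarrow> v2 x = v x" and g2: "chg i H2"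
        and r2: "v2 rS = cell n i 0" "v2 rP = ptime (J ! k)" "v2 rRel = rel (J ! k)" "v2 rD = dl (J ! k)"
        using I2 by (auto simp: I_def)
      have c2: "cst n T v2" using c fr2 by (auto simp: cst_def)
      have q2: "v2 rR = a" "v2 rNew = b" using fr2 r by auto
      have i_n: "i \<le> n" using i by simp
      show "v2 rS \<le> v2 rXN \<and> wp (rowc ;; ADD rS rS rW) (I (Suc i)) v2 H2 (t2 + 2)"
      proof
        show "v2 rS \<le> v2 rXN" using r2 c2 i by (simp add: cst_def)
        show "wp (rowc ;; ADD rS rS rW) (I (Suc i)) v2 H2 (t2 + 2)"
        proof (rule wp_simps(7), rule wp_conseq[OF rowc_spec[OF l(1) l2 ab i_n c2 q2 r2 chg_hinv[OF g2], of "t2 + 2"]], rule wp_simps(3))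
          fix v3 H3 t3 assume A: "(\<forall>i'\<le>n. \<forall>q. 0 \<le> q \<and> q < 2 * int n + 6 \<and> (i' \<noteq> i \<or> q < b \<or> b + int n < q) \<longrightarrow> H3 (cell n i' q) = H2 (cell n i' q)) \<and>
            (\<forall>x\<le>n. H3 (cell n i (b + int x)) = mreach T (jss (ks @ [k])) (rr i) x) \<and>
            t3 \<le> t2 + 2 + 230 * Suc n ^ 3 \<and> keeps ({20..25} \<union> {36} \<union> {40..54}) v2 v3"
          have fr3: "v3 x = v2 x" if "x \<notin> {20..25} \<union> {36} \<union> {40..54}" for x using A that by blast
          have g3: "chg (Suc i) H3" unfolding chg_def
          proof (intro conjI allI impI)
            fix i' q assume "i' \<le> n" "0 \<le> q \<and> q < 2 * int n + 6 \<and> (q < b \<or> b + int n < q)"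
            thus "H3 (cell n i' q) = H (cell n i' q)" using A g2 unfolding chg_def by simp
          next
            fix i' x assume i': "i' < Suc i" and x: "x \<le> n"
            show "H3 (cell n i' (b + int x)) = mreach T (jss (ks @ [k])) (rr i') x"
            proof (cases "i' = i")
              case True thus ?thesis using A x by simp
            next
              case False
              have "H3 (cell n i' (b + int x)) = H2 (cell n i' (b + int x))" using A False i' i x b0 by auto
              thus ?thesis using g2 False i' x unfolding chg_def by simp
            qed
          qed
          have "t3 + 1 \<le> t1 + 6 + Suc i * (235 * Suc n ^ 3)"
          proof -
            have arith: "t3 + 1 \<le> t1 + 6 + X" if "1 \<le> q" "t2 \<le> t1 + 6 + Y" "X = Y + 235 * q" "t3 \<le> t2 + 2 + 230 * q"
              for X Y q :: nat using that by linarith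
            show ?thesis
            proof (rule arith)
              show "1 \<le> Suc n ^ 3" by simp
              show "t2 \<le> t1 + 6 + i * (235 * Suc n ^ 3)" using I2 by (auto simp: I_def)
              show "Suc i * (235 * Suc n ^ 3) = i * (235 * Suc n ^ 3) + 235 * Suc n ^ 3" by simp
            qed (use A in auto)
          qed
          thus "I (Suc i) (v3(rS := v3 rS + v3 rW)) H3 (t3 + 1)"
            unfolding I_def using g3 fr3 fr2 r2 c2 I2 by (auto simp: cst_def cell_next I_def)
        qed
      qed
    next
      fix v2 H2 t2 assume I2: "I (Suc n) v2 H2 t2"
      have "v2 rS = cell n (Suc n) 0" "v2 rXN = cell n n 0" using I2 c by (auto simp: I_def cst_def)
      thus "\<not> v2 rS \<le> v2 rXN \<and> wp ?upd ?Q v2 H2 (t2 + 2)" using fin[OF I2] by simp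
    qed
    have nn: "0 \<le> cell n j 0" "0 \<le> cell n j 3" by (auto intro: cell_nonneg)
    have g0: "chg 0 H" by (simp add: chg_def)
    have q1: "v1 rZ = 0" "v1 rThree = 3" "v1 rX0 = cell n 0 0" using fr1 c by (auto simp: cst_def)
    show ?thesis
      apply (rule wp_simps(7), rule wp_simps(3))
      apply (rule wp_simps(7), rule wp_simps(3))
      apply (rule wp_simps(7), rule wp_simps(5))
       using j q1 nn apply simp
      apply (rule wp_simps(7), rule wp_simps(3))
      apply (rule wp_simps(7), rule wp_simps(5))
       using j q1 nn apply simp
      apply (rule wp_simps(7), rule wp_simps(3))
      apply (rule wp_simps(7), rule loop)
      using j q1 Hj g0 jk fr1 by (auto simp: I_def)
  qed
  have fH: "\<And>i. i \<le> n \<Longrightarrow> H (cell n i 2) = fd ks i" using H by (auto simp: hinv_def)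
  have sc: "wp (scan rTwo) (wp ?mid ?Q) v0 H (t + 1)"
  proof (rule wp_conseq[OF scan_spec[where v = v0 and H = H and f = "fd ks" and k = 2 and t = "t + 1", OF c0]])
    fix v1 H1 t1 assume B: "H1 = H \<and> t1 \<le> t + 1 + 20 * Suc n \<and>
      (\<exists>j. nxt (fd ks) (Suc n) T (v0 rE) (v1 rRJ) j \<and> (v1 rRJ < T \<longrightarrow> v1 rJ = cell n j 0)) \<and>
      keeps {21..25} v0 v1"
    then obtain j where j: "nxt (fd ks) (Suc n) T r0 (v1 rRJ) j" "v1 rRJ < T \<longrightarrow> v1 rJ = cell n j 0" by (auto simp: v0_def)
    have fr: "v1 x = v x" if "x \<notin> {20..25}" for x using B that by (auto simp: v0_def)
    show "wp ?mid ?Q v1 H1 t1" using after[OF j fr] B by blast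
  qed (use fH in auto)
  have X0: "v rX0 = cell n 0 0" "0 \<le> cell n 0 0" using c by (auto simp: cst_def intro: cell_nonneg)
  show ?thesis unfolding level_def
    apply (rule wp_simps(7), rule wp_simps(5))
     using X0 apply simp
    apply (rule wp_simps(7))
    using sc X0 H00 by (simp add: v0_def)
qed

lemma levels_spec:
  assumes ab: "offs n a b" and c: "cst n T v" and r: "v rR = a" "v rNew = b" and H: "hinv [] a H"
  shows "wp levels (\<lambda>v' H' t'. (\<exists>ks. lvl ks \<and> length ks = n \<and> hinv ks (v' rR) H') \<and> (v' rR = 4 \<or> v' rR = int n + 5) \<and>
      cst n T v' \<and> t' \<le> t + 300 * Suc n ^ 5) v H t" (is "wp _ ?Q _ _ _")
proof -
  define I where "I i v' H' t' \<longleftrightarrow> (\<exists>ks. lvl ks \<and> length ks = i \<and> hinv ks (v' rR) H') \<and> offs n (v' rR) (v' rNew) \<and>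
      cst n T v' \<and> v' rK = 1 + int i \<and> t' \<le> t + 1 + i * (285 * Suc n ^ 4)" for i :: nat and v' :: regs and H' :: heap and t' :: nat
  have loop: "wp (WHILELE rK rN (level ;; ADD rK rK rOne)) ?Q v' H' t'" if "I 0 v' H' t'" for v' H' t'
  proof (rule wp_for[where I = I and N = n, OF that])
    fix i v1 H1 t1 assume i: "i < n" and I: "I i v1 H1 t1"
    obtain ks where ks: "lvl ks" "length ks < n" "length ks = i" "hinv ks (v1 rR) H1" using I i by (auto simp: I_def)
    have c1: "cst n T v1" and ab1: "offs n (v1 rR) (v1 rNew)" and k1: "v1 rK = 1 + int i" using I by (auto simp: I_def)
    show "v1 rK \<le> v1 rN \<and> wp (level ;; ADD rK rK rOne) (I (Suc i)) v1 H1 (t1 + 2)"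
    proof
      show "v1 rK \<le> v1 rN" using k1 c1 i by (simp add: cst_def)
      show "wp (level ;; ADD rK rK rOne) (I (Suc i)) v1 H1 (t1 + 2)"
      proof (rule wp_simps(7), rule wp_conseq[OF level_spec[OF ks(1,2) ab1 c1 refl refl ks(4), of "t1 + 2"]], rule wp_simps(3))
        fix v2 H2 t2 assume A: "(\<exists>k. lvl (ks @ [k]) \<and> hinv (ks @ [k]) (v1 rNew) H2) \<and> v2 rR = v1 rNew \<and> v2 rNew = v1 rR \<and>
          t2 \<le> t1 + 2 + 280 * Suc n ^ 4 \<and> keeps ({7, 8} \<union> {20..25} \<union> {31..36} \<union> {40..54}) v1 v2"
        have fr: "v2 x = v1 x" if "x \<notin> {7, 8} \<union> {20..25} \<union> {31..36} \<union> {40..54}" for x using A that by blast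
        have c2: "cst n T v2" using c1 fr by (auto simp: cst_def)
        have "\<exists>ks. lvl ks \<and> length ks = Suc i \<and> hinv ks (v2 rR) H2" using A ks(3) by (metis length_append_singleton)
        moreover have "offs n (v2 rR) (v2 rNew)" using ab1 A by (auto simp: offs_def)
        moreover have "v2 rK = 1 + int i" "v2 rOne = 1" using fr k1 c1 by (auto simp: cst_def)
        moreover have "t2 + 1 \<le> t + 1 + Suc i * (285 * Suc n ^ 4)"
        proof -
          have arith: "t2 + 1 \<le> t + 1 + X" if "1 \<le> q" "t1 \<le> t + 1 + Y" "X = Y + 285 * q" "t2 \<le> t1 + 2 + 280 * q"
            for X Y q :: nat using that by linarith
          show ?thesis
          proof (rule arith)
            show "1 \<le> Suc n ^ 4" by simp
            show "t1 \<le> t + 1 + i * (285 * Suc n ^ 4)" using I by (auto simp: I_def)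
            show "Suc i * (285 * Suc n ^ 4) = i * (285 * Suc n ^ 4) + 285 * Suc n ^ 4" by simp
          qed (use A in auto)
        qed
        ultimately show "I (Suc i) (v2(rK := v2 rK + v2 rOne)) H2 (t2 + 1)" using c2 by (auto simp: I_def cst_def)
      qed
    qed
  next
    fix v1 H1 t1 assume I: "I n v1 H1 t1"
    have "t1 + 2 \<le> t + 300 * Suc n ^ 5"
    proof -
      have arith: "t1 + 2 \<le> t + 300 * q" if "1 \<le> q" "t1 \<le> t + 1 + Y" "Y \<le> Suc n * (285 * Suc n ^ 4)" "Suc n * (285 * Suc n ^ 4) = 285 * q"
        for Y q :: nat using that by linarith
      show ?thesis
      proof (rule arith)
        show "1 \<le> Suc n ^ 5" by simp
        show "t1 \<le> t + 1 + n * (285 * Suc n ^ 4)" using I by (auto simp: I_def)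
        show "n * (285 * Suc n ^ 4) \<le> Suc n * (285 * Suc n ^ 4)" by simp
        show "Suc n * (285 * Suc n ^ 4) = 285 * Suc n ^ 5" using mult_power_next[of "Suc n" 285 4] by simp
      qed
    qed
    thus "\<not> v1 rK \<le> v1 rN \<and> ?Q v1 H1 (t1 + 2)" using I by (auto simp: I_def cst_def offs_def)
  qed
  have "lvl []" by (simp add: lvl_def jss_def)
  thus ?thesis unfolding levels_def
    apply (intro wp_simps)
    apply (rule loop)
    using ab c r H by (auto simp: I_def cst_def)
qed

lemma answer_spec:
  assumes c: "cst n T v" and a: "v rR = 4 \<or> v rR = int n + 5" and l: "lvl ks" "length ks = n" and H: "hinv ks (v rR) H"
  shows "wp answer (\<lambda>v' H' t'. H' 0 = int (opt_gaps J) \<and> t' \<le> t + 60 * Suc n ^ 2) v H t" (is "wp _ ?Q _ _ _")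
proof -
  let ?js = "jss ks"
  note g = lvl_good[OF l(1)]
  have ks: "distinct ks" "set ks = {..<n}"
  proof -
    show d: "distinct ks" using l by (simp add: lvl_def)
    have "set ks \<subseteq> {..<n}" using l by (simp add: lvl_def)
    moreover have "card (set ks) = n" using distinct_card[OF d] l(2) by simp
    ultimately show "set ks = {..<n}" using card_subset_eq[of "{..<n}" "set ks"] by simp
  qed
  define dn where "dn x \<longleftrightarrow> (\<forall>y\<in>set ?js. rel y < mreach T ?js r0 x)" for x
  have r0T: "r0 \<le> T" using rr_lt_T[of 0] by (simp add: rr_def)
  \<comment> \<open>Column n passes all releases, so the search for the least such column stays
    inside the table.\<close>
  have ex: "dn n" using mreach_complete_bound[OF g r0T] l(2) by (simp add: dn_def jss_def)
  define k where "k = (LEAST x. dn x)"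
  have k: "dn k" "k \<le> n" unfolding k_def using ex by (rule LeastI, rule Least_le)
  have km: "\<not> dn k'" if "k' < k" for k' using not_less_Least[of k' dn] that k_def by simp
  have opt: "opt_gaps J + 1 = k"
  proof (rule opt_gaps_mreach[OF va fi ks, where s = r0 and T = T])
    show "sorted (map dl (map ((!) J) ks))" using l by (simp add: lvl_def jss_def)
    show "rel (J ! j) < mreach T (map ((!) J) ks) r0 k" if "j < n" for j
      using k(1) that ks(2) by (auto simp: dn_def jss_def)
    show "\<exists>j<n. mreach T (map ((!) J) ks) r0 k' \<le> rel (J ! j)" if "k' < k" for k'
      using km[OF that] ks(2) by (auto simp: dn_def jss_def not_less)
  qed (use r0_lt dl_lt_T ne in auto)
  have nd: "dn x \<longleftrightarrow> \<rho> = T" if "nxt (fa ks) (Suc n) T (mreach T ?js r0 x) \<rho> j" for x \<rho> j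
  proof -
    have "\<rho> \<le> T" using that by (simp add: nxt_def)
    moreover have "\<not> dn x" if lt: "\<rho> < T"
      using nxt_is_next(1)[OF l(1) \<open>nxt (fa ks) (Suc n) T (mreach T ?js r0 x) \<rho> j\<close> lt] unfolding dn_def is_next_def by force
    moreover have "dn x" if "\<rho> = T"
    proof -
      have "fa ks i < mreach T ?js r0 x" if "i \<le> n" "fa ks i < T" for i
        using \<open>nxt (fa ks) (Suc n) T (mreach T ?js r0 x) \<rho> j\<close> \<open>\<rho> = T\<close> that unfolding nxt_def by (meson le_imp_less_Suc not_le)
      thus ?thesis unfolding dn_def done_iff[OF l(1)] by blast
    qed
    ultimately show ?thesis by force
  qed
  have fH: "\<And>i. i \<le> n \<Longrightarrow> H (cell n i 1) = fa ks i" using H by (auto simp: hinv_def)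
  define I where "I x v' H' t' \<longleftrightarrow> H' = H \<and> v' rVal = int x - 1 \<and> v' rPR = cell n 0 (v rR + int x) \<and> (v' rRJ \<le> T - 1 \<longleftrightarrow> \<not> dn x) \<and>
    cst n T v' \<and> t' \<le> t + 4 + 20 * Suc n + x * (25 * Suc n)" for x :: nat and v' :: regs and H' :: heap and t' :: nat
  have sc: "wp (scan rOne) (I x) v1 H t1"
    if sc: "x \<le> n" "cst n T v1" "v1 rE = mreach T ?js r0 x" "v1 rVal = int x - 1" "v1 rPR = cell n 0 (v rR + int x)"
      "t1 + 20 * Suc n \<le> t + 4 + 20 * Suc n + x * (25 * Suc n)" for x v1 t1
  proof (rule wp_conseq[OF scan_spec[where v = v1 and H = H and f = "fa ks" and k = 1 and t = t1]])
    fix v2 H2 t2 assume B: "H2 = H \<and> t2 \<le> t1 + 20 * Suc n \<and>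
      (\<exists>j. nxt (fa ks) (Suc n) T (v1 rE) (v2 rRJ) j \<and> (v2 rRJ < T \<longrightarrow> v2 rJ = cell n j 0)) \<and>
      keeps {21..25} v1 v2"
    then obtain j where j: "nxt (fa ks) (Suc n) T (mreach T ?js r0 x) (v2 rRJ) j" using sc(3) by auto
    have fr: "v2 x = v1 x" if "x \<notin> {21..25}" for x using B that by blast
    have "v2 rRJ \<le> T" using j by (simp add: nxt_def)
    thus "I x v2 H2 t2" unfolding I_def using sc B fr nd[OF j] by (auto simp: cst_def)
  qed (use sc fH in \<open>auto simp: cst_def\<close>)
  have HR: "H (cell n 0 (v rR + int x)) = mreach T ?js r0 x" if "x \<le> n" for x using H that by (auto simp: hinv_def rr_def)
  have nn: "0 \<le> cell n 0 (v rR + int x)" for x using a by (auto intro!: cell_nonneg)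
  let ?body = "ADD rVal rVal rOne ;; ADD rPR rPR rOne ;; LOAD rE rPR ;; scan rOne"
  have loop: "wp (WHILELE rRJ rT1 ?body) (wp (STORE rZ rVal) ?Q) v' H' t'" if "I 0 v' H' t'" for v' H' t'
  proof (rule wp_for[where I = I and N = k, OF that])
    fix x v1 H1 t1 assume x: "x < k" and I: "I x v1 H1 t1"
    have c1: "cst n T v1" using I by (simp add: I_def)
    have xn: "Suc x \<le> n" using x k by simp
    show "v1 rRJ \<le> v1 rT1 \<and> wp ?body (I (Suc x)) v1 H1 (t1 + 2)"
    proof
      show "v1 rRJ \<le> v1 rT1" using I km[OF x] by (auto simp: I_def cst_def)
      have q: "v1 rPR + 1 = cell n 0 (v rR + int (Suc x))" "v1 rVal + 1 = int (Suc x) - 1" "v1 rOne = 1" "H1 = H"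
        using I by (auto simp: I_def cst_def)
      have "v rR + int x + 1 = v rR + int (Suc x)" by simp
      hence HR': "H (cell n 0 (v rR + int x + 1)) = mreach T ?js r0 (Suc x)" using HR[OF xn] by (simp only:)
      show "wp ?body (I (Suc x)) v1 H1 (t1 + 2)"
        unfolding q(4)
        apply (rule wp_simps(7), rule wp_simps(3))
        apply (rule wp_simps(7), rule wp_simps(3))
        apply (rule wp_simps(7), rule wp_simps(5))
         using q nn[of "Suc x"] apply simp
        apply (rule sc[OF xn])
        using I q c1 HR' by (auto simp: cst_def I_def)
    qed
  next
    fix v1 H1 t1 assume I: "I k v1 H1 t1"
    have c1: "cst n T v1" using I by (simp add: I_def)
    have "\<not> v1 rRJ \<le> v1 rT1" using I k(1) c1 by (auto simp: I_def cst_def)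
    moreover have "wp (STORE rZ rVal) ?Q v1 H1 (t1 + 2)"
    proof (rule wp_simps(6))
      show "0 \<le> v1 rZ" using c1 by (simp add: cst_def)
      have "t1 + 2 + 1 \<le> t + 60 * Suc n ^ 2"
      proof -
        have arith: "t1 + 2 + 1 \<le> t + 60 * q" if "N \<le> q" "1 \<le> q" "t1 \<le> t + 4 + 20 * N + X" "X \<le> N * (25 * N)" "N * (25 * N) = 25 * q"
          for N X q :: nat using that by linarith
        show ?thesis
        proof (rule arith)
          show "Suc n \<le> Suc n ^ 2" "1 \<le> Suc n ^ 2" "Suc n * (25 * Suc n) = 25 * Suc n ^ 2" by (auto simp: power2_eq_square algebra_simps)
          show "t1 \<le> t + 4 + 20 * Suc n + k * (25 * Suc n)" using I by (auto simp: I_def)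
          show "k * (25 * Suc n) \<le> Suc n * (25 * Suc n)" using k(2) by (intro mult_le_mono1) simp
        qed
      qed
      moreover have "v1 rVal = int (opt_gaps J)" using I opt by (auto simp: I_def)
      ultimately show "?Q v1 (H1(v1 rZ := v1 rVal)) (t1 + 2 + 1)" using c1 by (simp add: cst_def)
    qed
    ultimately show "\<not> v1 rRJ \<le> v1 rT1 \<and> wp (STORE rZ rVal) ?Q v1 H1 (t1 + 2)" by simp
  qed
  have X0: "v rX0 = cell n 0 0" using c by (simp add: cst_def)
  define w where "w = v(rVal := - 1, rPR := cell n 0 (v rR), rE := mreach T ?js r0 0)"
  have s0: "wp (scan rOne) (I 0) w H (t + 3)" using c by (intro sc) (auto simp: w_def cst_def)
  have s1: "wp (scan rOne) (wp (WHILELE rRJ rT1 ?body ;; STORE rZ rVal) ?Q) w H (t + 3)"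
    by (rule wp_conseq[OF s0]) (intro wp_simps(7) loop)
  show ?thesis unfolding answer_def
    apply (rule wp_simps(7), rule wp_simps(2))
    apply (rule wp_simps(7), rule wp_simps(3))
    apply (rule wp_simps(7), rule wp_simps(5))
     using X0 nn[of 0] apply simp
    apply (rule wp_simps(7))
    using s1 X0 HR[of 0] by (simp add: w_def numeral_eq_Suc)
qed


section \<open>Reading the input and filling the initial table\<close>

definition "inp H \<longleftrightarrow> (\<forall>j<n. H (3 * int j + 1) = ptime (J ! j) \<and> H (3 * int j + 2) = rel (J ! j) \<and> H (3 * int j + 3) = dl (J ! j))"

definition "pre v \<longleftrightarrow> v rZ = 0 \<and> v rOne = 1 \<and> v rTwo = 2 \<and> v rThree = 3 \<and> v rN = int n \<and> v rA = 3 * int n \<and>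
  v rX0 = cell n 0 0 \<and> v rW = 3 * int n + 7 \<and> v rR = 4 \<and> v rNew = int n + 5 \<and> v rC = 2 * int n + 6"

lemma inp_encode: "inp (encode J)"
proof -
  have "(3 * int j) div 3 = int j" "(3 * int j + 1) div 3 = int j" "(3 * int j + 2) div 3 = int j"
    "(3 * int j) mod 3 = 0" "(3 * int j + 1) mod 3 = 1" "(3 * int j + 2) mod 3 = 2" for j by presburger+
  thus ?thesis by (auto simp: inp_def encode_def Let_def)
qed

lemma minmax_spec:
  assumes p: "pre v" and H: "inp H"
  shows "wp minmax (\<lambda>v' H' t'. H' = H \<and> v' rRel = r0 + 1 \<and> v' rT1 = T - 1 \<and> v' rT = T \<and> v' rXN = cell n n 0 \<and>
      t' \<le> t + 30 * Suc n \<and> keeps {5, 6, 13, 25, 33, 40, 45} v v') v H t" (is "wp _ ?Q _ _ _")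
proof -
  let ?F = "{5, 6, 13, 25, 33, 40, 45} :: nat set"
  define RS DS where "RS = rel ` set J" and "DS = dl ` set J"
  define I where "I i v' H' t' \<longleftrightarrow> H' = H \<and> v' rRel \<in> RS \<and> (\<forall>j<i. v' rRel \<le> rel (J ! j)) \<and>
      v' rT1 \<in> DS \<and> (\<forall>j<i. dl (J ! j) \<le> v' rT1) \<and> v' rXN = cell n i 0 \<and> v' rPR = 3 * int i + 1 \<and>
      t' \<le> t + 4 + 14 * i \<and> keeps ?F v v'" for i :: nat and v' :: regs and H' :: heap and t' :: nat
  have loop: "wp (WHILELE rPR rA minmax_body) (wp (ADD rT rT1 rOne) ?Q) v' H' t'" if "I 0 v' H' t'" for v' H' t'
  proof (rule wp_for[where I = I and N = n, OF that])
    fix i v1 H1 t1 assume i: "i < n" and I: "I i v1 H1 t1"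
    have fr: "\<And>x. x \<notin> ?F \<Longrightarrow> v1 x = v x" using I by (auto simp: I_def)
    have q: "v1 rZ = 0" "v1 rOne = 1" "v1 rTwo = 2" "v1 rThree = 3" "v1 rA = 3 * int n" "v1 rW = 3 * int n + 7"
      using fr p by (auto simp: pre_def)
    have h: "H (2 + 3 * int i) = rel (J ! i)" "H (3 + 3 * int i) = dl (J ! i)" using H i by (auto simp: inp_def add.commute)
    have m: "rel (J ! i) \<in> RS" "dl (J ! i) \<in> DS" using i by (auto simp: RS_def DS_def)
    show "v1 rPR \<le> v1 rA \<and> wp minmax_body (I (Suc i)) v1 H1 (t1 + 2)"
    proof
      show "v1 rPR \<le> v1 rA" using I q i by (simp add: I_def)
      show "wp minmax_body (I (Suc i)) v1 H1 (t1 + 2)" unfolding minmax_body_def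
        apply (intro wp_simps)
        using I q h m by (auto simp: I_def less_Suc_eq cell_next)
    qed
  next
    fix v1 H1 t1 assume I: "I n v1 H1 t1"
    have fr: "\<And>x. x \<notin> ?F \<Longrightarrow> v1 x = v x" using I by (auto simp: I_def)
    have q: "v1 rA = 3 * int n" "v1 rOne = 1" using fr p by (auto simp: pre_def)
    have "Min (rel ` set J) = v1 rRel"
    proof (rule Min_eqI)
      fix y assume "y \<in> rel ` set J"
      then obtain j where "j < n" "y = rel (J ! j)" by (metis imageE in_set_conv_nth)
      thus "v1 rRel \<le> y" using I by (simp add: I_def)
    qed (use I in \<open>auto simp: I_def RS_def DS_def\<close>)
    hence r: "v1 rRel = r0 + 1" by (simp add: r0_def)
    have "Max (dl ` set J) = v1 rT1"
    proof (rule Max_eqI)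
      fix y assume "y \<in> dl ` set J"
      then obtain j where "j < n" "y = dl (J ! j)" by (metis imageE in_set_conv_nth)
      thus "y \<le> v1 rT1" using I by (simp add: I_def)
    qed (use I in \<open>auto simp: I_def RS_def DS_def\<close>)
    hence T: "v1 rT1 = T - 1" by (simp add: T_def)
    show "\<not> v1 rPR \<le> v1 rA \<and> wp (ADD rT rT1 rOne) ?Q v1 H1 (t1 + 2)"
      using I q r T by (auto simp: I_def intro!: wp_simps(3))
  qed
  have 0: "H 2 = rel (J ! 0)" "H 3 = dl (J ! 0)" using H ne by (auto simp: inp_def)
  have m: "rel (J ! 0) \<in> RS" "dl (J ! 0) \<in> DS" using ne by (auto simp: RS_def DS_def)
  show ?thesis unfolding minmax_def
    apply (intro wp_simps)
      using p apply (simp add: pre_def)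
     using p apply (simp add: pre_def)
    apply (rule loop)
    using p 0 m by (auto simp: I_def pre_def)
qed

text \<open>The row before any job is treated: no release visible, and in the first block the values
  of \<open>mreach_Nil\<close>. The work \<open>w\<close> is left open because row 0 belongs to no
  job.\<close>

definition "rowok \<rho> d w i H \<longleftrightarrow> H (cell n i 0) = \<rho> \<and> H (cell n i 1) = T \<and> H (cell n i 2) = d \<and> H (cell n i 3) = w \<and>
  (\<forall>x\<le>n. H (cell n i (4 + int x)) = (if x = 0 then \<rho> else T))"

lemma fillrow_spec:
  assumes p: "v rOne = 1" "v rTwo = 2" "v rThree = 3" "v rN = int n" "v rR = 4" "v rT = T" "v rX = cell n i 0"
  shows "wp fillrow (\<lambda>v' H' t'. rowok (v rRel) (v rD) (v rP) i H' \<and>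
      (\<forall>k. (\<forall>q. 0 \<le> q \<and> q < 3 * int n + 7 \<longrightarrow> k \<noteq> cell n i q) \<longrightarrow> H' k = H k) \<and>
      t' \<le> t + 20 * Suc n \<and> keeps {25, 41, 45} v v') v H t" (is "wp _ ?Q _ _ _")
proof -
  define I where "I h v' H' t' \<longleftrightarrow> H' (cell n i 0) = v rRel \<and> H' (cell n i 1) = T \<and> H' (cell n i 2) = v rD \<and> H' (cell n i 3) = v rP \<and>
      (\<forall>x\<le>h. H' (cell n i (4 + int x)) = (if x = 0 then v rRel else T)) \<and>
      (\<forall>k. (\<forall>q. 0 \<le> q \<and> q < 3 * int n + 7 \<longrightarrow> k \<noteq> cell n i q) \<longrightarrow> H' k = H k) \<and>
      v' rPC = cell n i (5 + int h) \<and> v' rPE = cell n i (4 + int n) \<and>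
      t' \<le> t + 11 + 4 * h \<and> keeps {25, 41, 45} v v'" for h :: nat and v' :: regs and H' :: heap and t' :: nat
  have loop: "wp (WHILELE rPC rPE (STORE rPC rT ;; ADD rPC rPC rOne)) ?Q v' H' t'" if "I 0 v' H' t'" for v' H' t'
  proof (rule wp_for[where I = I and N = n, OF that])
    fix h v1 H1 t1 assume h: "h < n" and I: "I h v1 H1 t1"
    have q: "v1 rOne = 1" "v1 rT = T" using I p by (auto simp: I_def)
    have nn: "0 \<le> cell n i (5 + int h)" by (auto intro: cell_nonneg)
    define H2 where "H2 = H1(cell n i (5 + int h) := T)"
    have h2: "H2 (cell n i r) = (if r = 5 + int h then T else H1 (cell n i r))" for r by (simp add: H2_def)
    have fm: "H2 k = H k" if k: "\<forall>q. 0 \<le> q \<and> q < 3 * int n + 7 \<longrightarrow> k \<noteq> cell n i q" for k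
    proof -
      have "k \<noteq> cell n i (5 + int h)" using k h by auto
      thus ?thesis using I k by (simp add: I_def H2_def)
    qed
    have I2: "I (Suc h) (v1(rPC := v1 rPC + 1)) H2 (t1 + 4)"
      using I fm unfolding I_def by (auto simp: h2 le_Suc_eq)
    show "v1 rPC \<le> v1 rPE \<and> wp (STORE rPC rT ;; ADD rPC rPC rOne) (I (Suc h)) v1 H1 (t1 + 2)"
    proof
      show "v1 rPC \<le> v1 rPE" using I h by (simp add: I_def)
      show "wp (STORE rPC rT ;; ADD rPC rPC rOne) (I (Suc h)) v1 H1 (t1 + 2)"
        apply (intro wp_simps)
        using I q nn I2 by (auto simp: I_def H2_def)
    qed
  next
    fix v1 H1 t1 assume I: "I n v1 H1 t1"
    thus "\<not> v1 rPC \<le> v1 rPE \<and> ?Q v1 H1 (t1 + 2)" by (auto simp: I_def rowok_def)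
  qed
  have nn: "0 \<le> cell n i q" if "0 \<le> q" for q using that by (rule cell_nonneg)
  have fm: "(H(cell n i 0 := x0, cell n i 1 := x1, cell n i 2 := x2, cell n i 3 := x3, cell n i 4 := x4)) k = H k"
    if "\<forall>q. 0 \<le> q \<and> q < 3 * int n + 7 \<longrightarrow> k \<noteq> cell n i q" for k x0 x1 x2 x3 x4
    using that[rule_format, of 0] that[rule_format, of 1] that[rule_format, of 2] that[rule_format, of 3] that[rule_format, of 4] by simp
  show ?thesis unfolding fillrow_def
    apply (intro wp_simps; (rule loop)?)
    using p nn fm by (auto simp: I_def simp del: fun_upd_apply) (auto simp: fun_upd_apply)
qed

lemma fillrows_spec:
  assumes p: "pre v" "v rRel = r0 + 1" "v rT = T" and H: "inp H"
  shows "wp fillrows (\<lambda>v' H' t'. hinv [] 4 H' \<and>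
      t' \<le> t + 60 * Suc n ^ 2 \<and> keeps {23, 25, 32, 33, 34, 40, 41, 45} v v') v H t" (is "wp _ ?Q _ _ _")
proof -
  let ?F = "{23, 25, 32, 33, 34, 40, 41, 45} :: nat set"
  let ?d = "\<lambda>i. if i = 0 then T else dl (J ! (i - 1))"
  have keep: "rowok \<rho> d w i' H2" if "rowok \<rho> d w i' H1" "i' \<noteq> i"
    "\<forall>k. (\<forall>q. 0 \<le> q \<and> q < 3 * int n + 7 \<longrightarrow> k \<noteq> cell n i q) \<longrightarrow> H2 k = H1 k" for \<rho> d w i i' H1 H2
  proof -
    have "H2 (cell n i' q) = H1 (cell n i' q)" if q: "0 \<le> q" "q < 3 * int n + 7" for q
    proof -
      have "\<forall>q'. 0 \<le> q' \<and> q' < 3 * int n + 7 \<longrightarrow> cell n i' q \<noteq> cell n i q'" using cell_eq[OF q] \<open>i' \<noteq> i\<close> by blast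
      thus ?thesis using \<open>\<forall>k. _ k \<longrightarrow> H2 k = H1 k\<close> by blast
    qed
    thus ?thesis using that(1) unfolding rowok_def by auto
  qed
  have keepi: "inp H2" if "inp H1" "\<forall>k. (\<forall>q. 0 \<le> q \<and> q < 3 * int n + 7 \<longrightarrow> k \<noteq> cell n i q) \<longrightarrow> H2 k = H1 k" for i H1 H2
  proof -
    have "H2 k = H1 k" if "k \<le> 3 * int n" for k
    proof -
      have "k \<noteq> cell n i q" if "0 \<le> q" for q using cell_gt_input[OF that, of n i] \<open>k \<le> 3 * int n\<close> by auto
      thus ?thesis using \<open>\<forall>k. _ k \<longrightarrow> H2 k = H1 k\<close> by blast
    qed
    thus ?thesis using that(1) unfolding inp_def by auto
  qed
  define I where "I i v' H' t' \<longleftrightarrow> inp H' \<and> (\<forall>i'\<le>i. \<exists>w. rowok (rr i') (?d i') w i' H' \<and> (0 < i' \<longrightarrow> w = ptime (J ! (i' - 1)))) \<and>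
      v' rX = cell n i 0 \<and> v' rPR = 3 * int i + 1 \<and>
      t' \<le> t + 10 + 20 * Suc n + i * (35 * Suc n) \<and> keeps ?F v v'" for i :: nat and v' :: regs and H' :: heap and t' :: nat
  let ?body = "ADD rX rX rW ;; LOAD rP rPR ;; ADD rPR rPR rOne ;; LOAD rRel rPR ;;
       ADD rPR rPR rOne ;; LOAD rD rPR ;; ADD rPR rPR rOne ;; fillrow"
  have loop: "wp (WHILELE rPR rA ?body) ?Q v' H' t'" if "I 0 v' H' t'" for v' H' t'
  proof (rule wp_for[where I = I and N = n, OF that])
    fix i v1 H1 t1 assume i: "i < n" and I: "I i v1 H1 t1"
    have fr: "\<And>x. x \<notin> ?F \<Longrightarrow> v1 x = v x" and i1: "inp H1" using I by (auto simp: I_def)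
    have q: "v1 rOne = 1" "v1 rTwo = 2" "v1 rThree = 3" "v1 rN = int n" "v1 rR = 4" "v1 rT = T" "v1 rW = 3 * int n + 7" "v1 rA = 3 * int n"
      using fr p by (auto simp: pre_def)
    have h: "H1 (3 * int i + 1) = ptime (J ! i)" "H1 (3 * int i + 2) = rel (J ! i)" "H1 (3 * int i + 3) = dl (J ! i)"
      using i1 i by (auto simp: inp_def)
    show "v1 rPR \<le> v1 rA \<and> wp ?body (I (Suc i)) v1 H1 (t1 + 2)"
    proof
      show "v1 rPR \<le> v1 rA" using I q i by (simp add: I_def)
      define w where "w = v1(rX := cell n (Suc i) 0, rP := ptime (J ! i), rRel := rel (J ! i), rD := dl (J ! i), rPR := 3 * int (Suc i) + 1)"
      have fill: "wp fillrow (I (Suc i)) w H1 (t1 + 9)"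
      proof (rule wp_conseq[OF fillrow_spec[where v = w and i = "Suc i" and H = H1 and t = "t1 + 9"]])
        fix v2 H2 t2 assume A: "rowok (w rRel) (w rD) (w rP) (Suc i) H2 \<and>
          (\<forall>k. (\<forall>q. 0 \<le> q \<and> q < 3 * int n + 7 \<longrightarrow> k \<noteq> cell n (Suc i) q) \<longrightarrow> H2 k = H1 k) \<and>
          t2 \<le> t1 + 9 + 20 * Suc n \<and> keeps {25, 41, 45} w v2"
        have fr2: "v2 x = w x" if "x \<notin> {25, 41, 45}" for x using A that by blast
        have "\<exists>w'. rowok (rr i') (?d i') w' i' H2 \<and> (0 < i' \<longrightarrow> w' = ptime (J ! (i' - 1)))" if i': "i' \<le> Suc i" for i'
        proof (cases "i' = Suc i")
          case True
          thus ?thesis using A by (intro exI[of _ "ptime (J ! i)"]) (auto simp: w_def rr_def)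
        next
          case False
          then obtain w' where "rowok (rr i') (?d i') w' i' H1" "0 < i' \<longrightarrow> w' = ptime (J ! (i' - 1))"
            using I i' by (auto simp: I_def le_Suc_eq)
          thus ?thesis using keep[of _ _ _ i' H1 "Suc i" H2] A False by blast
        qed
        moreover have "inp H2" using keepi[OF i1] A by blast
        moreover have "v2 rX = cell n (Suc i) 0" "v2 rPR = 3 * int (Suc i) + 1" using fr2 by (auto simp: w_def)
        moreover have "v2 x = v x" if "x \<notin> ?F" for x using fr2[of x] fr[OF that] that by (auto simp: w_def)
        moreover have "t2 \<le> t + 10 + 20 * Suc n + Suc i * (35 * Suc n)"
        proof -
          have arith: "t2 \<le> t + 10 + 20 * N + X" if "X = Y + 35 * N" "t1 \<le> t + 10 + 20 * N + Y" "t2 \<le> t1 + 9 + 20 * N" "1 \<le> N"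
            for X Y N :: nat using that by linarith
          show ?thesis
          proof (rule arith)
            show "Suc i * (35 * Suc n) = i * (35 * Suc n) + 35 * Suc n" by simp
            show "t1 \<le> t + 10 + 20 * Suc n + i * (35 * Suc n)" using I unfolding I_def by blast
          qed (use A in auto)
        qed
        ultimately show "I (Suc i) v2 H2 t2" unfolding I_def by blast
      qed (use q in \<open>auto simp: w_def\<close>)
      show "wp ?body (I (Suc i)) v1 H1 (t1 + 2)"
      proof -
        have nn: "0 \<le> v1 rPR" "v1 rPR = 3 * int i + 1" "v1 rX = cell n i 0" using I by (auto simp: I_def)
        have fill': "wp fillrow (I (Suc i)) w' H1 t'" if "w' = w" "t' = t1 + 9" for w' t' using fill that by simp
        have h': "H1 (3 * int i + 1 + 1) = rel (J ! i)" "H1 (3 * int i + 1 + 1 + 1) = dl (J ! i)"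
          using h(2,3) by (simp_all add: add.assoc)
        show ?thesis
          apply (rule wp_simps(7), rule wp_simps(3))
          apply (rule wp_simps(7), rule wp_simps(5))
           using nn apply simp
          apply (rule wp_simps(7), rule wp_simps(3))
          apply (rule wp_simps(7), rule wp_simps(5))
           using nn q apply simp
          apply (rule wp_simps(7), rule wp_simps(3))
          apply (rule wp_simps(7), rule wp_simps(5))
           using nn q apply simp
          apply (rule wp_simps(7), rule wp_simps(3))
          apply (rule fill')
           using nn q h(1) h' by (auto simp: w_def cell_next fun_eq_iff simp del: add_Suc_right)
      qed
    qed
  next
    fix v1 H1 t1 assume I: "I n v1 H1 t1"
    have "v1 rA = 3 * int n" using I p by (auto simp: I_def pre_def)
    hence "\<not> v1 rPR \<le> v1 rA" using I by (auto simp: I_def)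
    moreover have "hinv [] 4 H1" unfolding hinv_def
    proof (intro allI impI conjI)
      fix i assume i: "i \<le> n"
      obtain w where w: "rowok (rr i) (?d i) w i H1" "0 < i \<longrightarrow> w = ptime (J ! (i - 1))" using I i by (auto simp: I_def)
      show "H1 (cell n i 0) = rr i" "H1 (cell n i 1) = fa [] i" "H1 (cell n i 2) = fd [] i"
        "0 < i \<Longrightarrow> H1 (cell n i 3) = ptime (J ! (i - 1))" using w by (auto simp: rowok_def fa_def fd_def)
      fix x assume "x \<le> n"
      thus "H1 (cell n i (4 + int x)) = mreach T (jss []) (rr i) x"
        using w mreach_Nil[OF rr_lt_T[OF i], of x] by (auto simp: rowok_def jss_def)
    qed
    moreover have "t1 + 2 \<le> t + 60 * Suc n ^ 2"
    proof -
      have arith: "t1 + 2 \<le> t + 60 * q" if "N \<le> q" "M \<le> q" "t1 \<le> t + 10 + 20 * N + X" "X + 35 * N = 35 * q" "1 \<le> N"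
        for N X q M :: nat using that by linarith
      show ?thesis
      proof (rule arith)
        show "Suc n \<le> Suc n ^ 2" "Suc n \<le> Suc n ^ 2" "n * (35 * Suc n) + 35 * Suc n = 35 * Suc n ^ 2"
          by (auto simp: power2_eq_square algebra_simps)
        show "t1 \<le> t + 10 + 20 * Suc n + n * (35 * Suc n)" using I by (auto simp: I_def)
      qed simp
    qed
    ultimately show "\<not> v1 rPR \<le> v1 rA \<and> ?Q v1 H1 (t1 + 2)" using I by (auto simp: I_def)
  qed
  define v0 where "v0 = v(rRel := r0, rD := T, rX := cell n 0 0)"
  have fill: "wp fillrow (wp (ADD rPR rOne rZ ;; WHILELE rPR rA ?body) ?Q) v0 H (t + 3)"
  proof (rule wp_conseq[OF fillrow_spec[where v = v0 and i = 0 and H = H and t = "t + 3"]])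
    fix v2 H2 t2 assume A: "rowok (v0 rRel) (v0 rD) (v0 rP) 0 H2 \<and>
      (\<forall>k. (\<forall>q. 0 \<le> q \<and> q < 3 * int n + 7 \<longrightarrow> k \<noteq> cell n 0 q) \<longrightarrow> H2 k = H k) \<and>
      t2 \<le> t + 3 + 20 * Suc n \<and> keeps {25, 41, 45} v0 v2"
    have fr2: "v2 x = v0 x" if "x \<notin> {25, 41, 45}" for x using A that by blast
    have "inp H2" using keepi[OF H] A by blast
    moreover have "rowok (rr 0) T (v0 rP) 0 H2" using A by (simp add: v0_def rr_def)
    moreover have "v2 rZ = 0" "v2 rOne = 1" "v2 rX = cell n 0 0" using fr2 p by (auto simp: v0_def pre_def)
    moreover have "v2 x = v x" if "x \<notin> ?F" for x using fr2[of x] that by (auto simp: v0_def)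
    ultimately have "I 0 (v2(rPR := v2 rOne + v2 rZ)) H2 (t2 + 1)" using A unfolding I_def by auto
    thus "wp (ADD rPR rOne rZ ;; WHILELE rPR rA ?body) ?Q v2 H2 t2"
      by (intro wp_simps(7) wp_simps(3) loop)
  qed (use p in \<open>auto simp: v0_def pre_def\<close>)
  have eq: "v(rRel := r0, rD := T, rX := cell n 0 0) = v0" by (simp add: v0_def)
  show ?thesis unfolding fillrows_def
    apply (rule wp_simps(7), rule wp_simps(4))
    apply (rule wp_simps(7), rule wp_simps(3))
    apply (rule wp_simps(7), rule wp_simps(3))
    apply (rule wp_simps(7))
    using fill eq p by (simp add: pre_def numeral_eq_Suc)
qed

text \<open>The constant 500 covers 300 for the levels and 20, 30, 60 and 60 for layout, bounds,
  initial table and answer, which are of lower order.\<close>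

lemma main_spec: "wp main (\<lambda>v H t. H 0 = int (opt_gaps J) \<and> t \<le> 500 * (n + 1) ^ 5) (\<lambda>_. 0) (encode J) 0" (is "wp _ ?Q _ _ _")
proof -
  have n1: "1 \<le> int n" using ne by (cases J) auto
  have rest: "wp minmax (wp (fillrows ;; levels ;; answer) ?Q) v (encode J) t" if p: "pre v" and t: "t \<le> 20" for v t
  proof (rule wp_conseq[OF minmax_spec[OF p inp_encode, of t]])
    fix v1 H1 t1 assume A: "H1 = encode J \<and> v1 rRel = r0 + 1 \<and> v1 rT1 = T - 1 \<and> v1 rT = T \<and> v1 rXN = cell n n 0 \<and>
      t1 \<le> t + 30 * Suc n \<and> keeps {5, 6, 13, 25, 33, 40, 45} v v1"
    have fr1: "v1 x = v x" if "x \<notin> {5, 6, 13, 25, 33, 40, 45}" for x using A that by blast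
    have p1: "pre v1" "v1 rRel = r0 + 1" "v1 rT = T" "inp H1" using p fr1 A inp_encode by (auto simp: pre_def)
    show "wp (fillrows ;; levels ;; answer) ?Q v1 H1 t1"
    proof (rule wp_simps(7), rule wp_conseq[OF fillrows_spec[OF p1, of t1]])
      fix v2 H2 t2 assume B: "hinv [] 4 H2 \<and> t2 \<le> t1 + 60 * Suc n ^ 2 \<and>
        keeps {23, 25, 32, 33, 34, 40, 41, 45} v1 v2"
      have fr2: "v2 x = v1 x" if "x \<notin> {23, 25, 32, 33, 34, 40, 41, 45}" for x using B that by blast
      have c2: "cst n T v2" "v2 rR = 4" "v2 rNew = int n + 5" using p1(1) fr2 A by (auto simp: pre_def cst_def)
      have o: "offs n 4 (int n + 5)" by (simp add: offs_def)
      have hv: "hinv [] 4 H2" using B by blast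
      show "wp (levels ;; answer) ?Q v2 H2 t2"
      proof (rule wp_simps(7), rule wp_conseq[OF levels_spec[OF o c2 hv, of t2]])
        fix v3 H3 t3 assume D: "(\<exists>ks. lvl ks \<and> length ks = n \<and> hinv ks (v3 rR) H3) \<and> (v3 rR = 4 \<or> v3 rR = int n + 5) \<and>
          cst n T v3 \<and> t3 \<le> t2 + 300 * Suc n ^ 5"
        then obtain ks where ks: "lvl ks" "length ks = n" "hinv ks (v3 rR) H3" by blast
        have c3: "cst n T v3" "v3 rR = 4 \<or> v3 rR = int n + 5" using D by auto
        show "wp answer ?Q v3 H3 t3"
        proof (rule wp_conseq[OF answer_spec[OF c3 ks, of t3]])
          fix v4 :: regs and H4 :: heap and t4 :: nat assume E: "H4 0 = int (opt_gaps J) \<and> t4 \<le> t3 + 60 * Suc n ^ 2"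
          have arith: "t4 \<le> 500 * q" if "N \<le> q" "M \<le> q" "1 \<le> q" "t1 \<le> t + 30 * N" "t2 \<le> t1 + 60 * M" "t3 \<le> t2 + 300 * q" "t4 \<le> t3 + 60 * M"
            for N M q :: nat using that t by linarith
          have "t4 \<le> 500 * Suc n ^ 5"
          proof (rule arith)
            show "Suc n \<le> Suc n ^ 5" "Suc n ^ 2 \<le> Suc n ^ 5" "1 \<le> Suc n ^ 5"
              using power_increasing[of 1 5 "Suc n"] power_increasing[of 2 5 "Suc n"] by auto
          qed (use A B D E in auto)
          thus "?Q v4 H4 t4" using E by simp
        qed
      qed
    qed
  qed
  have e0: "encode J 0 = int n" by (simp add: encode_def)
  show ?thesis unfolding main_def layout_def
    apply (intro wp_simps; (rule rest)?)
    using e0 n1 by (auto simp: pre_def cell_def)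
qed

end

lemma opt_gaps_Nil: "opt_gaps [] = 0"
proof -
  have "feasible_schedule [] (\<lambda>_. None)" "num_gaps (\<lambda>_. None) = 0"
    by (auto simp: feasible_schedule_def num_gaps_def gaps_def)
  hence "\<exists>S. feasible_schedule [] S \<and> num_gaps S = 0" by blast
  thus ?thesis unfolding opt_gaps_def by (rule Least_eq_0)
qed

theorem theorem2:
  shows "\<exists>(P :: prog) (C :: nat). \<forall>J :: job list.
           valid_instance J \<and> feasible_instance J \<longrightarrow>
           computes_within P J (C * (length J + 1) ^ 5) (int (opt_gaps J))"
proof (intro exI allI impI)
  fix J :: "job list" assume a: "valid_instance J \<and> feasible_instance J"
  show "computes_within (comp main 0) J (500 * (length J + 1) ^ 5) (int (opt_gaps J))"
  proof (cases "J = []")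
    case True
    \<comment> \<open>The empty instance lies outside the locale, as \<open>T\<close> and
      \<open>r0\<close> are extrema over the jobs. The program then skips everything, and cell 0
      still holds the number 0 of jobs, which is also the optimum.\<close>
    have "wp main (\<lambda>v H t. H 0 = int (opt_gaps []) \<and> t \<le> 500 * (length ([] :: job list) + 1) ^ 5) (\<lambda>_. 0) (encode []) 0"
      unfolding main_def
      apply (intro wp_simps)
      by (auto simp: encode_def opt_gaps_Nil)
    thus ?thesis using True computes_within_wp by blast
  next
    case False
    then interpret inst J using a by unfold_locales auto
    show ?thesis using main_spec by (rule computes_within_wp)
  qed
qed

end
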